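(* Consider the catalytic branching random walk on $\mathbb{Z}$ branching at the origin only, started from one particle at the origin, with offspring variable $N$ of mean $m$ and underlying irreducible random walk $(S_n)_{n\ge0}$. Assume $m(1-q_{esc})>1$ and let $r>0$ be the unique solution of $m\,\mathbb{E}[e^{-r\tau}]=1$. Let $\psi(t)=\log\mathbb{E}[e^{tS_1}]$ and $\zeta=\sup\{t>0:\psi(t)<\infty\}$, and assume that $\zeta>0$ and that there exists $t_0\in(0,\zeta)$ with $\psi(t_0)=r$; let $\alpha:=\psi(t_0)/t_0$. Assume furthermore that $\mathbb{E}[N^2]<\infty$ and that $S$ is aperiodic. Then there exist a constant $c_*>0$ and a non-negative random variable $\Lambda_\infty$ with $$\{\Lambda_\infty>0\}=\mathcal{S}\quad\text{a.s.}$$ such that the following hold. (a) For every fixed $y\in\mathbb{R}$, $$\mathbb{P}(M_n-\alpha n>y)=\mathbb{E}\Big[1-\exp\Big(-c_*\,e^{-t_0y}\big(e^{t_0\{\alpha n+y\}}+o(1)\big)\Lambda_\infty\Big)\Big],$$ where $o(1)$ denotes a deterministic term tending to $0$ as $n\to\infty$; that is, there is a deterministic real sequence $(\varepsilon_n)$ (possibly depending on $y$) with $\varepsilon_n\to0$ such that the identity holds, with $\varepsilon_n$ in place of $o(1)$, for all sufficiently large $n$. (b) Consequently, for every subsequence $n_j\to\infty$ such that $\{\alpha n_j\}\to s$ for some $s\in[0,1)$, and for every $y\in\mathbb{Z}$, $$\lim_{j\to\infty}\mathbb{P}\big(M_{n_j}-\lfloor\alpha n_j\rfloor=y\big)=\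mathbb{E}\Big[e^{-c_*e^{-t_0(y-s)}\Lambda_\infty}-e^{-c_*e^{-t_0(y-1-s)}\Lambda_\infty}\Big].$$
   Context: Underlying walk: $(S_n)_{n\ge0}$ is an irreducible random walk on $\mathbb{Z}$ (partial sums of i.i.d. integer-valued steps); $\mathbb{P}_x$ is the law when started from $x$, $\mathbb{P}=\mathbb{P}_0$. $\tau:=\inf\{n\ge1:S_n=0\}$ (with $\inf\emptyset=+\infty$), $q_{esc}:=\mathbb{P}(\tau=+\infty)\in[0,1)$, and $e^{-r\tau}=0$ if $\tau=+\infty$. Aperiodic means $\gcd\{n\ge1:\mathbb{P}(\tau=n)>0\}=1$. Catalytic branching random walk (CBRW): $N$ is a random variable with values in $\{0,1,2,\dots\}$ and finite mean $m=\mathbb{E}[N]$. The system starts at time $0$ with one particle at $0$. A particle located at $x\ne0$ moves according to the transition probabilities of $S$, independently of the others. A particle located at $0$ at time $t$ dies at time $t+1$ and gives birth to new particles located at $S^{(1)}_1,\dots,S^{(N)}_1$, where the $(S^{(i)}_n)_{n\ge0}$, $i\ge1$, are i.i.d. copies of $(S_n)_{n\ge0}$ started from $0$, independent of $N$; different particles at the origin reproduce independently of each other and of the rest of the system up to time $t$. $\{X_u:|u|=n\}$ denotes the positions of the particles alive at time $n$. $M_n:=\sup_{|u|=n}X_u$, with $\sup\emptyset:=-\infty$. $\mathcal{S}$ is the event that, for infinitely many $n$, there is a particle $u$ with $|u|=n$ and $X_u=0$. For real $x$, $\lfloor x\rfloor$ is the integer part and $\{x\}:=x-\lfloor x\rfloor\in[0,1)$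 the fractional part. *)

theory Defs
  imports "HOL-Probability.Probability"
begin

section \<open>The underlying random walk\<close>

text \<open>Law on path space of the walk with step distribution \<open>p\<close> started from \<open>x\<close>; it is
  written \<open>P_x\<close> below.\<close>

definition walk_law :: "int pmf \<Rightarrow> int \<Rightarrow> (nat \<Rightarrow> int) measure" where
  "walk_law p x =
     distr (\<Pi>\<^sub>M i\<in>(UNIV :: nat set). measure_pmf p) (\<Pi>\<^sub>M i\<in>(UNIV :: nat set). count_space UNIV)
       (\<lambda>\<xi> n. x + (\<Sum>i<n. \<xi> i))"

definition irreducible_walk :: "int pmf \<Rightarrow> bool" where
  "irreducible_walk p \<longleftrightarrow> (\<forall>x y. \<exists>n. measure (walk_law p x) {S. S n = y} > 0)"

text \<open>In \<^typ>\<open>enat\<close>, the infimum of the empty set is \<open>\<infinity>\<close>.\<close>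

definition return_time :: "(nat \<Rightarrow> int) \<Rightarrow> enat" where
  "return_time S = (INF n\<in>{n. n \<ge> 1 \<and> S n = 0}. enat n)"

definition aperiodic_walk :: "int pmf \<Rightarrow> bool" where
  "aperiodic_walk p \<longleftrightarrow>
     Gcd {n :: nat. n \<ge> 1 \<and> measure (walk_law p 0) {S. return_time S = enat n} > 0} = 1"

definition q_esc :: "int pmf \<Rightarrow> real" where
  "q_esc p = measure (walk_law p 0) {S. return_time S = \<infinity>}"

fun discount :: "real \<Rightarrow> enat \<Rightarrow> real" where
  "discount r (enat n) = exp (- r * real n)"
| "discount r \<infinity> = 0"

definition return_laplace :: "int pmf \<Rightarrow> real \<Rightarrow> real" where
  "return_laplace p r = (\<integral>S. discount r (return_time S) \<partial>walk_law p 0)"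

text \<open>The log-Laplace transform of \<open>S\<^sub>1\<close> under \<open>P_0\<close>, with value \<open>\<infinity>\<close> where the expectation is infinite.\<close>

definition psi :: "int pmf \<Rightarrow> real \<Rightarrow> ereal" where
  "psi p t =
     (let L = \<integral>\<^sup>+ S. ennreal (exp (t * real_of_int (S 1))) \<partial>walk_law p 0
      in if L = \<infinity> then \<infinity> else ereal (ln (enn2real L)))"

definition zeta :: "int pmf \<Rightarrow> ereal" where
  "zeta p = Sup (ereal ` {t. t > 0 \<and> psi p t < \<infinity>})"


section \<open>The catalytic branching random walk\<close>

text \<open>Particles are labelled by finite sequences of natural numbers, the most recent index coming
  first, so that \<open>i # u\<close> is the \<open>i\<close>-th child of \<open>u\<close> and \<open>length u\<close> is the time at which \<open>u\<close> is
  alive. A particle that merely moves (outside the origin) is relabelled as its own only child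
  \<open>0 # u\<close>. Each potential label \<open>u\<close> carries an offspring number \<open>N u\<close>, used only if \<open>u\<close> sits at
  the origin, and the displacement \<open>\<xi> u\<close> of \<open>u\<close> from its parent's position (\<open>\<xi> []\<close> is not used).
  The functions below are for one fixed outcome.\<close>

primrec position :: "(nat list \<Rightarrow> int) \<Rightarrow> nat list \<Rightarrow> int" where
  "position \<xi> [] = 0"
| "position \<xi> (i # u) = position \<xi> u + \<xi> (i # u)"

primrec alive :: "(nat list \<Rightarrow> nat) \<Rightarrow> (nat list \<Rightarrow> int) \<Rightarrow> nat list \<Rightarrow> bool" where
  "alive N \<xi> [] = True"
| "alive N \<xi> (i # u) \<longleftrightarrow>
     alive N \<xi> u \<and> (if position \<xi> u = 0 then i < N u else i = 0)"

definition particles :: "(nat list \<Rightarrow> nat) \<Rightarrow> (nat list \<Rightarrow> int) \<Rightarrow> nat \<Rightarrow> nat list set" where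
  "particles N \<xi> n = {u. length u = n \<and> alive N \<xi> u}"

text \<open>In \<^typ>\<open>ereal\<close>, the supremum of the empty set is \<open>-\<infinity>\<close>.\<close>

definition rightmost :: "(nat list \<Rightarrow> nat) \<Rightarrow> (nat list \<Rightarrow> int) \<Rightarrow> nat \<Rightarrow> ereal" where
  "rightmost N \<xi> n = (SUP u\<in>particles N \<xi> n. ereal (real_of_int (position \<xi> u)))"

definition origin_visited_io :: "(nat list \<Rightarrow> nat) \<Rightarrow> (nat list \<Rightarrow> int) \<Rightarrow> bool" where
  "origin_visited_io N \<xi> \<longleftrightarrow> (\<exists>\<^sub>\<infinity>n. \<exists>u\<in>particles N \<xi> n. position \<xi> u = 0)"

text \<open>The random input: the pairs \<open>(N u, \<xi> u)\<close> are i.i.d. over all labels, with independent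
  components distributed according to the offspring law and the step law.\<close>

locale cbrw = prob_space P
  for P :: "'a measure" and offs :: "nat pmf" and step :: "int pmf"
    and N :: "nat list \<Rightarrow> 'a \<Rightarrow> nat" and \<xi> :: "nat list \<Rightarrow> 'a \<Rightarrow> int" +
  assumes indep_input:
      "indep_vars (\<lambda>_. count_space UNIV) (\<lambda>u \<omega>. (N u \<omega>, \<xi> u \<omega>)) UNIV"
    and law_input:
      "distr P (count_space UNIV) (\<lambda>\<omega>. (N u \<omega>, \<xi> u \<omega>)) = measure_pmf (pair_pmf offs step)"
begin

definition M :: "nat \<Rightarrow> 'a \<Rightarrow> ereal" where
  "M n \<omega> = rightmost (\<lambda>u. N u \<omega>) (\<lambda>u. \<xi> u \<omega>) n"

definition survival :: "'a set" where
  "survival = {\<omega> \<in> space P. origin_visited_io (\<lambda>u. N u \<omega>) (\<lambda>u. \<xi> u \<omega>)}"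

end

end

theory Submission
  imports Defs "HOL-Computational_Algebra.Formal_Power_Series"
begin

text \<open>The limit is produced by particles that left the origin long ago and never came back. Write
  \<open>r\<close> for the Malthusian parameter, \<open>\<phi> x = E\<^sub>x[e\<^bsup>-r\<sigma>\<^esup>]\<close> with \<open>\<sigma> \<ge> 0\<close> the first visit to the
  origin, and \<open>\<alpha> = r / t0\<close>. The function \<open>\<phi>\<close> is an eigenfunction, with eigenvalue \<open>e\<^sup>r\<close>, of the
  operator that maps \<open>f\<close> to the expected sum of \<open>f\<close> over the particles of the next generation.
  Hence \<open>W\<^sub>n = e\<^bsup>-rn\<^esup> \<Sum> \<phi>(X\<^sub>u)\<close> is a martingale. Its increments have second moments of order
  \<open>e\<^bsup>-rn\<^esup>\<close>, so that it converges almost surely and in \<open>L\<^sup>1\<close> to a limit with mean 1, which is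
  \<open>\<Lambda>\<^sub>\<infinity>\<close>.

  The mean number of particles beyond \<open>k\<close> at time \<open>n\<close>, started from \<open>x\<close>, is
  \<open>e\<^bsup>-t0(k - \<alpha>n)\<^esup> (\<beta> \<phi>(x) + o(1))\<close> when \<open>k - \<alpha>n\<close> stays bounded (\<open>mean_above_limit\<close>). A
  decomposition at the last visit to the origin before time \<open>n\<close> expresses it as a convolution
  of a renewal sequence, whose inter-arrival law is \<open>m e\<^bsup>-ri\<^esup> P(\<tau> = i)\<close>, with the discounted
  mass that an escaping walk puts beyond \<open>k\<close>. The renewal sequence converges because \<open>\<tau>\<close> is
  aperiodic. The total escaping mass is \<open>(m - 1) \<Sum>\<^sub>i e\<^bsup>-ri\<^esup> P(S\<^sub>i > k)\<close>, and \<open>e\<^bsup>t0 k\<^esup>\<close> times the sum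
  converges because it solves a renewal equation for the step law tilted by \<open>e\<^bsup>t0 z - r\<^esup>\<close>. Both
  limits are instances of one renewal theorem on the integers (\<open>renewal_theorem\<close>), which is
  proved by a maximum principle. The constant of the theorem is \<open>\<beta>\<close>, the product of \<open>m - 1\<close>
  and the two limits. Excursions that last almost the whole time \<open>n\<close> are negligible because
  \<open>\<psi>(t0/2) < r/2\<close> (\<open>half_mgf_less\<close>).

  The probability \<open>v\<close> that some particle is beyond \<open>k\<close> differs from this mean by at most a
  constant times \<open>e\<^bsup>-2 t0(k - \<alpha>n)\<^esup> \<phi>(x)\<close>, by a second moment estimate (\<open>prob_above_lower\<close>). For
  a fixed generation \<open>j\<close> the branching property gives \<open>P(M\<^sub>n \<le> k) = E[\<Prod> (1 - v(X\<^sub>u))]\<close>, the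
  product being over the particles at time \<open>j\<close>. From the point of view of time \<open>j\<close> the barrier
  is \<open>\<alpha>j\<close> higher, so each factor is close to 1 and the product is close to
  \<open>exp(-\<beta> e\<^bsup>-t0(k - \<alpha>n)\<^esup> W\<^sub>j)\<close>, with an error of order \<open>e\<^bsup>-rj\<^esup>\<close> as \<open>n \<rightarrow> \<infinity>\<close>. Then \<open>j \<rightarrow> \<infinity>\<close>
  (\<open>max_limit\<close>). Both (a) and (b) follow: for (a) the error is moved inside the Laplace
  transform, which is strictly monotone.

  Finally \<open>{\<Lambda>\<^sub>\<infinity> > 0}\<close> is the survival event (\<open>Winf_pos_iff_survival\<close>). If the origin is
  visited only finitely often, the population is eventually constant in size and \<open>W\<^sub>n \<rightarrow> 0\<close>.
  Conversely, both \<open>P(survival)\<close> and \<open>P(\<Lambda>\<^sub>\<infinity> > 0)\<close> are positive roots of the equation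
  \<open>1 - E[(1 - \<rho> d)\<^sup>N] = d\<close> with \<open>\<rho> = P(\<tau> < \<infinity>)\<close>, and this equation has only one positive root.\<close>

section \<open>A renewal theorem on the integers\<close>

inductive_set additive_span :: "int set \<Rightarrow> int set" for A where
  zero: "0 \<in> additive_span A"
| add: "x \<in> additive_span A \<Longrightarrow> z \<in> A \<Longrightarrow> x + z \<in> additive_span A"

lemma integrable_pmf_bounded:
  fixes f :: "'a \<Rightarrow> real"
  assumes "\<And>x. \<bar>f x\<bar> \<le> B"
  shows "integrable (measure_pmf p) f"
  by (rule measure_pmf.integrable_const_bound[where B = B]) (use assms in auto)

text \<open>Where \<open>h\<close> almost attains its upper limit \<open>L\<close> at infinity, it is an average of values that
  asymptotically do not exceed \<open>L\<close>. Hence none of the values that carry positive weight can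
  stay below \<open>L\<close>.\<close>

lemma max_principle_step:
  fixes q :: "int pmf" and h :: "int \<Rightarrow> real" and x :: "nat \<Rightarrow> int"
  assumes bdd: "\<And>y. \<bar>h y\<bar> \<le> C"
    and upper: "\<And>e. e > 0 \<Longrightarrow> \<exists>B. \<forall>y\<ge>B. h y \<le> L + e"
    and harmonic: "\<And>y. y > 0 \<Longrightarrow> h y = (\<integral>z. h (y - z) \<partial>measure_pmf q)"
    and x: "filterlim x at_top sequentially"
    and lim: "(\<lambda>k. h (x k)) \<longlonglongrightarrow> L"
    and z: "z \<in> set_pmf q"
  shows "(\<lambda>k. h (x k - z)) \<longlonglongrightarrow> L"
proof -
  have int: "integrable (measure_pmf q) (\<lambda>w. h (y - w))" for y
    by (rule integrable_pmf_bounded[where B = C]) (use bdd in auto)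
  have over: "(\<lambda>k. max 0 (h (x k - w) - L)) \<longlonglongrightarrow> 0" for w
  proof (rule tendstoI)
    fix e :: real assume "e > 0"
    then obtain B where B: "\<forall>y\<ge>B. h y \<le> L + e/2" using upper[of "e/2"] by auto
    have "\<forall>\<^sub>F k in sequentially. x k \<ge> B + w"
      using x by (simp add: filterlim_at_top)
    then show "\<forall>\<^sub>F k in sequentially. dist (max 0 (h (x k - w) - L)) 0 < e"
    proof eventually_elim
      case (elim k)
      then have "h (x k - w) \<le> L + e/2" using B by auto
      then show ?case using \<open>e > 0\<close> by (auto simp: dist_real_def)
    qed
  qed
  have pos: "(\<lambda>k. \<integral>w. max 0 (h (x k - w) - L) \<partial>measure_pmf q) \<longlonglongrightarrow> (\<integral>w. 0 \<partial>measure_pmf q)"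
  proof (rule integral_dominated_convergence[where w = "\<lambda>_. C + \<bar>L\<bar>"])
    show "AE w in measure_pmf q. norm (max 0 (h (x k - w) - L)) \<le> C + \<bar>L\<bar>" for k
      using bdd[of "x k - w" for w] by (intro AE_I2) (smt (verit) real_norm_def)
  qed (use over in auto)
  have "\<forall>\<^sub>F k in sequentially. x k \<ge> 1" using x by (simp add: filterlim_at_top)
  then have "\<forall>\<^sub>F k in sequentially. h (x k) = (\<integral>w. h (x k - w) \<partial>measure_pmf q)"
    by eventually_elim (simp add: harmonic[symmetric])
  with lim have "(\<lambda>k. \<integral>w. h (x k - w) \<partial>measure_pmf q) \<longlonglongrightarrow> L"
    using Lim_transform_eventually by fastforce
  then have mean: "(\<lambda>k. L - (\<integral>w. h (x k - w) \<partial>measure_pmf q)) \<longlonglongrightarrow> 0"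
    using tendsto_diff[OF tendsto_const[of L]] by fastforce
  have split: "(\<integral>w. max 0 (L - h (x k - w)) \<partial>measure_pmf q)
      = (L - (\<integral>w. h (x k - w) \<partial>measure_pmf q)) + (\<integral>w. max 0 (h (x k - w) - L) \<partial>measure_pmf q)" for k
  proof -
    have "(\<integral>w. max 0 (L - h (x k - w)) \<partial>measure_pmf q)
        = (\<integral>w. (L - h (x k - w)) + max 0 (h (x k - w) - L) \<partial>measure_pmf q)"
      by (intro Bochner_Integration.integral_cong) auto
    also have "\<dots> = (\<integral>w. L - h (x k - w) \<partial>measure_pmf q) + (\<integral>w. max 0 (h (x k - w) - L) \<partial>measure_pmf q)"
      by (intro Bochner_Integration.integral_add) (use int in auto)
    finally show ?thesis using int by simp
  qed
  have under: "(\<lambda>k. \<integral>w. max 0 (L - h (x k - w)) \<partial>measure_pmf q) \<longlonglongrightarrow> 0"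
    unfolding split using tendsto_add[OF mean pos] by simp
  have p: "pmf q z > 0" using z by (simp add: pmf_positive)
  have atom: "max 0 (L - h (x k - z)) * pmf q z \<le> (\<integral>w. max 0 (L - h (x k - w)) \<partial>measure_pmf q)" for k
  proof -
    have "max 0 (L - h (x k - z)) * pmf q z = (\<integral>w. max 0 (L - h (x k - w)) * indicator {z} w \<partial>measure_pmf q)"
      by (subst integral_measure_pmf_real[of "{z}"]) (auto simp: indicator_def split: if_splits)
    also have "\<dots> \<le> (\<integral>w. max 0 (L - h (x k - w)) \<partial>measure_pmf q)"
    proof (intro integral_mono)
      show "integrable (measure_pmf q) (\<lambda>w. max 0 (L - h (x k - w)) * indicator {z} w)"
      proof (rule integrable_pmf_bounded[where B = "\<bar>L\<bar> + C"])
        show "\<bar>max 0 (L - h (x k - w)) * indicator {z} w\<bar> \<le> \<bar>L\<bar> + C" for w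
          using bdd[of "x k - w"] by (auto simp: indicator_def)
      qed
    qed (use int in \<open>auto simp: indicator_def\<close>)
    finally show ?thesis .
  qed
  have "(\<lambda>k. max 0 (L - h (x k - z)) * pmf q z) \<longlonglongrightarrow> 0"
    by (rule tendsto_sandwich[OF _ _ tendsto_const under]) (use atom p in auto)
  then have "(\<lambda>k. max 0 (L - h (x k - z)) * pmf q z / pmf q z) \<longlonglongrightarrow> 0 / pmf q z"
    using p by (intro tendsto_divide) auto
  then have "(\<lambda>k. max 0 (L - h (x k - z))) \<longlonglongrightarrow> 0" using p by simp
  then have "(\<lambda>k. L + max 0 (h (x k - z) - L) - max 0 (L - h (x k - z))) \<longlonglongrightarrow> L + 0 - 0"
    by (intro tendsto_intros over)
  moreover have "L + max 0 (h (x k - z) - L) - max 0 (L - h (x k - z)) = h (x k - z)" for k by auto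
  ultimately show ?thesis by simp
qed

lemma max_principle_span:
  fixes q :: "int pmf" and h :: "int \<Rightarrow> real" and x :: "nat \<Rightarrow> int"
  assumes bdd: "\<And>y. \<bar>h y\<bar> \<le> C"
    and upper: "\<And>e. e > 0 \<Longrightarrow> \<exists>B. \<forall>y\<ge>B. h y \<le> L + e"
    and harmonic: "\<And>y. y > 0 \<Longrightarrow> h y = (\<integral>z. h (y - z) \<partial>measure_pmf q)"
    and x: "filterlim x at_top sequentially"
    and lim: "(\<lambda>k. h (x k)) \<longlonglongrightarrow> L"
    and s: "s \<in> additive_span (set_pmf q)"
  shows "(\<lambda>k. h (x k - s)) \<longlonglongrightarrow> L"
  using s
proof induction
  case zero
  then show ?case using lim by simp
next
  case (add s z)
  have "filterlim (\<lambda>k. x k - s) at_top sequentially"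
    unfolding filterlim_at_top
  proof
    fix Z
    have "\<forall>\<^sub>F k in sequentially. x k \<ge> Z + s" using x by (simp add: filterlim_at_top)
    then show "\<forall>\<^sub>F k in sequentially. Z \<le> x k - s" by eventually_elim auto
  qed
  from max_principle_step[OF bdd upper harmonic this add.IH add.hyps(2)]
  show ?case by (simp add: algebra_simps)
qed

text \<open>When the semigroup generated by the support contains only the large integers, as for the
  return times of a walk, a fixed shift \<open>y\<close> is not available; but \<open>y + K\<close> is, for all \<open>y\<close> in a
  finite window and a common \<open>K\<close>. The centre of the window is moved by \<open>K\<close>, and the windows
  grow with the required precision.\<close>

lemma max_principle_window:
  fixes q :: "int pmf" and h :: "int \<Rightarrow> real" and x :: "nat \<Rightarrow> int"
  assumes bdd: "\<And>y. \<bar>h y\<bar> \<le> C"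
    and upper: "\<And>e. e > 0 \<Longrightarrow> \<exists>B. \<forall>y\<ge>B. h y \<le> L + e"
    and harmonic: "\<And>y. y > 0 \<Longrightarrow> h y = (\<integral>z. h (y - z) \<partial>measure_pmf q)"
    and x: "filterlim x at_top sequentially"
    and lim: "(\<lambda>k. h (x k)) \<longlonglongrightarrow> L"
    and span: "\<And>y. \<exists>K0::int. \<forall>K\<ge>K0. y + K \<in> additive_span (set_pmf q)"
  shows "\<exists>x'. filterlim x' at_top sequentially \<and> (\<forall>y. (\<lambda>j. h (x' j - y)) \<longlonglongrightarrow> L)"
proof -
  have "\<exists>a. a \<ge> int j \<and> (\<forall>y\<in>{-int j..int j}. \<bar>h (a - y) - L\<bar> < 1 / real (Suc j))" for j
  proof -
    obtain K0 where K0: "\<And>y K. K \<ge> K0 y \<Longrightarrow> y + K \<in> additive_span (set_pmf q)"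
      using span by metis
    \<comment> \<open>one shift that serves all points of the window\<close>
    define K where "K = Max (K0 ` {-int j..int j})"
    have K: "y + K \<in> additive_span (set_pmf q)" if "y \<in> {-int j..int j}" for y
      using that unfolding K_def by (intro K0 Max_ge) auto
    have "\<forall>\<^sub>F k in sequentially. \<forall>y\<in>{-int j..int j}. \<bar>h (x k - (y + K)) - L\<bar> < 1 / real (Suc j)"
    proof (subst eventually_ball_finite_distrib, simp, intro ballI)
      fix y assume y: "y \<in> {-int j..int j}"
      have "(\<lambda>k. h (x k - (y + K))) \<longlonglongrightarrow> L"
        by (rule max_principle_span[OF bdd upper harmonic x lim K[OF y]])
      from tendstoD[OF this, of "1 / real (Suc j)"]
      show "\<forall>\<^sub>F k in sequentially. \<bar>h (x k - (y + K)) - L\<bar> < 1 / real (Suc j)"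
        by (simp add: dist_real_def)
    qed
    moreover have "\<forall>\<^sub>F k in sequentially. x k \<ge> int j + K"
      using x by (simp add: filterlim_at_top)
    ultimately have "\<forall>\<^sub>F k in sequentially. (\<forall>y\<in>{-int j..int j}. \<bar>h (x k - (y + K)) - L\<bar> < 1 / real (Suc j)) \<and> x k \<ge> int j + K"
      by eventually_elim simp
    then obtain k where "\<forall>y\<in>{-int j..int j}. \<bar>h (x k - (y + K)) - L\<bar> < 1 / real (Suc j)" "x k \<ge> int j + K"
      by (auto simp: eventually_sequentially)
    then show ?thesis by (intro exI[of _ "x k - K"]) (auto simp: algebra_simps)
  qed
  then obtain a where a: "\<And>j. a j \<ge> int j"
    "\<And>j y. y \<in> {-int j..int j} \<Longrightarrow> \<bar>h (a j - y) - L\<bar> < 1 / real (Suc j)" by metis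
  have "filterlim a at_top sequentially"
    unfolding filterlim_at_top
  proof
    fix Z :: int
    show "\<forall>\<^sub>F j in sequentially. Z \<le> a j"
      unfolding eventually_sequentially
    proof (intro exI allI impI)
      fix j assume "j \<ge> nat Z"
      then show "Z \<le> a j" using a(1)[of j] by linarith
    qed
  qed
  moreover have "(\<lambda>j. h (a j - y)) \<longlonglongrightarrow> L" for y
  proof -
    have "(\<lambda>j. h (a j - y) - L) \<longlonglongrightarrow> 0"
    proof (rule Lim_null_comparison)
      show "\<forall>\<^sub>F j in sequentially. norm (h (a j - y) - L) \<le> 1 / real (Suc j)"
        unfolding eventually_sequentially
      proof (intro exI[of _ "nat \<bar>y\<bar>"] allI impI)
        fix j assume "nat \<bar>y\<bar> \<le> j"
        then have "y \<in> {-int j..int j}" by auto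
        from a(2)[OF this] show "norm (h (a j - y) - L) \<le> 1 / real (Suc j)" by simp
      qed
      show "(\<lambda>j. 1 / real (Suc j)) \<longlonglongrightarrow> 0"
        using LIMSEQ_inverse_real_of_nat by (simp add: inverse_eq_divide)
    qed
    then show ?thesis by (simp add: LIM_zero_iff)
  qed
  ultimately show ?thesis by blast
qed

lemma bounded_limsup_realised:
  fixes h :: "int \<Rightarrow> real"
  assumes bdd: "\<And>y. \<bar>h y\<bar> \<le> C"
  obtains L x where "filterlim x at_top sequentially" "(\<lambda>k::nat. h (x k)) \<longlonglongrightarrow> L"
     "\<And>e. e > 0 \<Longrightarrow> \<exists>B. \<forall>y\<ge>B. h y \<le> L + e"
proof -
  define u where "u n = ereal (h (int n))" for n
  obtain r where r: "strict_mono (r :: nat \<Rightarrow> nat)" "(u \<circ> r) \<longlonglongrightarrow> limsup u"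
    using limsup_subseq_lim by blast
  have "\<bar>limsup u\<bar> \<noteq> \<infinity>"
  proof -
    have "limsup u \<le> ereal C"
      by (rule Limsup_bounded) (use bdd in \<open>auto simp: u_def abs_le_iff\<close>)
    moreover have "u (r n) \<ge> ereal (- C)" for n using bdd[of "int (r n)"] by (auto simp: u_def)
    then have "limsup u \<ge> ereal (- C)"
      by (intro tendsto_lowerbound[OF r(2)]) (auto intro!: always_eventually)
    ultimately show ?thesis by auto
  qed
  then obtain L where L: "limsup u = ereal L" by auto
  have 2: "(\<lambda>k. h (int (r k))) \<longlonglongrightarrow> L"
    using r(2) by (simp add: L u_def o_def)
  have 1: "filterlim (\<lambda>k. int (r k)) at_top sequentially"
    using filterlim_compose[OF filterlim_int_sequentially filterlim_subseq[OF r(1)]] .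
  have 3: "\<exists>B. \<forall>y\<ge>B. h y \<le> L + e" if "e > 0" for e
  proof -
    have "limsup u < ereal (L + e)" using that L by simp
    then have "\<forall>\<^sub>F n in sequentially. u n < ereal (L + e)" by (rule Limsup_lessD)
    then obtain n0 where n0: "\<And>n. n \<ge> n0 \<Longrightarrow> h (int n) < L + e"
      by (auto simp: eventually_sequentially u_def)
    show ?thesis
    proof (intro exI allI impI)
      fix y assume "y \<ge> int n0"
      then show "h y \<le> L + e" using n0[of "nat y"] by (simp add: le_nat_iff)
    qed
  qed
  show ?thesis by (rule that[OF 1 2 3])
qed

text \<open>The increment from \<open>x - z\<close> to \<open>x\<close> of a discrete primitive of \<open>g\<close>: for \<open>z < 0\<close> the sum is
  over \<open>x + 1, \<dots>, x - z\<close>, with the opposite sign.\<close>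

definition window_sum :: "(int \<Rightarrow> real) \<Rightarrow> int \<Rightarrow> int \<Rightarrow> real" where
  "window_sum g x z = (if z \<ge> 0 then \<Sum>i<nat z. g (x - int i) else - (\<Sum>i<nat (-z). g (x + 1 + int i)))"

lemma window_sum_step: "window_sum g x z - window_sum g (x - 1) z = g x - g (x - z)"
proof (cases "z \<ge> 0")
  case True
  then obtain n where n: "z = int n" using zero_le_imp_eq_int by blast
  have "window_sum g x z - window_sum g (x - 1) z = (\<Sum>i<n. g (x - int i) - g (x - int (Suc i)))"
    by (simp add: window_sum_def n sum_subtractf algebra_simps)
  also have "\<dots> = g (x - int 0) - g (x - int n)"
    by (rule sum_lessThan_telescope')
  finally show ?thesis by (simp add: n)
next
  case False
  then obtain n where n: "z = - int n" by (metis int_cases2 of_nat_0_le_iff)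
  have "n > 0" using False n by auto
  have "window_sum g x z - window_sum g (x - 1) z = - (\<Sum>i<n. g (x + int (Suc i)) - g (x + int i))"
    using \<open>n > 0\<close> by (simp add: window_sum_def n sum_subtractf algebra_simps)
  also have "(\<Sum>i<n. g (x + int (Suc i)) - g (x + int i)) = g (x + int n) - g (x + int 0)"
    by (rule sum_lessThan_telescope)
  finally show ?thesis by (simp add: n)
qed

lemma window_sum_bound:
  assumes "\<And>y. \<bar>g y\<bar> \<le> C"
  shows "\<bar>window_sum g x z\<bar> \<le> C * \<bar>real_of_int z\<bar>"
proof -
  have "\<bar>\<Sum>i<n. g (f i)\<bar> \<le> C * real n" for n and f :: "nat \<Rightarrow> int"
  proof -
    have "\<bar>\<Sum>i<n. g (f i)\<bar> \<le> (\<Sum>i<n. \<bar>g (f i)\<bar>)" by (rule sum_abs)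
    also have "\<dots> \<le> (\<Sum>i<n. C)" by (intro sum_mono assms)
    finally show ?thesis by (simp add: mult.commute)
  qed
  from this[of "\<lambda>i. x - int i" "nat z"] this[of "\<lambda>i. x + 1 + int i" "nat (-z)"]
  show ?thesis by (auto simp: window_sum_def)
qed

lemma window_sum_tendsto:
  assumes "\<And>y. ((\<lambda>j. g (x j - y)) \<longlongrightarrow> L) F"
  shows "((\<lambda>j. window_sum g (x j) z) \<longlongrightarrow> L * real_of_int z) F"
proof (cases "z \<ge> 0")
  case True
  have "((\<lambda>j. \<Sum>i<nat z. g (x j - int i)) \<longlongrightarrow> (\<Sum>i<nat z. L)) F"
    by (intro tendsto_sum assms)
  then show ?thesis using True by (simp add: window_sum_def mult.commute)
next
  case False
  have "((\<lambda>j. - (\<Sum>i<nat (-z). g (x j - (- 1 - int i)))) \<longlongrightarrow> - (\<Sum>i<nat (-z). L)) F"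
    by (intro tendsto_minus tendsto_sum assms)
  then show ?thesis using False by (simp add: window_sum_def algebra_simps)
qed

text \<open>Let \<open>D x\<close> be the expected increment of a primitive of \<open>g\<close> over a step of law \<open>q\<close> that ends
  at \<open>x\<close>. The renewal equation says that \<open>D x - D (x - 1) = s x\<close>, so \<open>D\<close> equals a positive
  constant on the positive half-line. By the maximum principle there are arbitrarily remote
  windows on which \<open>g\<close> is close to its upper limit \<open>L\<close>, and on them \<open>D\<close> is close to \<open>L\<close> times
  the mean of \<open>q\<close>. The same holds for the lower limit, so the two limits agree.\<close>

theorem renewal_theorem:
  fixes q :: "int pmf" and g s :: "int \<Rightarrow> real"
  assumes g: "\<And>y. 0 \<le> g y" "\<And>y. g y \<le> C"
    and eq: "\<And>y. g y = s y + (\<integral>z. g (y - z) \<partial>measure_pmf q)"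
    and s: "\<And>y. 0 \<le> s y" "\<And>y. y > 0 \<Longrightarrow> s y = 0" "s y0 > 0"
    and left: "(g \<longlongrightarrow> 0) at_bot"
    and mean: "integrable (measure_pmf q) real_of_int"
    and span: "\<And>y. \<exists>K0::int. \<forall>K\<ge>K0. y + K \<in> additive_span (set_pmf q)"
  shows "\<exists>c>0. (g \<longlongrightarrow> c) at_top"
proof -
  have bdd: "\<bar>g y\<bar> \<le> C" for y using g[of y] by simp
  have int: "integrable (measure_pmf q) (\<lambda>z. g (y - z))" for y
    by (rule integrable_pmf_bounded[where B = C]) (use bdd in auto)
  define D where "D x = (\<integral>z. window_sum g x z \<partial>measure_pmf q)" for x
  have dom: "integrable (measure_pmf q) (\<lambda>z. C * \<bar>real_of_int z\<bar>)"
    using mean by auto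
  have intw: "integrable (measure_pmf q) (\<lambda>z. window_sum g x z)" for x
    by (rule Bochner_Integration.integrable_bound[OF dom])
       (use window_sum_bound[OF bdd] in \<open>auto intro!: AE_I2 order_trans[OF _ abs_ge_self]\<close>)
  have Dstep: "D x = D (x - 1) + s x" for x
  proof -
    have "D x - D (x - 1) = (\<integral>z. g x - g (x - z) \<partial>measure_pmf q)"
      unfolding D_def by (subst Bochner_Integration.integral_diff[symmetric]) (use intw in \<open>auto simp: window_sum_step\<close>)
    also have "\<dots> = g x - (\<integral>z. g (x - z) \<partial>measure_pmf q)"
      using int by simp
    finally show ?thesis using eq[of x] by simp
  qed
  have Dlim: "(\<lambda>j. D (x j)) \<longlonglongrightarrow> L * (\<integral>z. real_of_int z \<partial>measure_pmf q)"
    if "\<And>y. (\<lambda>j. g (x j - y)) \<longlonglongrightarrow> L" for x :: "nat \<Rightarrow> int" and L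
  proof -
    have "(\<lambda>j. D (x j)) \<longlonglongrightarrow> (\<integral>z. L * real_of_int z \<partial>measure_pmf q)"
      unfolding D_def
    proof (rule integral_dominated_convergence[OF _ _ dom])
      show "AE z in measure_pmf q. (\<lambda>j. window_sum g (x j) z) \<longlonglongrightarrow> L * real_of_int z"
        using window_sum_tendsto[OF that] by simp
    qed (use window_sum_bound[OF bdd] in auto)
    then show ?thesis by simp
  qed
  have Dmono: "D (x - int n) \<le> D x" for x n
  proof (induction n)
    case (Suc n)
    have "D (x - int n) = D (x - int (Suc n)) + s (x - int n)"
      using Dstep[of "x - int n"] by (simp add: algebra_simps)
    then show ?case using Suc s(1)[of "x - int n"] by simp
  qed simp
  have Dnonneg: "D x \<ge> 0" for x
  proof -
    have "(\<lambda>j. g ((x - int j) - y)) \<longlonglongrightarrow> 0" for y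
    proof -
      have "filterlim (\<lambda>j. x - int j - y) at_bot sequentially"
        unfolding filterlim_at_bot eventually_sequentially
      proof (intro allI)
        fix Z show "\<exists>N. \<forall>n\<ge>N. x - int n - y \<le> Z"
          by (rule exI[of _ "nat (x - y - Z)"]) auto
      qed
      from filterlim_compose[OF left this] show ?thesis .
    qed
    from Dlim[OF this] have "(\<lambda>j. D (x - int j)) \<longlonglongrightarrow> 0" by simp
    then show ?thesis
      by (rule tendsto_upperbound) (simp_all add: Dmono)
  qed
  have Dconst: "D (int n) = D 0" for n
  proof (induction n)
    case (Suc n)
    then show ?case using Dstep[of "int (Suc n)"] s(2)[of "int (Suc n)"] by simp
  qed simp
  have "y0 \<le> 0" using s(2)[of y0] s(3) by force
  have Dpos: "D 0 > 0"
  proof -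
    have "D y0 > 0" using Dstep[of y0] s(3) Dnonneg[of "y0 - 1"] by simp
    then show ?thesis using Dmono[of 0 "nat (- y0)"] \<open>y0 \<le> 0\<close> by simp
  qed
  \<comment> \<open>every limit value that is taken on whole windows is determined by the constant value of \<open>D\<close>\<close>
  have key: "L * (\<integral>z. real_of_int z \<partial>measure_pmf q) = D 0"
    if x: "filterlim x at_top sequentially" and L: "\<And>y. (\<lambda>j. g (x j - y)) \<longlonglongrightarrow> L" for x :: "nat \<Rightarrow> int" and L
  proof -
    have "\<forall>\<^sub>F j in sequentially. x j \<ge> 0" using x by (simp add: filterlim_at_top)
    then have "\<forall>\<^sub>F j in sequentially. D (x j) = D 0"
    proof eventually_elim
      case (elim j)
      then obtain n where "x j = int n" using zero_le_imp_eq_int by blast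
      then show ?case using Dconst by simp
    qed
    then have "(\<lambda>j. D (x j)) \<longlonglongrightarrow> D 0" by (rule tendsto_eventually)
    then show ?thesis using Dlim[OF L] LIMSEQ_unique by blast
  qed
  have harmonic: "g y = (\<integral>z. g (y - z) \<partial>measure_pmf q)" if "y > 0" for y
    using eq[of y] s(2)[OF that] by simp
  obtain L x where L: "filterlim x at_top sequentially" "(\<lambda>k::nat. g (x k)) \<longlonglongrightarrow> L"
     "\<And>e. e > 0 \<Longrightarrow> \<exists>B. \<forall>y\<ge>B. g y \<le> L + e"
    by (rule bounded_limsup_realised[where h = g, OF bdd]) blast
  have bdd': "\<bar>- g y\<bar> \<le> C" for y using bdd by simp
  obtain L' x' where L': "filterlim x' at_top sequentially" "(\<lambda>k::nat. - g (x' k)) \<longlonglongrightarrow> L'"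
     "\<And>e. e > 0 \<Longrightarrow> \<exists>B. \<forall>y\<ge>B. - g y \<le> L' + e"
    by (rule bounded_limsup_realised[where h = "\<lambda>y. - g y", OF bdd']) blast
  obtain a where a: "filterlim a at_top sequentially" "\<And>y. (\<lambda>j. g (a j - y)) \<longlonglongrightarrow> L"
    using max_principle_window[OF bdd L(3) harmonic L(1,2) span] by blast
  have harmonic': "- g y = (\<integral>z. - g (y - z) \<partial>measure_pmf q)" if "y > 0" for y
    using harmonic[OF that] by simp
  obtain a' where a': "filterlim a' at_top sequentially" "\<And>y. (\<lambda>j. - g (a' j - y)) \<longlonglongrightarrow> L'"
    using max_principle_window[OF bdd' L'(3) harmonic' L'(1,2) span] by blast
  have a'': "(\<lambda>j. g (a' j - y)) \<longlonglongrightarrow> - L'" for y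
    using tendsto_minus[OF a'(2)[of y]] by simp
  have *: "L * (\<integral>z. real_of_int z \<partial>measure_pmf q) = D 0" by (rule key[OF a])
  have **: "- L' * (\<integral>z. real_of_int z \<partial>measure_pmf q) = D 0" by (rule key[OF a'(1) a''])
  have LL: "L' = - L"
  proof -
    have "L * (\<integral>z. real_of_int z \<partial>measure_pmf q) = - L' * (\<integral>z. real_of_int z \<partial>measure_pmf q)"
      using * ** by simp
    moreover have "(\<integral>z. real_of_int z \<partial>measure_pmf q) \<noteq> 0" using * Dpos by auto
    ultimately show ?thesis by (simp only: mult_cancel_right) simp
  qed
  have "L \<ge> 0" by (rule tendsto_lowerbound[OF L(2)]) (use g in auto)
  then have "L > 0" using * Dpos by (cases "L = 0") auto
  moreover have "(g \<longlongrightarrow> L) at_top"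
  proof (rule tendstoI)
    fix e :: real assume "e > 0"
    then obtain B B' where "\<forall>y\<ge>B. g y \<le> L + e/2" "\<forall>y\<ge>B'. - g y \<le> L' + e/2"
      using L(3)[of "e/2"] L'(3)[of "e/2"] by auto
    then have "\<bar>g y - L\<bar> < e" if "y \<ge> max B B'" for y
      using that \<open>e > 0\<close> LL by (smt (verit) field_sum_of_halves)
    then show "\<forall>\<^sub>F y in at_top. dist (g y) L < e"
      unfolding eventually_at_top_linorder dist_real_def by blast
  qed
  ultimately show ?thesis by blast
qed

section \<open>Averages of bounded functions over one step\<close>

text \<open>A predicate with introduction rules, so that the integrability side conditions below are
  proved by structural decomposition of the integrand.\<close>

definition bdd_fun :: "('a \<Rightarrow> real) \<Rightarrow> bool" where
  "bdd_fun f \<longleftrightarrow> (\<exists>B. \<forall>x. \<bar>f x\<bar> \<le> B)"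

lemma bdd_funI: "(\<And>x. \<bar>f x\<bar> \<le> B) \<Longrightarrow> bdd_fun f"
  unfolding bdd_fun_def by blast

lemma bdd_fun_const [simp, intro]: "bdd_fun (\<lambda>_. c)"
  by (rule bdd_funI[of _ "\<bar>c\<bar>"]) simp

lemma bdd_fun_of_bool [simp, intro]: "bdd_fun (\<lambda>x. of_bool (P x))"
  by (rule bdd_funI[of _ 1]) simp

lemma bdd_fun_compose [simp, intro]: "bdd_fun f \<Longrightarrow> bdd_fun (\<lambda>x. f (g x))"
  unfolding bdd_fun_def by blast

lemma bdd_fun_add [simp, intro]:
  assumes "bdd_fun f" "bdd_fun g" shows "bdd_fun (\<lambda>x. f x + g x)"
proof -
  obtain A B where AB: "\<And>x. \<bar>f x\<bar> \<le> A" "\<And>x. \<bar>g x\<bar> \<le> B" using assms by (auto simp: bdd_fun_def)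
  show ?thesis
    by (rule bdd_funI[of _ "A + B"]) (rule order_trans[OF abs_triangle_ineq add_mono[OF AB]])
qed

lemma bdd_fun_mult [simp, intro]:
  assumes "bdd_fun f" "bdd_fun g" shows "bdd_fun (\<lambda>x. f x * g x)"
proof -
  obtain A B where AB: "\<And>x. \<bar>f x\<bar> \<le> A" "\<And>x. \<bar>g x\<bar> \<le> B" using assms by (auto simp: bdd_fun_def)
  show ?thesis
  proof (rule bdd_funI[of _ "A * B"])
    have "0 \<le> A" using AB(1)[of undefined] by linarith
    then show "\<bar>f x * g x\<bar> \<le> A * B" for x
      unfolding abs_mult using AB by (intro mult_mono) auto
  qed
qed

lemma bdd_fun_sum [simp, intro]: "(\<And>i. i \<in> I \<Longrightarrow> bdd_fun (f i)) \<Longrightarrow> bdd_fun (\<lambda>x. \<Sum>i\<in>I. f i x)"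
  by (induction I rule: infinite_finite_induct) auto

lemma bdd_fun_minus [simp, intro]: "bdd_fun f \<Longrightarrow> bdd_fun (\<lambda>x. - f x)"
  by (auto simp: bdd_fun_def)

lemma bdd_fun_diff [simp, intro]: "bdd_fun f \<Longrightarrow> bdd_fun g \<Longrightarrow> bdd_fun (\<lambda>x. f x - g x)"
  using bdd_fun_add[of f "\<lambda>x. - g x"] by simp

lemma bdd_fun_If [simp, intro]:
  assumes "bdd_fun f" "bdd_fun g" shows "bdd_fun (\<lambda>x. if P x then f x else g x)"
proof -
  obtain A B where AB: "\<And>x. \<bar>f x\<bar> \<le> A" "\<And>x. \<bar>g x\<bar> \<le> B" using assms by (auto simp: bdd_fun_def)
  show ?thesis
    by (rule bdd_funI[of _ "max A B"]) (use AB in \<open>auto simp: le_max_iff_disj\<close>)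
qed

lemma bdd_fun_unit: "(\<And>x. 0 \<le> f x) \<Longrightarrow> (\<And>x. f x \<le> 1) \<Longrightarrow> bdd_fun f"
  by (rule bdd_funI[of _ 1]) auto

lemma integrable_bdd_fun [simp, intro]: "bdd_fun f \<Longrightarrow> integrable (measure_pmf p) f"
  unfolding bdd_fun_def using integrable_pmf_bounded by blast

definition walk_mean :: "int pmf \<Rightarrow> (int \<Rightarrow> real) \<Rightarrow> int \<Rightarrow> real" where
  "walk_mean p f x = (\<integral>z. f (x + z) \<partial>measure_pmf p)"

lemma walk_mean_mono:
  assumes "bdd_fun f" "bdd_fun g" "\<And>y. f y \<le> g y"
  shows "walk_mean p f x \<le> walk_mean p g x"
  unfolding walk_mean_def using assms by (intro integral_mono) auto

lemma walk_mean_const [simp]: "walk_mean p (\<lambda>_. c) x = c"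
  by (simp add: walk_mean_def)

lemma walk_mean_add: "bdd_fun f \<Longrightarrow> bdd_fun g \<Longrightarrow> walk_mean p (\<lambda>y. f y + g y) x = walk_mean p f x + walk_mean p g x"
  by (simp add: walk_mean_def)

lemma walk_mean_diff: "bdd_fun f \<Longrightarrow> bdd_fun g \<Longrightarrow> walk_mean p (\<lambda>y. f y - g y) x = walk_mean p f x - walk_mean p g x"
  by (simp add: walk_mean_def)

lemma walk_mean_cmult: "walk_mean p (\<lambda>y. c * f y) x = c * walk_mean p f x"
  by (simp add: walk_mean_def)

lemma walk_mean_multc: "walk_mean p (\<lambda>y. f y * c) x = walk_mean p f x * c"
  by (simp add: walk_mean_def)

lemma walk_mean_sum: "(\<And>i. i \<in> I \<Longrightarrow> bdd_fun (f i)) \<Longrightarrow> walk_mean p (\<lambda>y. \<Sum>i\<in>I. f i y) x = (\<Sum>i\<in>I. walk_mean p (f i) x)"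
  by (simp add: walk_mean_def)

lemma walk_mean_nonneg: "(\<And>y. 0 \<le> f y) \<Longrightarrow> 0 \<le> walk_mean p f x"
  by (simp add: walk_mean_def)

lemma walk_mean_le:
  assumes "bdd_fun f" "\<And>y. f y \<le> c" shows "walk_mean p f x \<le> c"
  using walk_mean_mono[OF assms(1) _ assms(2), of p x] by simp

lemma bdd_fun_walk_mean [simp, intro]:
  assumes "bdd_fun f" shows "bdd_fun (walk_mean p f)"
proof -
  obtain B where B: "\<And>x. \<bar>f x\<bar> \<le> B" using assms by (auto simp: bdd_fun_def)
  have "f y \<le> B" "- B \<le> f y" for y using B[of y] by auto
  then have "walk_mean p f x \<le> B" "- B \<le> walk_mean p f x" for x
    using walk_mean_le[OF assms] walk_mean_mono[OF _ assms, of "\<lambda>_. - B" p x] by auto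
  then show ?thesis by (intro bdd_funI[of _ B]) (simp add: abs_le_iff minus_le_iff)
qed

lemma pmf_expectation_sums:
  fixes f :: "nat \<Rightarrow> 'a \<Rightarrow> real"
  assumes partial: "\<And>n z. \<bar>\<Sum>i<n. f i z\<bar> \<le> B" and sums: "\<And>z. (\<lambda>i. f i z) sums F z"
  shows "(\<lambda>i. \<integral>z. f i z \<partial>measure_pmf p) sums (\<integral>z. F z \<partial>measure_pmf p)"
proof -
  have bdd: "bdd_fun (f i)" for i
  proof (rule bdd_funI[of _ "2 * B"])
    fix z
    have "f i z = (\<Sum>i<Suc i. f i z) - (\<Sum>i<i. f i z)" by simp
    then show "\<bar>f i z\<bar> \<le> 2 * B" using partial[of z "Suc i"] partial[of z i] by linarith
  qed
  have "(\<lambda>n. \<integral>z. (\<Sum>i<n. f i z) \<partial>measure_pmf p) \<longlonglongrightarrow> (\<integral>z. F z \<partial>measure_pmf p)"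
    by (rule integral_dominated_convergence[where w = "\<lambda>_. B"])
       (use partial sums in \<open>auto simp: sums_def\<close>)
  moreover have "(\<integral>z. (\<Sum>i<n. f i z) \<partial>measure_pmf p) = (\<Sum>i<n. \<integral>z. f i z \<partial>measure_pmf p)" for n
    using bdd by (intro Bochner_Integration.integral_sum) auto
  ultimately show ?thesis by (simp add: sums_def)
qed

section \<open>First visit to the origin\<close>

text \<open>Let \<open>\<sigma> \<ge> 0\<close> be the first time at which the walk is at the origin. The recursions below, on
  the first step, describe \<open>hit p n x = P\<^sub>x(\<sigma> = n)\<close>, \<open>avoid p h n x = E\<^sub>x[h(S\<^sub>n); \<sigma> > n]\<close> and
  \<open>tail p n k = P\<^sub>0(S\<^sub>n > k)\<close>.\<close>

primrec hit :: "int pmf \<Rightarrow> nat \<Rightarrow> int \<Rightarrow> real" where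
  "hit p 0 = (\<lambda>x. of_bool (x = 0))"
| "hit p (Suc n) = (\<lambda>x. if x = 0 then 0 else walk_mean p (hit p n) x)"

primrec avoid :: "int pmf \<Rightarrow> (int \<Rightarrow> real) \<Rightarrow> nat \<Rightarrow> int \<Rightarrow> real" where
  "avoid p h 0 = (\<lambda>x. if x = 0 then 0 else h x)"
| "avoid p h (Suc n) = (\<lambda>x. if x = 0 then 0 else walk_mean p (avoid p h n) x)"

primrec tail :: "int pmf \<Rightarrow> nat \<Rightarrow> int \<Rightarrow> real" where
  "tail p 0 = (\<lambda>k. of_bool (k < 0))"
| "tail p (Suc n) = (\<lambda>k. \<integral>z. tail p n (k - z) \<partial>measure_pmf p)"

lemma bdd_fun_hit [simp, intro]: "bdd_fun (hit p n)"
  by (induction n) auto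

lemma bdd_fun_avoid [simp, intro]: "bdd_fun h \<Longrightarrow> bdd_fun (avoid p h n)"
  by (induction n) auto

lemma hit_nonneg [simp]: "0 \<le> hit p n x"
  by (induction n arbitrary: x) (auto intro!: walk_mean_nonneg)

lemma avoid_nonneg: "(\<And>x. 0 \<le> h x) \<Longrightarrow> 0 \<le> avoid p h n x"
  by (induction n arbitrary: x) (auto intro!: walk_mean_nonneg)

lemma tail_bounds: "0 \<le> tail p n k \<and> tail p n k \<le> 1"
proof (induction n arbitrary: k)
  case (Suc n)
  have "bdd_fun (tail p n)" using Suc by (intro bdd_fun_unit) auto
  then have "(\<integral>z. tail p n (k - z) \<partial>measure_pmf p) \<le> (\<integral>z. 1 \<partial>measure_pmf p)"
    using Suc by (intro integral_mono) auto
  then show ?case using Suc by simp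
qed simp

lemma bdd_fun_tail [simp, intro]: "bdd_fun (tail p n)"
  using tail_bounds by (intro bdd_fun_unit) auto

lemma hit_partial_sum_le: "(\<Sum>i<n. hit p i x) \<le> 1"
proof (induction n arbitrary: x)
  case (Suc n)
  show ?case
  proof (cases "x = 0")
    case False
    have "(\<Sum>i<Suc n. hit p i x) = walk_mean p (\<lambda>y. \<Sum>i<n. hit p i y) x"
      using False by (simp add: sum.lessThan_Suc_shift walk_mean_sum del: sum.lessThan_Suc)
    also have "\<dots> \<le> 1" using Suc by (intro walk_mean_le) auto
    finally show ?thesis .
  qed (simp add: sum.lessThan_Suc_shift del: sum.lessThan_Suc)
qed simp

text \<open>The generating function \<open>E\<^sub>x[s\<^sup>\<sigma>]\<close> of the first visit; for \<open>s = 1\<close> it is the probability of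
  ever visiting the origin.\<close>

definition hit_gf :: "int pmf \<Rightarrow> real \<Rightarrow> int \<Rightarrow> real" where
  "hit_gf p s x = (\<Sum>n. s ^ n * hit p n x)"

context
  fixes s :: real
  assumes s: "0 \<le> s" "s \<le> 1"
begin

lemma hit_gf_partial: "(\<Sum>i<n. s ^ i * hit p i x) \<le> 1"
proof -
  have "(\<Sum>i<n. s ^ i * hit p i x) \<le> (\<Sum>i<n. hit p i x)"
    using s by (intro sum_mono mult_left_le_one_le) (auto intro: power_le_one)
  then show ?thesis using hit_partial_sum_le[of p x n] by simp
qed

lemma hit_gf_sums: "(\<lambda>n. s ^ n * hit p n x) sums hit_gf p s x"
  unfolding hit_gf_def using s hit_gf_partial
  by (intro summable_sums summableI_nonneg_bounded[where x = 1]) auto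

lemma hit_gf_nonneg: "0 \<le> hit_gf p s x"
  by (rule sums_le[OF _ sums_zero hit_gf_sums]) (use s in auto)

lemma hit_gf_le_1: "hit_gf p s x \<le> 1"
  using LIMSEQ_le_const2[OF hit_gf_sums[unfolded sums_def]] hit_gf_partial by blast

lemma bdd_fun_hit_gf [simp, intro]: "bdd_fun (hit_gf p s)"
  using hit_gf_nonneg hit_gf_le_1 by (intro bdd_fun_unit) auto

lemma walk_mean_hit_gf_sums: "(\<lambda>n. s ^ n * walk_mean p (hit p n) x) sums walk_mean p (hit_gf p s) x"
proof -
  have "(\<lambda>n. \<integral>z. s ^ n * hit p n (x + z) \<partial>measure_pmf p) sums (\<integral>z. hit_gf p s (x + z) \<partial>measure_pmf p)"
  proof (rule pmf_expectation_sums[where B = 1])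
    show "\<bar>\<Sum>i<n. s ^ i * hit p i (x + z)\<bar> \<le> 1" for n z
      using hit_gf_partial[where n = n and p = p and x = "x + z"] sum_nonneg[of "{..<n}" "\<lambda>i. s ^ i * hit p i (x + z)"] s
      by (simp add: abs_le_iff)
  qed (rule hit_gf_sums)
  then show ?thesis by (simp add: walk_mean_def)
qed

lemma hit_gf_0: "hit_gf p s 0 = 1"
proof -
  have "s ^ n * hit p n 0 = (if n = 0 then 1 else 0)" for n by (cases n) auto
  then show ?thesis using suminf_finite[of "{0::nat}" "\<lambda>n. s ^ n * hit p n 0"] by (simp add: hit_gf_def)
qed

end

lemma walk_mean_hit_gf:
  assumes s: "0 \<le> s" "s \<le> 1" and x: "x \<noteq> 0"
  shows "s * walk_mean p (hit_gf p s) x = hit_gf p s x"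
proof -
  have "(\<lambda>n. s * (s ^ n * walk_mean p (hit p n) x)) sums (s * walk_mean p (hit_gf p s) x)"
    by (intro sums_mult walk_mean_hit_gf_sums s)
  then have "(\<lambda>n. s ^ Suc n * hit p (Suc n) x) sums (s * walk_mean p (hit_gf p s) x)"
    using x by (simp add: mult_ac)
  then have "(\<lambda>n. s ^ n * hit p n x) sums (s * walk_mean p (hit_gf p s) x + s ^ 0 * hit p 0 x)"
    by (rule sums_Suc)
  then have "(\<lambda>n. s ^ n * hit p n x) sums (s * walk_mean p (hit_gf p s) x)"
    using x by simp
  then show ?thesis using hit_gf_sums[OF s] sums_unique2 by blast
qed

text \<open>Only the recursion off the origin enters, so the decomposition applies alike to the free
  walk, to mean population sizes and to functions that do not depend on \<open>n\<close>.\<close>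

lemma first_hit_decomposition:
  assumes step: "\<And>n x. x \<noteq> 0 \<Longrightarrow> u (Suc n) x = walk_mean p (u n) x"
    and bdd: "\<And>n. bdd_fun (u n)"
  shows "u n x = avoid p (u 0) n x + (\<Sum>i\<le>n. hit p i x * u (n - i) 0)"
proof (induction n arbitrary: x)
  case 0
  then show ?case by simp
next
  case (Suc n)
  show ?case
  proof (cases "x = 0")
    case True
    then show ?thesis by (simp add: sum.atMost_Suc_shift del: sum.atMost_Suc)
  next
    case False
    have "u (Suc n) x = walk_mean p (\<lambda>y. avoid p (u 0) n y + (\<Sum>i\<le>n. hit p i y * u (n - i) 0)) x"
      unfolding step[OF False] using Suc by (intro arg_cong[where f = "\<lambda>g. walk_mean p g x"] ext) auto
    also have "\<dots> = avoid p (u 0) (Suc n) x + (\<Sum>i\<le>n. hit p (Suc i) x * u (n - i) 0)"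
      using False bdd by (simp add: walk_mean_add walk_mean_sum walk_mean_multc)
    finally show ?thesis using False by (simp add: sum.atMost_Suc_shift del: sum.atMost_Suc)
  qed
qed

lemma tail_walk_mean: "tail p (Suc n) (k - x) = walk_mean p (\<lambda>y. tail p n (k - y)) x"
  by (simp add: walk_mean_def algebra_simps)

abbreviation above :: "int \<Rightarrow> int \<Rightarrow> real" where "above k \<equiv> \<lambda>x. of_bool (k < x)"

lemma avoid_indicator:
  "avoid p (above k) n x = tail p n (k - x) - (\<Sum>i\<le>n. hit p i x * tail p (n - i) k)"
  using first_hit_decomposition[of "\<lambda>n x. tail p n (k - x)" p n x] tail_walk_mean[of p _ k]
  by simp

lemma avoid_indicator_le: "avoid p (above k) n x \<le> tail p n (k - x)"
  unfolding avoid_indicator using tail_bounds by (simp add: sum_nonneg)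

text \<open>The Chernoff bound.\<close>

lemma tail_exp_bound:
  assumes "t \<ge> 0" and int: "integrable (measure_pmf p) (\<lambda>z. exp (t * real_of_int z))"
    and L: "L = (\<integral>z. exp (t * real_of_int z) \<partial>measure_pmf p)"
  shows "tail p n k \<le> exp (- t * real_of_int k) * L ^ n"
proof (induction n arbitrary: k)
  case 0
  have "k < 0 \<Longrightarrow> t * real_of_int k \<le> 0" using assms(1) by (intro mult_nonneg_nonpos) auto
  then show ?case by (auto simp: of_bool_def)
next
  case (Suc n)
  have "tail p (Suc n) k \<le> (\<integral>z. exp (- t * real_of_int k) * L ^ n * exp (t * real_of_int z) \<partial>measure_pmf p)"
    unfolding tail.simps
  proof (intro integral_mono)
    show "tail p n (k - z) \<le> exp (- t * real_of_int k) * L ^ n * exp (t * real_of_int z)" for z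
      using Suc[of "k - z"] by (simp add: algebra_simps exp_diff exp_add exp_minus divide_simps)
  qed (use int in auto)
  also have "\<dots> = exp (- t * real_of_int k) * L ^ Suc n" by (simp add: L)
  finally show ?case .
qed

lemma additive_span_add:
  assumes "x \<in> additive_span A" "y \<in> additive_span A"
  shows "x + y \<in> additive_span A"
  using assms(2)
proof induction
  case (add y z)
  then show ?case using additive_span.add[of "x + y" A z] by (simp add: add.assoc)
qed (use assms(1) in simp)

lemma additive_span_mult:
  assumes "x \<in> additive_span A" shows "int n * x \<in> additive_span A"
proof (induction n)
  case (Suc n)
  then show ?case using additive_span_add[OF Suc assms] by (simp add: algebra_simps)
qed (simp add: additive_span.zero)

lemma additive_span_incl: "x \<in> A \<Longrightarrow> x \<in> additive_span A"
  using additive_span.add[OF additive_span.zero] by force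

text \<open>The differences of elements of the semigroup form a group, and this group is all of \<open>\<int>\<close>
  because its least positive element divides the gcd. So the semigroup contains \<open>b\<close> and
  \<open>b + 1\<close> for some \<open>b\<close>, and with them every \<open>N \<ge> b\<^sup>2\<close>: write \<open>N = q b + s\<close> with
  \<open>0 \<le> s < b \<le> q\<close>.\<close>

lemma additive_span_eventually_all:
  fixes A :: "nat set"
  assumes gcd: "Gcd A = 1"
  shows "\<exists>K0::int. \<forall>K\<ge>K0. y + K \<in> additive_span (int ` A)"
proof -
  let ?S = "additive_span (int ` A)"
  have S_nonneg: "x \<ge> 0" if "x \<in> ?S" for x using that by induction auto
  define D where "D = {a - b | a b. a \<in> ?S \<and> b \<in> ?S}"
  have D_add: "x + y \<in> D" if "x \<in> D" "y \<in> D" for x y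
  proof -
    obtain a b c d where "x = a - b" "y = c - d" "a \<in> ?S" "b \<in> ?S" "c \<in> ?S" "d \<in> ?S"
      using \<open>x \<in> D\<close> \<open>y \<in> D\<close> by (auto simp: D_def)
    then have "x + y = (a + c) - (b + d)" "a + c \<in> ?S" "b + d \<in> ?S"
      by (auto intro: additive_span_add)
    then show ?thesis unfolding D_def by blast
  qed
  have D_uminus: "- x \<in> D" if "x \<in> D" for x using that by (force simp: D_def)
  have D_S: "x \<in> D" if "x \<in> ?S" for x using that additive_span.zero by (force simp: D_def)
  have D_mult: "int n * x \<in> D" if "x \<in> D" for n x
  proof (induction n)
    case (Suc n)
    then show ?case using D_add[OF that Suc] by (simp add: algebra_simps)
  qed (use D_S additive_span.zero in simp)
  have D_mult': "k * x \<in> D" if "x \<in> D" for k x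
    using D_mult[OF that, of "nat \<bar>k\<bar>"] D_uminus[OF D_mult[OF that, of "nat \<bar>k\<bar>"]]
    by (cases "k \<ge> 0") auto
  obtain a0 where a0: "a0 \<in> A" "a0 > 0"
  proof -
    have "\<not> A \<subseteq> {0}" using gcd by (metis Gcd_0_iff zero_neq_one)
    then show ?thesis using that by auto
  qed
  have ex: "\<exists>n. n > 0 \<and> int n \<in> D"
    using a0 D_S additive_span_incl[of "int a0"] by blast
  \<comment> \<open>the group \<open>D\<close> of differences is generated by its least positive element\<close>
  define d where "d = (LEAST n. n > 0 \<and> int n \<in> D)"
  have d: "d > 0" "int d \<in> D" using LeastI_ex[OF ex] by (auto simp: d_def)
  have "d dvd a" if "a \<in> A" for a
  proof -
    have "int a \<in> D" using that by (intro D_S additive_span_incl) auto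
    have "int (a mod d) = int a + (- int (a div d)) * int d"
      by (simp add: zmod_int zdiv_int minus_div_mult_eq_mod[symmetric])
    then have "int (a mod d) \<in> D"
      using D_add[OF \<open>int a \<in> D\<close> D_mult'[OF d(2)]] by metis
    moreover have "a mod d < d" using d by simp
    ultimately have "\<not> a mod d > 0" using not_less_Least[of "a mod d" "\<lambda>n. n > 0 \<and> int n \<in> D"] d_def by auto
    then show ?thesis by auto
  qed
  then have "d dvd Gcd A" by (rule Gcd_greatest)
  then have "d = 1" using gcd by simp
  then obtain a b where ab: "1 = a - b" "a \<in> ?S" "b \<in> ?S" using d(2) by (auto simp: D_def)
  have large: "N \<in> ?S" if N: "N \<ge> b * b" for N
  proof (cases "b = 0")
    case True
    then have "int (nat N) * 1 \<in> ?S" using ab by (intro additive_span_mult) simp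
    then show ?thesis using True N by simp
  next
    case False
    then have b: "b > 0" using S_nonneg[OF ab(3)] by simp
    define q s where "q = N div b" and "s = N mod b"
    have "q \<ge> b" using N b unfolding q_def by (metis less_irrefl nonzero_mult_div_cancel_right zdiv_mono1)
    moreover have "0 \<le> s" "s < b" using b by (auto simp: s_def)
    moreover have "N = (q - s) * b + s * a"
    proof -
      have "a = b + 1" "N = q * b + s" using ab(1) by (simp_all add: q_def s_def)
      then show ?thesis by (simp add: algebra_simps)
    qed
    moreover have "int (nat (q - s)) * b + int (nat s) * a \<in> ?S"
      by (intro additive_span_add additive_span_mult ab)
    ultimately show ?thesis by simp
  qed
  show ?thesis
    by (rule exI[of _ "b * b - y"]) (auto intro!: large)
qed

section \<open>The tilted Green function\<close>

text \<open>The hypotheses of the limit theorem in analytic form, with \<open>p\<close> the step law and \<open>offs\<close> the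
  law of \<open>N\<close>. Since \<open>walk_mean p (hit p n) 0 = P(\<tau> = n + 1)\<close>, \<open>malthus\<close> says that
  \<open>m E[e\<^bsup>-r\<tau>\<^esup>] = 1\<close> and \<open>supercritical\<close> that \<open>m P(\<tau> < \<infinity>) > 1\<close>; \<open>t1\<close> is any exponent beyond \<open>t0\<close>
  with a finite exponential moment.\<close>

locale catalytic =
  fixes p :: "int pmf" and offs :: "nat pmf" and m r t0 t1 :: real
  assumes r_pos: "r > 0" and t0_pos: "t0 > 0" and t1: "t0 < t1"
    and int_t0: "integrable (measure_pmf p) (\<lambda>z. exp (t0 * real_of_int z))"
    and exp_t0: "(\<integral>z. exp (t0 * real_of_int z) \<partial>measure_pmf p) = exp r"
    and int_t1: "integrable (measure_pmf p) (\<lambda>z. exp (t1 * real_of_int z))"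
    and span: "additive_span (set_pmf p) = UNIV"
    and malthus: "m * (exp (- r) * walk_mean p (hit_gf p (exp (- r))) 0) = 1"
    and aperiodic: "Gcd {Suc n | n. walk_mean p (hit p n) 0 > 0} = 1"
    and offs_int: "integrable (measure_pmf offs) real"
    and m_eq: "m = measure_pmf.expectation offs real"
    and offs_sq: "integrable (measure_pmf offs) (\<lambda>k. (real k)\<^sup>2)"
    and supercritical: "m * walk_mean p (hit_gf p 1) 0 > 1"
begin

abbreviation disc :: real where "disc \<equiv> exp (- r)"
abbreviation \<phi> :: "int \<Rightarrow> real" where "\<phi> \<equiv> hit_gf p disc"

lemma disc: "0 \<le> disc" "disc \<le> 1" "disc < 1" "0 < disc"
  using r_pos by auto

lemmas phi_nonneg [simp] = hit_gf_nonneg[OF disc(1,2), of p]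
lemmas phi_le_1 [simp] = hit_gf_le_1[OF disc(1,2), of p]
lemmas phi_0 [simp] = hit_gf_0[OF disc(1,2), of p]
lemmas bdd_phi [simp, intro] = bdd_fun_hit_gf[OF disc(1,2), of p]

text \<open>Together with the next equation: \<open>\<phi>\<close> is an eigenfunction, with eigenvalue \<open>e\<^sup>r\<close>, of the mean
  operator of the branching walk, which averages over one step and multiplies by \<open>m\<close> at the
  origin.\<close>

lemma phi_step: "x \<noteq> 0 \<Longrightarrow> walk_mean p \<phi> x = exp r * \<phi> x"
  using walk_mean_hit_gf[OF disc(1,2), of x p] by (simp add: exp_minus divide_simps mult.commute)

lemma phi_step_0: "m * walk_mean p \<phi> 0 = exp r"
  using malthus by (simp add: exp_minus divide_simps mult.commute)

lemma m_nonneg: "m \<ge> 0" unfolding m_eq by simp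

lemma m_gt_1: "m > 1"
proof -
  have "walk_mean p (hit_gf p 1) 0 \<le> 1"
    by (rule walk_mean_le) (auto simp: hit_gf_le_1)
  then have "m * walk_mean p (hit_gf p 1) 0 \<le> m * 1" by (intro mult_left_mono m_nonneg)
  then show ?thesis using supercritical by simp
qed

text \<open>The discounted Green function \<open>\<Sum>\<^sub>n e\<^bsup>-rn\<^esup> P\<^sub>0(S\<^sub>n > k)\<close> of a half-line.\<close>

definition gtail :: "int \<Rightarrow> real" where
  "gtail k = (\<Sum>n. disc ^ n * tail p n k)"

definition green_bound :: real where "green_bound = 1 / (1 - disc)"

lemma green_bound_pos: "green_bound > 0" using disc by (simp add: green_bound_def)

lemma disc_sums: "(\<lambda>n. disc ^ n) sums green_bound"
  unfolding green_bound_def using geometric_sums[of disc] disc by simp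

lemma disc_partial: "(\<Sum>i<n. disc ^ i) \<le> green_bound"
  using sum_le_suminf[OF sums_summable[OF disc_sums], of "{..<n}"] sums_unique[OF disc_sums] disc by simp

lemma gtail_partial: "(\<Sum>i<n. disc ^ i * tail p i k) \<le> green_bound"
proof -
  have "(\<Sum>i<n. disc ^ i * tail p i k) \<le> (\<Sum>i<n. disc ^ i)"
    using tail_bounds by (intro sum_mono) (auto simp: mult_left_le)
  then show ?thesis using disc_partial[of n] by simp
qed

lemma gtail_sums: "(\<lambda>n. disc ^ n * tail p n k) sums gtail k"
  unfolding gtail_def using tail_bounds gtail_partial
  by (intro summable_sums summableI_nonneg_bounded[where x = green_bound]) auto

lemma gtail_nonneg: "0 \<le> gtail k"
  by (rule sums_le[OF _ sums_zero gtail_sums]) (use tail_bounds in auto)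

lemma gtail_le: "gtail k \<le> green_bound"
  using LIMSEQ_le_const2[OF gtail_sums[unfolded sums_def]] gtail_partial by blast

lemma bdd_gtail [simp, intro]: "bdd_fun gtail"
  by (rule bdd_funI[of _ green_bound]) (use gtail_nonneg gtail_le in auto)

lemma gtail_step_sums: "(\<lambda>n. disc ^ n * tail p (Suc n) k) sums (\<integral>z. gtail (k - z) \<partial>measure_pmf p)"
proof -
  have "(\<lambda>n. \<integral>z. disc ^ n * tail p n (k - z) \<partial>measure_pmf p) sums (\<integral>z. gtail (k - z) \<partial>measure_pmf p)"
  proof (rule pmf_expectation_sums[where B = green_bound])
    show "\<bar>\<Sum>i<n. disc ^ i * tail p i (k - z)\<bar> \<le> green_bound" for n z
      using gtail_partial[of "k - z" n] sum_nonneg[of "{..<n}" "\<lambda>i. disc ^ i * tail p i (k - z)"] tail_bounds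
      by (simp add: abs_le_iff)
  qed (rule gtail_sums)
  then show ?thesis by simp
qed

lemma gtail_rec: "gtail k = of_bool (k < 0) + disc * (\<integral>z. gtail (k - z) \<partial>measure_pmf p)"
proof -
  have "(\<lambda>n. disc ^ Suc n * tail p (Suc n) k) sums (disc * (\<integral>z. gtail (k - z) \<partial>measure_pmf p))"
    using sums_mult[OF gtail_step_sums[of k], of disc] by (simp add: mult_ac)
  from sums_Suc[OF this] have "(\<lambda>n. disc ^ n * tail p n k) sums (disc * (\<integral>z. gtail (k - z) \<partial>measure_pmf p) + of_bool (k < 0))"
    by simp
  then show ?thesis using gtail_sums[of k] sums_unique2 by fastforce
qed

text \<open>The Cramer transform of the step law; its total mass is 1 because \<open>\<psi>(t0) = r\<close>.\<close>

definition tilted :: "int pmf" where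
  "tilted = embed_pmf (\<lambda>z. exp (t0 * real_of_int z - r) * pmf p z)"

lemma pmf_tilted: "pmf tilted z = exp (t0 * real_of_int z - r) * pmf p z"
  unfolding tilted_def
proof (rule pmf_embed_pmf)
  have "(\<integral>\<^sup>+z. ennreal (exp (t0 * real_of_int z - r) * pmf p z) \<partial>count_space UNIV)
      = (\<integral>\<^sup>+z. ennreal (pmf p z) * ennreal (exp (t0 * real_of_int z - r)) \<partial>count_space UNIV)"
    by (intro nn_integral_cong) (simp add: ennreal_mult' mult.commute)
  also have "\<dots> = (\<integral>\<^sup>+z. ennreal (exp (t0 * real_of_int z - r)) \<partial>measure_pmf p)"
    by (simp add: nn_integral_measure_pmf)
  also have "\<dots> = ennreal (\<integral>z. exp (t0 * real_of_int z - r) \<partial>measure_pmf p)"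
    using int_t0 by (intro nn_integral_eq_integral) (auto simp: exp_diff)
  also have "\<dots> = 1" by (simp add: exp_diff exp_t0)
  finally show "(\<integral>\<^sup>+z. ennreal (exp (t0 * real_of_int z - r) * pmf p z) \<partial>count_space UNIV) = 1" .
qed simp

lemma measure_tilted: "measure_pmf tilted = density (measure_pmf p) (\<lambda>z. ennreal (exp (t0 * real_of_int z - r)))"
proof (rule measure_eqI)
  fix A assume "A \<in> sets (measure_pmf tilted)"
  have "emeasure (measure_pmf tilted) A = (\<integral>\<^sup>+z. ennreal (pmf tilted z) * indicator A z \<partial>count_space UNIV)"
    by (simp add: nn_integral_measure_pmf[symmetric])
  also have "\<dots> = (\<integral>\<^sup>+z. ennreal (pmf p z) * (ennreal (exp (t0 * real_of_int z - r)) * indicator A z) \<partial>count_space UNIV)"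
    by (intro nn_integral_cong) (simp add: pmf_tilted ennreal_mult' mult_ac)
  also have "\<dots> = emeasure (density (measure_pmf p) (\<lambda>z. ennreal (exp (t0 * real_of_int z - r)))) A"
    by (simp add: emeasure_density nn_integral_measure_pmf)
  finally show "emeasure (measure_pmf tilted) A = emeasure (density (measure_pmf p) (\<lambda>z. ennreal (exp (t0 * real_of_int z - r)))) A" .
qed simp

lemma integral_tilted:
  "(\<integral>z. h z \<partial>measure_pmf tilted) = (\<integral>z. exp (t0 * real_of_int z - r) * h z \<partial>measure_pmf p)" for h :: "int \<Rightarrow> real"
  unfolding measure_tilted by (subst integral_density) auto

lemma integrable_tilted:
  "integrable (measure_pmf tilted) h \<longleftrightarrow> integrable (measure_pmf p) (\<lambda>z. exp (t0 * real_of_int z - r) * h z)" for h :: "int \<Rightarrow> real"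
  unfolding measure_tilted by (subst integrable_density) auto

lemma set_tilted: "set_pmf tilted = set_pmf p"
  by (auto simp: set_pmf_iff pmf_tilted)

lemma tilted_mean: "integrable (measure_pmf tilted) real_of_int"
  unfolding integrable_tilted
proof (rule Bochner_Integration.integrable_bound)
  show "integrable (measure_pmf p) (\<lambda>z. exp (- r) * (exp (t1 * real_of_int z) / (t1 - t0) + 1 / t0))"
    using int_t1 by auto
  have "\<bar>exp (t0 * x - r) * x\<bar> \<le> exp (- r) * (exp (t1 * x) / (t1 - t0) + 1 / t0)" for x :: real
  proof (cases "x \<ge> 0")
    case True
    have "(t1 - t0) * x \<le> exp ((t1 - t0) * x)" using exp_ge_add_one_self[of "(t1 - t0) * x"] by linarith
    then have "x \<le> exp ((t1 - t0) * x) / (t1 - t0)" using t1 by (simp add: field_simps)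
    then have "exp (t0 * x - r) * x \<le> exp (t0 * x - r) * (exp ((t1 - t0) * x) / (t1 - t0))"
      by (intro mult_left_mono) auto
    also have "\<dots> = exp (t0 * x - r) * exp ((t1 - t0) * x) / (t1 - t0)" by simp
    also have "\<dots> = exp (- r) * exp (t1 * x) / (t1 - t0)"
      unfolding mult_exp_exp by (simp add: algebra_simps)
    also have "\<dots> = exp (- r) * (exp (t1 * x) / (t1 - t0))" by simp
    also have "\<dots> \<le> exp (- r) * (exp (t1 * x) / (t1 - t0) + 1 / t0)"
      using t0_pos by (intro mult_left_mono) auto
    finally show ?thesis using True by (simp add: abs_mult)
  next
    case False
    have "- x * t0 \<le> exp (- (t0 * x))" using exp_ge_add_one_self[of "- (t0 * x)"] by (simp add: mult.commute)
    then have "- x \<le> exp (- (t0 * x)) * (1 / t0)" using t0_pos by (simp add: field_simps)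
    then have "exp (t0 * x - r) * - x \<le> exp (t0 * x - r) * (exp (- (t0 * x)) * (1 / t0))"
      by (intro mult_left_mono) auto
    also have "\<dots> = exp (t0 * x - r) * exp (- (t0 * x)) * (1 / t0)" by (simp only: mult.assoc)
    also have "\<dots> = exp (- r) * (1 / t0)" unfolding mult_exp_exp by simp
    also have "\<dots> \<le> exp (- r) * (exp (t1 * x) / (t1 - t0) + 1 / t0)"
      using t1 by (intro mult_left_mono) auto
    finally show ?thesis using False by (simp add: abs_mult)
  qed
  then show "AE z in measure_pmf p. norm (exp (t0 * real_of_int z - r) * real_of_int z)
      \<le> norm (exp (- r) * (exp (t1 * real_of_int z) / (t1 - t0) + 1 / t0))"
    unfolding real_norm_def by (intro AE_I2 order_trans[OF _ abs_ge_self])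
qed simp

definition vtail :: "int \<Rightarrow> real" where
  "vtail k = exp (t0 * real_of_int k) * gtail k"

lemma exp_tilt: "exp (t0 * real_of_int k) * (disc * (\<integral>z. h (k - z) \<partial>measure_pmf p))
    = (\<integral>z. exp (t0 * real_of_int (k - z)) * h (k - z) \<partial>measure_pmf tilted)"
proof -
  have *: "exp (t0 * real_of_int z - r) * (exp (t0 * real_of_int (k - z)) * h (k - z))
      = (exp (t0 * real_of_int k) * disc) * h (k - z)" for z
  proof -
    have "exp (t0 * real_of_int z - r) * exp (t0 * real_of_int (k - z)) = exp (t0 * real_of_int k) * disc"
      unfolding mult_exp_exp by (simp add: algebra_simps)
    then show ?thesis by (simp only: mult.assoc[symmetric])
  qed
  show ?thesis unfolding integral_tilted * by simp
qed

lemma vtail_rec: "vtail k = exp (t0 * real_of_int k) * of_bool (k < 0) + (\<integral>z. vtail (k - z) \<partial>measure_pmf tilted)"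
  using exp_tilt[of k gtail] by (simp add: vtail_def gtail_rec[of k] ring_distribs)

text \<open>Induction on the number of terms. To the left of the origin the discount alone gives the
  bound; to the right the renewal equation has no source, and an average of numbers below the
  bound stays below it.\<close>

lemma vtail_partial_le: "exp (t0 * real_of_int k) * (\<Sum>i<n. disc ^ i * tail p i k) \<le> green_bound"
proof (induction n arbitrary: k)
  case 0
  then show ?case using green_bound_pos by simp
next
  case (Suc n)
  show ?case
  proof (cases "k < 0")
    case True
    have "exp (t0 * real_of_int k) * (\<Sum>i<Suc n. disc ^ i * tail p i k) \<le> 1 * green_bound"
      using True t0_pos gtail_partial[of k "Suc n"] tail_bounds
      by (intro mult_mono) (auto simp: mult_nonneg_nonpos intro!: sum_nonneg simp del: sum.lessThan_Suc)
    then show ?thesis by simp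
  next
    case False
    have "(\<Sum>i<Suc n. disc ^ i * tail p i k) = disc * (\<integral>z. (\<Sum>i<n. disc ^ i * tail p i (k - z)) \<partial>measure_pmf p)"
      using False by (simp add: sum.lessThan_Suc_shift sum_distrib_left mult_ac del: sum.lessThan_Suc)
    then have "exp (t0 * real_of_int k) * (\<Sum>i<Suc n. disc ^ i * tail p i k)
        = (\<integral>z. exp (t0 * real_of_int (k - z)) * (\<Sum>i<n. disc ^ i * tail p i (k - z)) \<partial>measure_pmf tilted)"
      using exp_tilt[of k "\<lambda>k. \<Sum>i<n. disc ^ i * tail p i k"] by simp
    also have "\<dots> \<le> (\<integral>z. green_bound \<partial>measure_pmf tilted)"
    proof (intro integral_mono integrable_bdd_fun)
      show "bdd_fun (\<lambda>z. exp (t0 * real_of_int (k - z)) * (\<Sum>i<n. disc ^ i * tail p i (k - z)))"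
      proof (rule bdd_funI)
        fix z
        have "0 \<le> exp (t0 * real_of_int (k - z)) * (\<Sum>i<n. disc ^ i * tail p i (k - z))"
          using tail_bounds by (intro mult_nonneg_nonneg sum_nonneg) auto
        then show "\<bar>exp (t0 * real_of_int (k - z)) * (\<Sum>i<n. disc ^ i * tail p i (k - z))\<bar> \<le> green_bound"
          using Suc[of "k - z"] by linarith
      qed
      show "exp (t0 * real_of_int (k - z)) * (\<Sum>i<n. disc ^ i * tail p i (k - z)) \<le> green_bound" for z
        by (rule Suc)
    qed simp
    finally show ?thesis by simp
  qed
qed

lemma vtail_nonneg: "0 \<le> vtail k"
  using gtail_nonneg by (simp add: vtail_def)

lemma vtail_le: "vtail k \<le> green_bound"
proof -
  have "(\<lambda>n. exp (t0 * real_of_int k) * (\<Sum>i<n. disc ^ i * tail p i k)) \<longlonglongrightarrow> vtail k"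
    unfolding vtail_def using gtail_sums[of k] by (intro tendsto_mult tendsto_const) (simp add: sums_def)
  then show ?thesis using LIMSEQ_le_const2 vtail_partial_le by blast
qed

text \<open>The source of the renewal equation is \<open>e\<^bsup>t0 k\<^esup>\<close> on the negative half-line. Boundedness and
  the decay at \<open>-\<infinity>\<close> both come from the discount.\<close>

lemma vtail_limit: "\<exists>V>0. (vtail \<longlongrightarrow> V) at_top"
proof (rule renewal_theorem[OF vtail_nonneg vtail_le vtail_rec])
  show "(vtail \<longlongrightarrow> 0) at_bot"
  proof (rule tendsto_sandwich[OF always_eventually always_eventually tendsto_const])
    show "\<forall>k. 0 \<le> vtail k" using vtail_nonneg by blast
    show "\<forall>k. vtail k \<le> green_bound * exp (t0 * real_of_int k)"
      using gtail_le by (auto simp: vtail_def mult.commute)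
    have "filterlim (\<lambda>k. t0 * real_of_int k) at_bot at_bot"
      by (rule filterlim_tendsto_pos_mult_at_bot[OF tendsto_const t0_pos])
         (auto simp: filterlim_at_bot eventually_at_bot_linorder le_floor_iff intro!: exI[of _ "\<lfloor>Z\<rfloor>" for Z])
    then have "((\<lambda>k. exp (t0 * real_of_int k)) \<longlongrightarrow> 0) at_bot"
      by (rule filterlim_compose[OF exp_at_bot])
    from tendsto_mult[OF tendsto_const this]
    show "((\<lambda>k. green_bound * exp (t0 * real_of_int k)) \<longlongrightarrow> 0) at_bot" by simp
  qed
  show "0 < exp (t0 * real_of_int (-1)) * of_bool ((-1::int) < 0)" by simp
qed (auto simp: tilted_mean set_tilted span)

end

section \<open>The mean number of particles beyond a barrier\<close>

text \<open>The expected sum of \<open>h\<close> over the positions at time \<open>n\<close> of the particles that descend from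
  one particle at \<open>x\<close>, by recursion on the first generation.\<close>

primrec popmean :: "int pmf \<Rightarrow> real \<Rightarrow> (int \<Rightarrow> real) \<Rightarrow> nat \<Rightarrow> int \<Rightarrow> real" where
  "popmean p m h 0 = h"
| "popmean p m h (Suc n) = (\<lambda>x. (if x = 0 then m else 1) * walk_mean p (popmean p m h n) x)"

lemma bdd_popmean [simp, intro]: "bdd_fun h \<Longrightarrow> bdd_fun (popmean p m h n)"
  by (induction n) auto

lemma popmean_nonneg: "m \<ge> 0 \<Longrightarrow> (\<And>x. 0 \<le> h x) \<Longrightarrow> 0 \<le> popmean p m h n x"
  by (induction n arbitrary: x) (auto intro!: walk_mean_nonneg mult_nonneg_nonneg)

fun renewal_seq :: "(nat \<Rightarrow> real) \<Rightarrow> nat \<Rightarrow> real" where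
  "renewal_seq w 0 = 1"
| "renewal_seq w (Suc n) = (\<Sum>i\<le>n. w i * renewal_seq w (n - i))"

text \<open>In terms of generating functions, \<open>(1 - z w(z)) Y(z) = H(z)\<close>, and that of \<open>renewal_seq w\<close>
  is the inverse of \<open>1 - z w(z)\<close>.\<close>

lemma renewal_seq_solves:
  assumes Y0: "Y 0 = H 0" and Y: "\<And>n. Y (Suc n) = H (Suc n) + (\<Sum>i\<le>n. w i * Y (n - i))"
  shows "Y n = (\<Sum>i\<le>n. H i * renewal_seq w (n - i))"
proof -
  define W Yf Hf B where "W = fps_X * Abs_fps w" and "Yf = Abs_fps Y" and "Hf = Abs_fps H"
    and "B = Abs_fps (renewal_seq w)"
  have W_mult: "fps_nth (W * Z) 0 = 0" "fps_nth (W * Z) (Suc n) = (\<Sum>i\<le>n. w i * fps_nth Z (n - i))" for Z n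
    unfolding W_def mult.assoc fps_X_mult_nth by (simp_all add: fps_mult_nth atMost_atLeast0)
  have W_0: "fps_nth W 0 = 0" by (simp add: W_def)
  have "Yf = Hf + W * Yf"
  proof (rule fps_ext)
    fix n show "fps_nth Yf n = fps_nth (Hf + W * Yf) n"
      by (cases n) (simp_all add: W_mult W_0 Y0 Y Yf_def Hf_def)
  qed
  then have 1: "(1 - W) * Yf = Hf" by (simp add: algebra_simps)
  have "B = 1 + W * B"
  proof (rule fps_ext)
    fix n show "fps_nth B n = fps_nth (1 + W * B) n"
      by (cases n) (simp_all add: W_mult W_0 B_def)
  qed
  then have 2: "(1 - W) * B = 1" by (simp add: algebra_simps)
  have "Yf = ((1 - W) * B) * Yf" by (simp add: 2)
  also have "\<dots> = ((1 - W) * Yf) * B" by (simp add: mult_ac)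
  also have "\<dots> = Hf * B" by (simp add: 1)
  finally have "fps_nth Yf n = fps_nth (Hf * B) n" by simp
  then show ?thesis by (simp add: Yf_def Hf_def B_def fps_mult_nth atMost_atLeast0)
qed

context catalytic
begin

abbreviation ret :: "nat \<Rightarrow> real" where "ret i \<equiv> walk_mean p (hit p i) 0"

text \<open>The Malthusian equation makes this a probability distribution, the law of \<open>\<tau> - 1\<close> under the
  change of measure with density \<open>m e\<^bsup>-r\<tau>\<^esup>\<close>.\<close>

definition return_weight :: "nat \<Rightarrow> real" where "return_weight i = m * disc ^ Suc i * ret i"

abbreviation renewal :: "nat \<Rightarrow> real" where "renewal \<equiv> renewal_seq return_weight"

lemma ret_nonneg [simp]: "ret i \<ge> 0" by (rule walk_mean_nonneg) simp

lemma ret_le_1: "ret i \<le> 1"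
proof (intro walk_mean_le bdd_fun_hit)
  show "hit p i y \<le> 1" for y
    using hit_partial_sum_le[of p y "Suc i"] sum_nonneg[of "{..<i}" "\<lambda>j. hit p j y"] by simp
qed

lemma return_weight_nonneg [simp]: "return_weight i \<ge> 0" unfolding return_weight_def using m_nonneg by simp

lemma return_weight_sums: "return_weight sums 1"
proof -
  have "(\<lambda>n. m * (disc * (disc ^ n * ret n))) sums (m * (disc * walk_mean p \<phi> 0))"
    by (intro sums_mult walk_mean_hit_gf_sums disc)
  then show ?thesis using malthus by (simp add: return_weight_def[abs_def] mult_ac)
qed

lemma return_weight_partial: "(\<Sum>i<n. return_weight i) \<le> 1"
  using sum_le_suminf[OF sums_summable[OF return_weight_sums], of "{..<n}"] sums_unique[OF return_weight_sums] by simp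

lemma renewal_nonneg [simp]: "renewal n \<ge> 0"
proof (induction n rule: less_induct)
  case (less n)
  then show ?case by (cases n) (auto intro!: sum_nonneg mult_nonneg_nonneg)
qed

lemma renewal_le_1: "renewal n \<le> 1"
proof (induction n rule: less_induct)
  case (less n)
  show ?case
  proof (cases n)
    case (Suc k)
    have "renewal n \<le> (\<Sum>i\<le>k. return_weight i)"
      unfolding Suc renewal_seq.simps using less Suc by (intro sum_mono mult_left_le) auto
    then show ?thesis using return_weight_partial[of "Suc k"] by (simp add: lessThan_Suc_atMost)
  qed simp
qed

definition return_pmf_nat :: "nat pmf" where "return_pmf_nat = embed_pmf return_weight"

lemma pmf_return_pmf_nat: "pmf return_pmf_nat i = return_weight i"
  unfolding return_pmf_nat_def
proof (rule pmf_embed_pmf)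
  have "(\<integral>\<^sup>+ i. ennreal (return_weight i) \<partial>count_space UNIV) = (\<Sum>i. ennreal (return_weight i))"
    by (rule nn_integral_count_space_nat)
  also have "\<dots> = ennreal 1" using return_weight_sums by (intro suminf_ennreal_eq) auto
  finally show "(\<integral>\<^sup>+ i. ennreal (return_weight i) \<partial>count_space UNIV) = 1" by simp
qed simp

lemma return_mean_integrable: "integrable (measure_pmf return_pmf_nat) (\<lambda>i. real (Suc i))"
  unfolding measure_pmf_eq_density
proof (subst integrable_density)
  have "summable (\<lambda>n. m * (disc * (real (Suc n) * disc ^ n)))"
    using geometric_deriv_sums[of disc] disc by (intro summable_mult) (auto dest: sums_summable)
  then have "summable (\<lambda>n. norm (return_weight n * real (Suc n)))"
  proof (rule summable_comparison_test'[where N = 0])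
    fix n
    have "m * disc ^ Suc n * ret n * real (Suc n) \<le> m * disc ^ Suc n * 1 * real (Suc n)"
      using m_nonneg ret_le_1[of n] by (intro mult_right_mono mult_left_mono) auto
    then show "norm (norm (return_weight n * real (Suc n))) \<le> m * (disc * (real (Suc n) * disc ^ n))"
      using m_nonneg by (simp add: return_weight_def mult_ac)
  qed
  then show "integrable (count_space UNIV) (\<lambda>x. pmf return_pmf_nat x *\<^sub>R real (Suc x))"
    by (simp add: integrable_count_space_nat_iff pmf_return_pmf_nat)
qed auto

text \<open>The renewal theorem for the tilted return time, whose mean is finite because of the
  exponential factor. Extended by 0 to the negative integers, the renewal sequence solves the
  equation on \<open>\<int>\<close> with a unit source at 0.\<close>

lemma renewal_limit: "\<exists>c>0. renewal \<longlonglongrightarrow> c"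
proof -
  define q where "q = map_pmf (\<lambda>i. int (Suc i)) return_pmf_nat"
  define g where "g y = (if y < 0 then 0 else renewal (nat y))" for y :: int
  have "\<exists>c>0. (g \<longlongrightarrow> c) at_top"
  proof (rule renewal_theorem[where C = 1 and s = "\<lambda>y. of_bool (y = 0)" and ?y0.0 = 0 and q = q])
    fix y :: int
    show "g y = of_bool (y = 0) + (\<integral>z. g (y - z) \<partial>measure_pmf q)"
    proof (cases "y \<le> 0")
      case True
      then have "(\<integral>z. g (y - z) \<partial>measure_pmf q) = 0" by (simp add: q_def g_def)
      then show ?thesis using True by (auto simp: g_def)
    next
      case False
      then obtain n' where n': "n' > 0" "y = int n'" using zero_less_imp_eq_int[of y] by auto
      then obtain n where n: "y = int (Suc n)" using gr0_implies_Suc by blast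
      have "(\<integral>z. g (y - z) \<partial>measure_pmf q) = (\<integral>i. g (y - int (Suc i)) \<partial>measure_pmf return_pmf_nat)"
        by (simp add: q_def)
      also have "\<dots> = (\<Sum>i\<in>{..n}. g (y - int (Suc i)) * pmf return_pmf_nat i)"
        by (rule integral_measure_pmf_real) (auto simp: g_def n split: if_splits)
      also have "\<dots> = renewal (Suc n)"
      proof -
        have "g (y - int (Suc i)) = renewal (n - i)" if "i \<le> n" for i
        proof -
          have "y - int (Suc i) = int (n - i)" using that n by simp
          then show ?thesis by (simp add: g_def)
        qed
        then show ?thesis unfolding renewal_seq.simps pmf_return_pmf_nat
          by (intro sum.cong refl) (simp add: mult.commute)
      qed
      finally show ?thesis by (simp add: g_def n nat_add_distrib)
    qed
    show "\<exists>K0. \<forall>K\<ge>K0. y + K \<in> additive_span (set_pmf q)"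
    proof -
      have "set_pmf q = int ` {Suc n |n. 0 < ret n}"
      proof -
        have "set_pmf return_pmf_nat = {n. 0 < ret n}"
        proof (rule set_eqI)
          fix n
          have "return_weight n \<noteq> 0 \<longleftrightarrow> ret n \<noteq> 0" using m_gt_1 by (simp add: return_weight_def)
          then show "n \<in> set_pmf return_pmf_nat \<longleftrightarrow> n \<in> {n. 0 < ret n}"
            using ret_nonneg[of n] unfolding set_pmf_iff pmf_return_pmf_nat mem_Collect_eq by linarith
        qed
        then show ?thesis unfolding q_def set_map_pmf by blast
      qed
      then show ?thesis using additive_span_eventually_all[OF aperiodic] by simp
    qed
    show "integrable (measure_pmf q) real_of_int" using return_mean_integrable by (simp add: q_def)
    show "(g \<longlongrightarrow> 0) at_bot"
      by (rule tendsto_eventually) (auto simp: eventually_at_bot_dense g_def)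
  qed (auto simp: g_def renewal_le_1)
  then obtain c where c: "c > 0" "(g \<longlongrightarrow> c) at_top" by blast
  have "(\<lambda>n. g (int n)) \<longlonglongrightarrow> c"
    by (rule filterlim_compose[OF c(2) filterlim_int_sequentially])
  then show ?thesis using c(1) by (auto simp: g_def)
qed

text \<open>For \<open>i \<ge> 1\<close> this is \<open>m e\<^bsup>-ri\<^esup> P\<^sub>0(S\<^sub>i > k, \<tau> > i)\<close>: the discounted mean number of particles
  beyond \<open>k\<close> at time \<open>i\<close> that descend from one particle at the origin and have not come back
  to it.\<close>

definition escape :: "int \<Rightarrow> nat \<Rightarrow> real" where
  "escape k i = (case i of 0 \<Rightarrow> of_bool (k < 0)
     | Suc j \<Rightarrow> m * disc ^ Suc j * walk_mean p (avoid p (above k) j) 0)"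

abbreviation mean_above :: "int \<Rightarrow> nat \<Rightarrow> int \<Rightarrow> real" where
  "mean_above k n x \<equiv> popmean p m (above k) n x"

lemma mean_above_nonneg [simp]: "0 \<le> mean_above k n x"
  by (rule popmean_nonneg[OF m_nonneg]) simp

lemma escape_nonneg [simp]: "0 \<le> escape k i"
  using m_nonneg by (auto simp: escape_def split: nat.split intro!: walk_mean_nonneg avoid_nonneg mult_nonneg_nonneg)

lemma mean_above_first_hit: "mean_above k n x = avoid p (above k) n x + (\<Sum>i\<le>n. hit p i x * mean_above k (n - i) 0)"
  using first_hit_decomposition[of "\<lambda>n. popmean p m (above k) n" p n x] by simp

text \<open>The first-visit decomposition after the first step is a renewal equation in \<open>n\<close>. Its
  solution is the decomposition at the last visit to the origin.\<close>

lemma mean_above_renewal: "disc ^ n * mean_above k n 0 = (\<Sum>i\<le>n. escape k i * renewal (n - i))"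
proof (rule renewal_seq_solves)
  fix n
  have "mean_above k (Suc n) 0 = m * walk_mean p (\<lambda>x. avoid p (above k) n x + (\<Sum>i\<le>n. hit p i x * mean_above k (n - i) 0)) 0"
  proof -
    have "mean_above k n = (\<lambda>x. avoid p (above k) n x + (\<Sum>i\<le>n. hit p i x * mean_above k (n - i) 0))"
      by (rule ext) (rule mean_above_first_hit)
    from arg_cong[where f = "\<lambda>f. m * walk_mean p f 0", OF this] show ?thesis by simp
  qed
  also have "\<dots> = m * (walk_mean p (avoid p (above k) n) 0 + (\<Sum>i\<le>n. ret i * mean_above k (n - i) 0))"
    by (simp add: walk_mean_add walk_mean_sum walk_mean_multc)
  finally have "disc ^ Suc n * mean_above k (Suc n) 0 = disc ^ Suc n *
      (m * (walk_mean p (avoid p (above k) n) 0 + (\<Sum>i\<le>n. ret i * mean_above k (n - i) 0)))"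
    by (rule arg_cong)
  also have "\<dots> = escape k (Suc n) + (\<Sum>i\<le>n. return_weight i * (disc ^ (n - i) * mean_above k (n - i) 0))"
  proof -
    have *: "disc ^ Suc n * (m * (ret i * mean_above k (n - i) 0)) = return_weight i * (disc ^ (n - i) * mean_above k (n - i) 0)" if "i \<le> n" for i
    proof -
      have "disc ^ Suc n = disc ^ Suc i * disc ^ (n - i)"
        using that by (simp flip: power_add power_Suc)
      then show ?thesis by (simp add: return_weight_def mult_ac)
    qed
    have "(\<Sum>i\<le>n. return_weight i * (disc ^ (n - i) * mean_above k (n - i) 0)) = (\<Sum>i\<le>n. disc ^ Suc n * (m * (ret i * mean_above k (n - i) 0)))"
      by (intro sum.cong refl *[symmetric]) simp
    then show ?thesis by (simp only: escape_def nat.case distrib_left sum_distrib_left mult_ac)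
  qed
  finally show "disc ^ Suc n * mean_above k (Suc n) 0 = escape k (Suc n) + (\<Sum>i\<le>n. return_weight i * (disc ^ (n - i) * mean_above k (n - i) 0))" .
qed (simp add: escape_def)

lemma avoid_gf_sums: "(\<lambda>n. disc ^ n * avoid p (above k) n x) sums (gtail (k - x) - \<phi> x * gtail k)"
proof -
  have "summable (\<lambda>n. norm (disc ^ n * hit p n x))" "summable (\<lambda>n. norm (disc ^ n * tail p n k))"
    using sums_summable[OF hit_gf_sums[OF disc(1,2), of p x]] sums_summable[OF gtail_sums[of k]] tail_bounds by auto
  from Cauchy_product_sums[OF this]
  have "(\<lambda>n. \<Sum>i\<le>n. disc ^ i * hit p i x * (disc ^ (n - i) * tail p (n - i) k)) sums (\<phi> x * gtail k)"
    using sums_unique[OF hit_gf_sums[OF disc(1,2), of p x]] sums_unique[OF gtail_sums[of k]] by simp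
  from sums_diff[OF gtail_sums[of "k - x"] this]
  have "(\<lambda>n. disc ^ n * tail p n (k - x) - (\<Sum>i\<le>n. disc ^ i * hit p i x * (disc ^ (n - i) * tail p (n - i) k)))
     sums (gtail (k - x) - \<phi> x * gtail k)" .
  moreover have "disc ^ n * tail p n (k - x) - (\<Sum>i\<le>n. disc ^ i * hit p i x * (disc ^ (n - i) * tail p (n - i) k))
     = disc ^ n * avoid p (above k) n x" for n
  proof -
    have "disc ^ i * hit p i x * (disc ^ (n - i) * tail p (n - i) k) = disc ^ n * (hit p i x * tail p (n - i) k)" if "i \<le> n" for i
    proof -
      have "disc ^ n = disc ^ i * disc ^ (n - i)" using that by (simp flip: power_add)
      then show ?thesis by (simp add: mult_ac)
    qed
    then have "(\<Sum>i\<le>n. disc ^ i * hit p i x * (disc ^ (n - i) * tail p (n - i) k)) = (\<Sum>i\<le>n. disc ^ n * (hit p i x * tail p (n - i) k))"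
      by (intro sum.cong) auto
    then show ?thesis by (simp only: avoid_indicator right_diff_distrib sum_distrib_left)
  qed
  ultimately show ?thesis by simp
qed

lemma avoid_gf_partial:
  "\<bar>\<Sum>i<n. disc ^ i * avoid p (above k) i x\<bar> \<le> green_bound"
proof -
  have "(\<Sum>i<n. disc ^ i * avoid p (above k) i x) \<le> (\<Sum>i<n. disc ^ i * tail p i (k - x))"
    using avoid_indicator_le by (intro sum_mono mult_left_mono) auto
  moreover have "0 \<le> (\<Sum>i<n. disc ^ i * avoid p (above k) i x)"
    by (intro sum_nonneg mult_nonneg_nonneg avoid_nonneg) auto
  ultimately show ?thesis using gtail_partial[of "k - x" n] by simp
qed

text \<open>The sum over time of the first-visit decomposition is \<open>gtail (k - x) - \<phi> x * gtail k\<close>.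
  After one more step the equations for \<open>gtail\<close> and \<open>\<phi>\<close> turn it into a multiple of \<open>gtail k\<close>,
  so the Green function of the walk killed at the origin never has to be studied by itself.\<close>

lemma escape_sums: "escape k sums ((m - 1) * (gtail k - of_bool (k < 0)))"
proof -
  have "(\<lambda>n. \<integral>z. disc ^ n * avoid p (above k) n (0 + z) \<partial>measure_pmf p)
     sums (\<integral>z. gtail (k - (0 + z)) - \<phi> (0 + z) * gtail k \<partial>measure_pmf p)"
    by (rule pmf_expectation_sums[where B = green_bound]) (intro avoid_gf_partial avoid_gf_sums)+
  then have "(\<lambda>n. disc ^ n * walk_mean p (avoid p (above k) n) 0)
     sums ((\<integral>z. gtail (k - z) \<partial>measure_pmf p) - walk_mean p \<phi> 0 * gtail k)"
    by (simp add: walk_mean_def)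
  from sums_mult[OF this, of "m * disc"]
  have "(\<lambda>n. escape k (Suc n)) sums (m * disc * ((\<integral>z. gtail (k - z) \<partial>measure_pmf p) - walk_mean p \<phi> 0 * gtail k))"
    by (simp add: escape_def mult_ac)
  moreover have "escape k 0 = of_bool (k < 0)" by (simp add: escape_def)
  ultimately have "escape k sums (m * disc * ((\<integral>z. gtail (k - z) \<partial>measure_pmf p) - walk_mean p \<phi> 0 * gtail k) + of_bool (k < 0))"
    using sums_Suc[of "escape k"] by metis
  moreover have "m * disc * ((\<integral>z. gtail (k - z) \<partial>measure_pmf p) - walk_mean p \<phi> 0 * gtail k)
      = m * (disc * (\<integral>z. gtail (k - z) \<partial>measure_pmf p)) - (m * (disc * walk_mean p \<phi> 0)) * gtail k"
    by (simp add: algebra_simps)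
  moreover have "disc * (\<integral>z. gtail (k - z) \<partial>measure_pmf p) = gtail k - of_bool (k < 0)"
    using gtail_rec[of k] by simp
  ultimately show ?thesis using malthus by (simp add: algebra_simps)
qed

end

context catalytic
begin

definition speed :: real where "speed = r / t0"

lemma t0_speed: "t0 * speed = r" using t0_pos by (simp add: speed_def)

definition mean_above_const :: real where "mean_above_const = (m - 1) * green_bound"

lemma mean_above_const_pos: "mean_above_const > 0" using m_gt_1 green_bound_pos by (simp add: mean_above_const_def)

lemma escape_total_le: "exp (t0 * real_of_int k) * (\<Sum>i<n. escape k i) \<le> mean_above_const"
proof -
  have "(\<Sum>i<n. escape k i) \<le> (m - 1) * (gtail k - of_bool (k < 0))"
    using sum_le_suminf[OF sums_summable[OF escape_sums], of "{..<n}" k] sums_unique[OF escape_sums, of k] by simp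
  also have "\<dots> \<le> (m - 1) * gtail k" using m_gt_1 by (intro mult_left_mono) auto
  finally have "exp (t0 * real_of_int k) * (\<Sum>i<n. escape k i) \<le> exp (t0 * real_of_int k) * ((m - 1) * gtail k)"
    by (intro mult_left_mono) auto
  also have "\<dots> = (m - 1) * vtail k" by (simp add: vtail_def)
  also have "\<dots> \<le> mean_above_const" unfolding mean_above_const_def using m_gt_1 vtail_le by (intro mult_left_mono) auto
  finally show ?thesis .
qed

lemma mean_above_origin_bound: "exp (t0 * real_of_int k) * (disc ^ n * mean_above k n 0) \<le> mean_above_const"
proof -
  have "(\<Sum>i\<le>n. escape k i * renewal (n - i)) \<le> (\<Sum>i\<le>n. escape k i)"
    using renewal_le_1 by (intro sum_mono mult_left_le) auto
  then have "exp (t0 * real_of_int k) * (disc ^ n * mean_above k n 0) \<le> exp (t0 * real_of_int k) * (\<Sum>i\<le>n. escape k i)"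
    unfolding mean_above_renewal by (intro mult_left_mono) auto
  also have "\<dots> \<le> mean_above_const" using escape_total_le[of k "Suc n"] by (simp only: lessThan_Suc_atMost)
  finally show ?thesis .
qed

definition half_mgf :: real where "half_mgf = (\<integral>z. exp (t0 / 2 * real_of_int z) \<partial>measure_pmf p)"

lemma int_half: "integrable (measure_pmf p) (\<lambda>z. exp (t0 / 2 * real_of_int z))"
proof (rule Bochner_Integration.integrable_bound)
  show "integrable (measure_pmf p) (\<lambda>z. 1 + exp (t0 * real_of_int z))" using int_t0 by auto
  have "exp (t0 / 2 * x) \<le> 1 + exp (t0 * x)" for x
  proof (cases "x \<ge> 0")
    case True
    then have "t0 / 2 * x \<le> t0 * x" using t0_pos by (intro mult_right_mono) auto
    then have "exp (t0 / 2 * x) \<le> exp (t0 * x)" by (simp only: exp_le_cancel_iff)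
    then show ?thesis by linarith
  next
    case False
    then have "exp (t0 / 2 * x) \<le> 1" using t0_pos by (simp add: mult_nonneg_nonpos)
    then show ?thesis by (simp add: add_increasing2)
  qed
  then show "AE z in measure_pmf p. norm (exp (t0 / 2 * real_of_int z)) \<le> norm (1 + exp (t0 * real_of_int z))"
    by (intro AE_I2) (simp add: add_nonneg_nonneg)
qed simp

text \<open>The variance of \<open>e\<^bsup>t0 Z / 2\<^esup>\<close> is positive because the step \<open>Z\<close> of an irreducible walk is not
  constant. In other words \<open>\<psi>(t0/2) < \<psi>(t0)/2\<close>, strict convexity at one point.\<close>

lemma half_mgf_less: "half_mgf < exp (r / 2)"
proof -
  let ?X = "\<lambda>z::int. exp (t0 / 2 * real_of_int z)"
  have sq: "?X z ^ 2 = exp (t0 * real_of_int z)" for z by (simp add: power2_eq_square mult_exp_exp)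
  have int_sq: "integrable (measure_pmf p) (\<lambda>z. (?X z)\<^sup>2)" unfolding sq by (rule int_t0)
  have var: "measure_pmf.variance p ?X = exp r - half_mgf\<^sup>2"
    using measure_pmf.variance_eq[OF int_half int_sq] unfolding sq exp_t0 half_mgf_def by simp
  have "measure_pmf.variance p ?X \<noteq> 0"
  proof
    assume "measure_pmf.variance p ?X = 0"
    then have "AE z in measure_pmf p. (?X z - half_mgf)\<^sup>2 = 0"
    proof (subst integral_nonneg_eq_0_iff_AE[symmetric])
      show "integrable (measure_pmf p) (\<lambda>z. (?X z - half_mgf)\<^sup>2)"
        unfolding power2_diff using int_half int_sq by auto
    qed (simp_all add: half_mgf_def)
    then have *: "?X z = half_mgf" if "z \<in> set_pmf p" for z
      using that by (simp add: AE_measure_pmf_iff)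
    obtain z1 where z1: "z1 \<in> set_pmf p" using set_pmf_not_empty by fastforce
    have "z = z1" if "z \<in> set_pmf p" for z
    proof -
      have "exp (t0 / 2 * real_of_int z) = exp (t0 / 2 * real_of_int z1)" using *[OF that] *[OF z1] by (rule trans_sym)
      then show ?thesis using t0_pos by simp
    qed
    then have "set_pmf p \<subseteq> {z1}" by blast
    have mult: "\<exists>n::nat. x = int n * z1" if "x \<in> additive_span (set_pmf p)" for x
      using that
    proof induction
      case (add x z)
      then obtain n where "x = int n * z1" by blast
      moreover have "z = z1" using add \<open>set_pmf p \<subseteq> {z1}\<close> by blast
      ultimately show ?case by (intro exI[of _ "Suc n"]) (simp add: algebra_simps)
    qed (auto intro!: exI[of _ 0])
    obtain n1 n2 :: nat where "1 = int n1 * z1" "- 1 = int n2 * z1" using mult[of 1] mult[of "-1"] span by auto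
    then have "z1 > 0 \<and> z1 < 0"
      by (metis mult_nonneg_nonneg mult_nonneg_nonpos not_less of_nat_0_le_iff zero_less_one neg_0_le_iff_le not_one_le_zero order.trans zero_le_one)
    then show False by linarith
  qed
  moreover have "measure_pmf.variance p ?X \<ge> 0" by simp
  ultimately have "half_mgf\<^sup>2 < exp r" using var by linarith
  also have "exp r = (exp (r / 2))\<^sup>2" by (simp add: power2_eq_square mult_exp_exp)
  finally show ?thesis by (rule power_less_imp_less_base) simp
qed

text \<open>Relative to the scale \<open>e\<^bsup>-t0(k - \<alpha>l)\<^esup>\<close>, the chance that a walk is beyond \<open>k\<close> after \<open>l\<close> steps
  without branching is at most of order \<open>\<theta>\<^sup>l\<close>.\<close>

definition \<theta> :: real where "\<theta> = half_mgf * exp (- r / 2)"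

lemma half_mgf_pos: "half_mgf > 0"
proof -
  have "half_mgf \<noteq> 0"
  proof
    assume "half_mgf = 0"
    then have "AE z in measure_pmf p. exp (t0 / 2 * real_of_int z) = 0"
      unfolding half_mgf_def by (subst (asm) integral_nonneg_eq_0_iff_AE) (use int_half in auto)
    then show False by simp
  qed
  moreover have "half_mgf \<ge> 0" unfolding half_mgf_def by simp
  ultimately show ?thesis by simp
qed

lemma theta: "0 < \<theta>" "\<theta> < 1"
proof -
  show "0 < \<theta>" using half_mgf_pos by (simp add: \<theta>_def)
  have "\<theta> < exp (r / 2) * exp (- r / 2)" unfolding \<theta>_def using half_mgf_less by (intro mult_strict_right_mono) auto
  then show "\<theta> < 1" by (simp add: mult_exp_exp)
qed

lemma disc_half: "disc * half_mgf = exp (- r / 2) * \<theta>"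
  unfolding \<theta>_def by (simp add: mult_exp_exp)

lemma disc_half_less: "0 < disc * half_mgf" "disc * half_mgf < 1"
proof -
  show "0 < disc * half_mgf" using half_mgf_pos by simp
  have "exp (- r / 2) * \<theta> < 1 * 1" using theta r_pos by (intro mult_strict_mono) auto
  then show "disc * half_mgf < 1" by (simp add: disc_half)
qed

lemma disc_tail_bound:
  "disc ^ n * tail p n k \<le> exp (- t0 / 2 * real_of_int k) * (disc * half_mgf) ^ n"
proof -
  have "tail p n k \<le> exp (- (t0 / 2) * real_of_int k) * half_mgf ^ n"
    by (rule tail_exp_bound[OF _ int_half half_mgf_def]) (use t0_pos in simp)
  then have "disc ^ n * tail p n k \<le> disc ^ n * (exp (- (t0 / 2) * real_of_int k) * half_mgf ^ n)"
    by (intro mult_left_mono) auto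
  then show ?thesis by (simp add: power_mult_distrib mult_ac)
qed

lemma half_exp_bound:
  assumes "real_of_int k \<le> speed * real l + B"
  shows "exp (t0 * real_of_int k) * (exp (- t0 / 2 * real_of_int k) * (disc * half_mgf) ^ l) \<le> exp (t0 * B / 2) * \<theta> ^ l"
proof -
  have "exp (t0 * real_of_int k) * (exp (- t0 / 2 * real_of_int k) * (disc * half_mgf) ^ l)
      = exp (t0 * real_of_int k + - t0 / 2 * real_of_int k) * (exp (- r / 2) ^ l * \<theta> ^ l)"
    unfolding disc_half power_mult_distrib exp_add by simp
  also have "exp (- r / 2) ^ l = exp (real l * (- r / 2))" by (rule exp_of_nat_mult[symmetric])
  also have "exp (t0 * real_of_int k + - t0 / 2 * real_of_int k) * (exp (real l * (- r / 2)) * \<theta> ^ l)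
      = exp (t0 / 2 * real_of_int k - real l * r / 2) * \<theta> ^ l"
    unfolding mult.assoc[symmetric] mult_exp_exp by (simp add: field_simps)
  also have "\<dots> \<le> exp (t0 * B / 2) * \<theta> ^ l"
  proof (intro mult_right_mono)
    have "t0 * real_of_int k \<le> t0 * (speed * real l + B)" using assms t0_pos by simp
    also have "\<dots> = r * real l + t0 * B" using t0_speed by (simp add: distrib_left flip: mult.assoc)
    finally show "exp (t0 / 2 * real_of_int k - real l * r / 2) \<le> exp (t0 * B / 2)" by (simp add: algebra_simps)
  qed (use theta in simp)
  finally show ?thesis .
qed

lemma escape_bound:
  assumes "k \<ge> 0"
  shows "escape k i \<le> m * (exp (- t0 / 2 * real_of_int k) * (disc * half_mgf) ^ i)"
proof (cases i)
  case 0
  then show ?thesis using assms m_nonneg by (simp add: escape_def)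
next
  case (Suc j)
  have "walk_mean p (avoid p (above k) j) 0 \<le> walk_mean p (\<lambda>x. tail p j (k - x)) 0"
    by (intro walk_mean_mono avoid_indicator_le) auto
  also have "\<dots> = tail p (Suc j) k" using tail_walk_mean[of p j k 0] by simp
  finally have "escape k i \<le> m * (disc ^ Suc j * tail p (Suc j) k)"
    using m_nonneg unfolding escape_def Suc nat.case mult.assoc by (intro mult_left_mono) auto
  also have "\<dots> \<le> m * (exp (- t0 / 2 * real_of_int k) * (disc * half_mgf) ^ Suc j)"
    using m_nonneg by (intro mult_left_mono disc_tail_bound) auto
  finally show ?thesis by (simp add: Suc)
qed

lemma escape_remainder:
  assumes "k \<ge> 0"
  shows "(\<Sum>i. escape k (i + j)) \<le> m / (1 - disc * half_mgf) * (exp (- t0 / 2 * real_of_int k) * (disc * half_mgf) ^ j)"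
proof (rule sums_le)
  show "(\<lambda>i. escape k (i + j)) sums (\<Sum>i. escape k (i + j))"
    using sums_summable[OF escape_sums[of k]] by (intro summable_sums) (simp add: summable_iff_shift)
  have "(\<lambda>i. (m * (exp (- t0 / 2 * real_of_int k) * (disc * half_mgf) ^ j)) * (disc * half_mgf) ^ i)
     sums ((m * (exp (- t0 / 2 * real_of_int k) * (disc * half_mgf) ^ j)) * (1 / (1 - disc * half_mgf)))"
    using disc_half_less by (intro sums_mult geometric_sums) auto
  then show "(\<lambda>i. m * (exp (- t0 / 2 * real_of_int k) * (disc * half_mgf) ^ (i + j)))
     sums (m / (1 - disc * half_mgf) * (exp (- t0 / 2 * real_of_int k) * (disc * half_mgf) ^ j))"
    by (simp add: power_add mult_ac)
qed (use escape_bound[OF assms] in blast)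

definition renewal_inf :: real where "renewal_inf = lim renewal"
definition vtail_inf :: real where "vtail_inf = Lim at_top vtail"

lemma renewal_inf: "renewal \<longlonglongrightarrow> renewal_inf" "renewal_inf > 0"
  using renewal_limit limI unfolding renewal_inf_def by blast+

lemma vtail_inf: "(vtail \<longlongrightarrow> vtail_inf) at_top" "vtail_inf > 0"
proof -
  obtain V where "V > 0" "(vtail \<longlongrightarrow> V) at_top" using vtail_limit by blast
  moreover from this have "vtail_inf = V" unfolding vtail_inf_def by (intro tendsto_Lim) auto
  ultimately show "(vtail \<longlongrightarrow> vtail_inf) at_top" "vtail_inf > 0" by auto
qed

lemma renewal_inf_le_1: "renewal_inf \<le> 1"
  using LIMSEQ_le_const2[OF renewal_inf(1)] renewal_le_1 by blast

definition \<beta> :: real where "\<beta> = renewal_inf * ((m - 1) * vtail_inf)"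

lemma beta_pos: "\<beta> > 0"
  unfolding \<beta>_def using renewal_inf vtail_inf m_gt_1 by simp

lemma speed_pos: "speed > 0" using r_pos t0_pos by (simp add: speed_def)

lemma barrier_at_top:
  assumes "\<And>l. \<bar>real_of_int (k l) - speed * real l\<bar> \<le> B"
  shows "filterlim k at_top sequentially"
  unfolding filterlim_at_top
proof
  fix Z :: int
  have "filterlim (\<lambda>l. speed * real l) at_top sequentially"
    by (rule filterlim_tendsto_pos_mult_at_top[OF tendsto_const speed_pos filterlim_real_sequentially])
  then have "\<forall>\<^sub>F l in sequentially. speed * real l \<ge> B + real_of_int Z" by (simp add: filterlim_at_top)
  then show "\<forall>\<^sub>F l in sequentially. Z \<le> k l"
  proof eventually_elim
    case (elim l)
    then show ?case using assms[of l] by linarith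
  qed
qed

text \<open>In the convolution \<open>\<Sum> escape k i * renewal (l - i)\<close> the indices with \<open>l - i \<ge> K\<close> see a
  value of the renewal sequence close to its limit, and their total weight is governed by
  \<open>vtail\<close>. The remaining indices, those of excursions that last almost the whole time, carry a
  mass of order \<open>\<theta>\<^sup>l\<close>.\<close>

lemma mean_above_origin_limit:
  assumes k: "\<And>l. \<bar>real_of_int (k l) - speed * real l\<bar> \<le> B"
  shows "(\<lambda>l. exp (t0 * real_of_int (k l)) * (disc ^ l * mean_above (k l) l 0)) \<longlonglongrightarrow> \<beta>"
proof -
  define E where "E l = exp (t0 * real_of_int (k l))" for l
  define T where "T l = (m - 1) * (gtail (k l) - of_bool (k l < 0))" for l
  have ev: "\<forall>\<^sub>F l in sequentially. k l \<ge> 0"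
    using barrier_at_top[OF k] by (simp add: filterlim_at_top)
  have main: "(\<lambda>l. renewal_inf * (E l * T l)) \<longlonglongrightarrow> \<beta>"
  proof -
    have "(\<lambda>l. vtail (k l)) \<longlonglongrightarrow> vtail_inf" by (rule filterlim_compose[OF vtail_inf(1) barrier_at_top[OF k]])
    then have "(\<lambda>l. renewal_inf * ((m - 1) * vtail (k l))) \<longlonglongrightarrow> \<beta>" unfolding \<beta>_def by (intro tendsto_mult tendsto_const)
    moreover have "\<forall>\<^sub>F l in sequentially. renewal_inf * ((m - 1) * vtail (k l)) = renewal_inf * (E l * T l)"
      using ev by eventually_elim (simp add: E_def T_def vtail_def)
    ultimately show ?thesis by (rule Lim_transform_eventually)
  qed
  have "(\<lambda>l. E l * (disc ^ l * mean_above (k l) l 0) - renewal_inf * (E l * T l)) \<longlonglongrightarrow> 0"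
  proof (rule tendstoI)
    fix e :: real assume "e > 0"
    \<comment> \<open>the total weight of the escaping mass is at most \<open>mean_above_const\<close>, so this precision
      contributes \<open>e / 2\<close>\<close>
    define e' where "e' = e / (2 * mean_above_const)"
    have "e' > 0" using \<open>e > 0\<close> mean_above_const_pos by (simp add: e'_def)
    then obtain K where K: "\<And>j. j \<ge> K \<Longrightarrow> \<bar>renewal j - renewal_inf\<bar> < e'"
      using LIMSEQ_D[OF renewal_inf(1)] by (metis real_norm_def)
    define C where "C = m / (1 - disc * half_mgf) / (disc * half_mgf) ^ K * exp (t0 * B / 2)"
    have "(\<lambda>l. 2 * (C * \<theta> ^ l)) \<longlonglongrightarrow> 2 * (C * 0)"
      using theta by (intro tendsto_mult tendsto_const LIMSEQ_realpow_zero) auto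
    then have "(\<lambda>l. 2 * (C * \<theta> ^ l)) \<longlonglongrightarrow> 0" by simp
    from order_tendstoD(2)[OF this, of "e / 2"] have "\<forall>\<^sub>F l in sequentially. 2 * (C * \<theta> ^ l) < e / 2"
      using \<open>e > 0\<close> by simp
    with ev eventually_ge_at_top[of K]
    show "\<forall>\<^sub>F l in sequentially. dist (E l * (disc ^ l * mean_above (k l) l 0) - renewal_inf * (E l * T l)) 0 < e"
    proof eventually_elim
      case (elim l)
      \<comment> \<open>indices below \<open>j\<close> see the limit of the renewal sequence; the others belong to long
        excursions\<close>
      define j where "j = l - K"
      define R where "R = (\<Sum>i. escape (k l) (i + j))"
      have summ: "summable (escape (k l))" using escape_sums sums_summable by blast
      have T: "T l = (\<Sum>i<j. escape (k l) i) + R"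
        using sums_unique[OF escape_sums, of "k l"] suminf_split_initial_segment[OF summ, of j]
        unfolding T_def R_def by linarith
      have Rpart: "(\<Sum>i\<in>{j..l}. escape (k l) i) \<le> R"
      proof -
        have "(\<Sum>i\<in>{j..l}. escape (k l) i) = (\<Sum>i<Suc (l - j). escape (k l) (i + j))"
          using sum.shift_bounds_cl_nat_ivl[of "escape (k l)" 0 j "l - j"]
          by (simp add: j_def lessThan_Suc_atMost atMost_atLeast0)
        also have "\<dots> \<le> R" unfolding R_def
          by (intro sum_le_suminf) (use summ in \<open>auto simp: summable_iff_shift\<close>)
        finally show ?thesis .
      qed
      have "0 \<le> R" using Rpart sum_nonneg[of "{j..l}" "escape (k l)"] by simp
      have split: "(\<Sum>i\<le>l. escape (k l) i * renewal (l - i)) = (\<Sum>i<j. escape (k l) i * renewal (l - i)) + (\<Sum>i\<in>{j..l}. escape (k l) i * renewal (l - i))"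
        by (subst sum.union_disjoint[symmetric]) (auto simp: j_def intro!: sum.cong)
      have 1: "\<bar>(\<Sum>i<j. escape (k l) i * renewal (l - i)) - renewal_inf * (\<Sum>i<j. escape (k l) i)\<bar> \<le> e' * (\<Sum>i<j. escape (k l) i)"
      proof -
        have "\<bar>(\<Sum>i<j. escape (k l) i * renewal (l - i)) - renewal_inf * (\<Sum>i<j. escape (k l) i)\<bar> = \<bar>\<Sum>i<j. escape (k l) i * (renewal (l - i) - renewal_inf)\<bar>"
          by (simp add: right_diff_distrib sum_subtractf sum_distrib_left mult.commute)
        also have "\<dots> \<le> (\<Sum>i<j. \<bar>escape (k l) i * (renewal (l - i) - renewal_inf)\<bar>)" by (rule sum_abs)
        also have "\<dots> \<le> (\<Sum>i<j. escape (k l) i * e')"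
        proof (intro sum_mono)
          fix i assume "i \<in> {..<j}"
          then have "\<bar>renewal (l - i) - renewal_inf\<bar> < e'" by (intro K) (auto simp: j_def)
          then show "\<bar>escape (k l) i * (renewal (l - i) - renewal_inf)\<bar> \<le> escape (k l) i * e'"
            by (simp add: abs_mult mult_left_mono)
        qed
        also have "\<dots> = e' * (\<Sum>i<j. escape (k l) i)" by (simp add: sum_distrib_left mult.commute)
        finally show ?thesis .
      qed
      have 2: "(\<Sum>i\<in>{j..l}. escape (k l) i * renewal (l - i)) \<le> R"
        using sum_mono[of "{j..l}" "\<lambda>i. escape (k l) i * renewal (l - i)" "escape (k l)"] renewal_le_1 Rpart by (simp add: mult_left_le)
      have 3: "0 \<le> (\<Sum>i\<in>{j..l}. escape (k l) i * renewal (l - i))" by (intro sum_nonneg) auto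
      have 4: "0 \<le> renewal_inf * R" "renewal_inf * R \<le> R" using renewal_inf renewal_inf_le_1 \<open>0 \<le> R\<close> by (auto simp: mult_left_le_one_le)
      have E: "E l > 0" by (simp add: E_def)
      have "\<bar>disc ^ l * mean_above (k l) l 0 - renewal_inf * T l\<bar> \<le> e' * (\<Sum>i<j. escape (k l) i) + 2 * R"
        unfolding mean_above_renewal split T distrib_left using 1 2 3 4 \<open>0 \<le> R\<close> by linarith
      then have "E l * \<bar>disc ^ l * mean_above (k l) l 0 - renewal_inf * T l\<bar> \<le> E l * (e' * (\<Sum>i<j. escape (k l) i) + 2 * R)"
        using E by (intro mult_left_mono) auto
      also have "\<dots> = e' * (E l * (\<Sum>i<j. escape (k l) i)) + 2 * (E l * R)" by (simp add: algebra_simps)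
      also have "\<dots> \<le> e' * mean_above_const + 2 * (C * \<theta> ^ l)"
      proof (intro add_mono mult_left_mono)
        show "E l * (\<Sum>i<j. escape (k l) i) \<le> mean_above_const" unfolding E_def by (rule escape_total_le)
        have "(disc * half_mgf) ^ j = (disc * half_mgf) ^ l / (disc * half_mgf) ^ K"
          using elim half_mgf_pos by (simp add: j_def power_diff)
        then have "E l * R \<le> E l * (m / (1 - disc * half_mgf) * (exp (- t0 / 2 * real_of_int (k l)) * ((disc * half_mgf) ^ l / (disc * half_mgf) ^ K)))"
          using escape_remainder[of "k l" j] elim E by (intro mult_left_mono) (auto simp: R_def)
        also have "\<dots> = m / (1 - disc * half_mgf) / (disc * half_mgf) ^ K * (E l * (exp (- t0 / 2 * real_of_int (k l)) * (disc * half_mgf) ^ l))"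
          by (simp add: field_simps)
        also have "\<dots> \<le> m / (1 - disc * half_mgf) / (disc * half_mgf) ^ K * (exp (t0 * B / 2) * \<theta> ^ l)"
          unfolding E_def using k[of l] m_nonneg disc_half_less by (intro mult_left_mono half_exp_bound) auto
        also have "\<dots> = C * \<theta> ^ l" by (simp add: C_def)
        finally show "E l * R \<le> C * \<theta> ^ l" .
      qed (use \<open>e' > 0\<close> in auto)
      also have "\<dots> < e" using elim mean_above_const_pos by (simp add: e'_def)
      finally have "E l * \<bar>disc ^ l * mean_above (k l) l 0 - renewal_inf * T l\<bar> < e" .
      moreover have "\<bar>E l * (disc ^ l * mean_above (k l) l 0) - renewal_inf * (E l * T l)\<bar> = E l * \<bar>disc ^ l * mean_above (k l) l 0 - renewal_inf * T l\<bar>"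
      proof -
        have "E l * (disc ^ l * mean_above (k l) l 0) - renewal_inf * (E l * T l) = E l * (disc ^ l * mean_above (k l) l 0 - renewal_inf * T l)"
          by (simp add: algebra_simps)
        then show ?thesis using E by (simp add: abs_mult)
      qed
      ultimately show ?case by (simp add: dist_real_def)
    qed
  qed
  from tendsto_add[OF this main] show ?thesis by (simp add: E_def)
qed

text \<open>Decomposition at the first visit to the origin and dominated convergence for series
  (Tannery). A visit at time \<open>i\<close> shifts the barrier relative to the remaining time by \<open>\<alpha>i\<close>,
  which produces the factor \<open>e\<^bsup>-ri\<^esup>\<close>, and these factors sum to \<open>\<phi> x\<close>.\<close>

lemma mean_above_limit:
  assumes k: "\<And>l. \<bar>real_of_int (k l) - speed * real l\<bar> \<le> B"
  shows "(\<lambda>l. exp (t0 * real_of_int (k l)) * (disc ^ l * mean_above (k l) l x)) \<longlonglongrightarrow> \<beta> * \<phi> x"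
proof -
  define E where "E l = exp (t0 * real_of_int (k l))" for l
  define a where "a i l = (if i \<le> l then disc ^ i * hit p i x * (E l * (disc ^ (l - i) * mean_above (k l) (l - i) 0)) else 0)" for i l
  have decomp: "E l * (disc ^ l * mean_above (k l) l x) = E l * (disc ^ l * avoid p (above (k l)) l x) + (\<Sum>i. a i l)" for l
  proof -
    have "(\<Sum>i. a i l) = (\<Sum>i\<le>l. a i l)" by (rule suminf_finite) (auto simp: a_def)
    also have "\<dots> = (\<Sum>i\<le>l. E l * (disc ^ l * (hit p i x * mean_above (k l) (l - i) 0)))"
    proof (rule sum.cong[OF refl])
      fix i assume "i \<in> {..l}"
      then have "disc ^ l = disc ^ i * disc ^ (l - i)" by (simp flip: power_add)
      then show "a i l = E l * (disc ^ l * (hit p i x * mean_above (k l) (l - i) 0))"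
        using \<open>i \<in> {..l}\<close> by (simp add: a_def mult_ac)
    qed
    finally show ?thesis by (subst mean_above_first_hit) (simp only: distrib_left sum_distrib_left)
  qed
  have first: "(\<lambda>l. E l * (disc ^ l * avoid p (above (k l)) l x)) \<longlonglongrightarrow> 0"
  proof (rule tendsto_sandwich[OF always_eventually always_eventually tendsto_const])
    show "\<forall>l. 0 \<le> E l * (disc ^ l * avoid p (above (k l)) l x)"
      by (auto simp: E_def intro!: mult_nonneg_nonneg avoid_nonneg)
    show "\<forall>l. E l * (disc ^ l * avoid p (above (k l)) l x) \<le> exp (t0 / 2 * real_of_int x) * (exp (t0 * B / 2) * \<theta> ^ l)"
    proof
      fix l
      have "disc ^ l * avoid p (above (k l)) l x \<le> disc ^ l * tail p l (k l - x)"
        by (intro mult_left_mono avoid_indicator_le) auto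
      also have "\<dots> \<le> exp (- t0 / 2 * real_of_int (k l - x)) * (disc * half_mgf) ^ l" by (rule disc_tail_bound)
      also have "\<dots> = exp (t0 / 2 * real_of_int x) * (exp (- t0 / 2 * real_of_int (k l)) * (disc * half_mgf) ^ l)"
        unfolding mult.assoc[symmetric] mult_exp_exp by (simp add: algebra_simps)
      finally have "E l * (disc ^ l * avoid p (above (k l)) l x)
        \<le> E l * (exp (t0 / 2 * real_of_int x) * (exp (- t0 / 2 * real_of_int (k l)) * (disc * half_mgf) ^ l))"
        by (intro mult_left_mono) (auto simp: E_def)
      also have "\<dots> = exp (t0 / 2 * real_of_int x) * (E l * (exp (- t0 / 2 * real_of_int (k l)) * (disc * half_mgf) ^ l))"
        by (rule mult.left_commute)
      also have "\<dots> \<le> exp (t0 / 2 * real_of_int x) * (exp (t0 * B / 2) * \<theta> ^ l)"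
        unfolding E_def using k[of l] by (intro mult_left_mono half_exp_bound) auto
      finally show "E l * (disc ^ l * avoid p (above (k l)) l x) \<le> exp (t0 / 2 * real_of_int x) * (exp (t0 * B / 2) * \<theta> ^ l)" .
    qed
    have "(\<lambda>l. exp (t0 / 2 * real_of_int x) * (exp (t0 * B / 2) * \<theta> ^ l)) \<longlonglongrightarrow> exp (t0 / 2 * real_of_int x) * (exp (t0 * B / 2) * 0)"
      using theta by (intro tendsto_mult tendsto_const LIMSEQ_realpow_zero) auto
    then show "(\<lambda>l. exp (t0 / 2 * real_of_int x) * (exp (t0 * B / 2) * \<theta> ^ l)) \<longlonglongrightarrow> 0" by simp
  qed
  have second: "(\<lambda>l. \<Sum>i. a i l) \<longlonglongrightarrow> (\<Sum>i. disc ^ i * hit p i x * \<beta>)"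
  proof (rule tannerys_theorem[THEN conjunct2, THEN conjunct2])
    fix i
    have "\<bar>real_of_int (k (l + i)) - speed * real l\<bar> \<le> B + speed * real i" for l
    proof -
      have "speed * real (l + i) = speed * real l + speed * real i" by (simp add: algebra_simps)
      moreover have "speed * real i \<ge> 0" using speed_pos by simp
      ultimately show ?thesis using k[of "l + i"] by linarith
    qed
    from mean_above_origin_limit[of "\<lambda>l. k (l + i)", OF this]
    have "(\<lambda>l. disc ^ i * hit p i x * (E (l + i) * (disc ^ l * mean_above (k (l + i)) l 0))) \<longlonglongrightarrow> disc ^ i * hit p i x * \<beta>"
      unfolding E_def by (intro tendsto_mult tendsto_const)
    then have "(\<lambda>l. a i (l + i)) \<longlonglongrightarrow> disc ^ i * hit p i x * \<beta>" by (simp add: a_def)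
    then show "a i \<longlonglongrightarrow> disc ^ i * hit p i x * \<beta>" by (rule LIMSEQ_offset)
  next
    have "norm (a i l) \<le> disc ^ i * hit p i x * mean_above_const" for i l
    proof (cases "i \<le> l")
      case True
      have "0 \<le> E l * (disc ^ (l - i) * mean_above (k l) (l - i) 0)" by (simp add: E_def)
      moreover have "E l * (disc ^ (l - i) * mean_above (k l) (l - i) 0) \<le> mean_above_const" unfolding E_def by (rule mean_above_origin_bound)
      ultimately have "\<bar>E l * (disc ^ (l - i) * mean_above (k l) (l - i) 0)\<bar> \<le> mean_above_const" by linarith
      then show ?thesis using True unfolding a_def
        by (simp add: abs_mult) (intro mult_left_mono, auto)
    next
      case False
      then show ?thesis using mean_above_const_pos by (simp add: a_def)
    qed
    then show "\<forall>\<^sub>F (i, l) in at_top \<times>\<^sub>F sequentially. norm (a i l) \<le> disc ^ i * hit p i x * mean_above_const"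
      by (intro always_eventually) auto
    show "summable (\<lambda>i. disc ^ i * hit p i x * mean_above_const)"
      using sums_summable[OF hit_gf_sums[OF disc(1,2)]] by (rule summable_mult2)
  qed simp
  have "(\<Sum>i. disc ^ i * hit p i x * \<beta>) = \<phi> x * \<beta>"
    using sums_mult2[OF hit_gf_sums[OF disc(1,2), of p x], of \<beta>] sums_unique by metis
  with tendsto_add[OF first second] show ?thesis
    unfolding decomp[symmetric] by (simp add: E_def mult.commute)
qed

end

section \<open>The probability of a particle beyond a barrier\<close>

definition pgf :: "nat pmf \<Rightarrow> real \<Rightarrow> real" where
  "pgf offs s = (\<integral>k. s ^ k \<partial>measure_pmf offs)"

text \<open>The expectation of the product of \<open>u\<close> over the positions at time \<open>n\<close> of the particles that
  descend from one particle at \<open>x\<close>. It is the \<open>n\<close>-th iterate of one operator, which is the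
  branching property at a fixed time (\<open>prodmean_add\<close>).\<close>

primrec prodmean :: "nat pmf \<Rightarrow> int pmf \<Rightarrow> (int \<Rightarrow> real) \<Rightarrow> nat \<Rightarrow> int \<Rightarrow> real" where
  "prodmean offs p u 0 = u"
| "prodmean offs p u (Suc n) =
     (\<lambda>x. if x = 0 then pgf offs (walk_mean p (prodmean offs p u n) 0) else walk_mean p (prodmean offs p u n) x)"

lemma prodmean_add: "prodmean offs p u (j + n) = prodmean offs p (prodmean offs p u n) j"
  by (induction j) auto

lemma bdd_fun_power_unit: "0 \<le> s \<Longrightarrow> s \<le> 1 \<Longrightarrow> bdd_fun (\<lambda>k::nat. s ^ k :: real)"
  by (rule bdd_fun_unit) (auto intro: power_le_one)

lemma pgf_unit:
  assumes "0 \<le> s" "s \<le> 1"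
  shows "0 \<le> pgf offs s" "pgf offs s \<le> 1"
proof -
  show "0 \<le> pgf offs s" using assms by (simp add: pgf_def)
  have "pgf offs s \<le> (\<integral>k. 1 \<partial>measure_pmf offs)"
    unfolding pgf_def using assms
    by (intro integral_mono integrable_bdd_fun bdd_fun_power_unit) (auto intro: power_le_one)
  then show "pgf offs s \<le> 1" by simp
qed

lemma prodmean_unit:
  assumes "\<And>x. 0 \<le> u x" "\<And>x. u x \<le> 1"
  shows "0 \<le> prodmean offs p u n x \<and> prodmean offs p u n x \<le> 1"
proof (induction n arbitrary: x)
  case (Suc n)
  then have "bdd_fun (prodmean offs p u n)" by (intro bdd_fun_unit) auto
  then have "0 \<le> walk_mean p (prodmean offs p u n) y" "walk_mean p (prodmean offs p u n) y \<le> 1" for y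
    using Suc by (auto intro!: walk_mean_nonneg walk_mean_le)
  then show ?case by (simp add: pgf_unit)
qed (use assms in simp)

lemma one_minus_power_le:
  fixes s :: real
  assumes "0 \<le> s" "s \<le> 1"
  shows "(1 - s) ^ k \<le> 1 - real k * s + (real k)\<^sup>2 * s\<^sup>2"
proof (induction k)
  case (Suc k)
  have "(1 - s) ^ Suc k \<le> (1 - s) * (1 - real k * s + (real k)\<^sup>2 * s\<^sup>2)"
    using Suc assms by (simp add: mult_left_mono)
  also have "\<dots> = 1 - real (Suc k) * s + (real k + (real k)\<^sup>2) * s\<^sup>2 - s * ((real k)\<^sup>2 * s\<^sup>2)"
    by (simp add: algebra_simps power2_eq_square)
  also have "\<dots> \<le> 1 - real (Suc k) * s + (real k + (real k)\<^sup>2) * s\<^sup>2"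
    using assms by simp
  also have "\<dots> \<le> 1 - real (Suc k) * s + (real (Suc k))\<^sup>2 * s\<^sup>2"
    by (intro add_left_mono mult_right_mono) (auto simp: power2_eq_square algebra_simps)
  finally show ?case .
qed simp

lemma avoid_mono:
  assumes "bdd_fun f" "bdd_fun g" "\<And>x. f x \<le> g x"
  shows "avoid p f n x \<le> avoid p g n x"
  by (induction n arbitrary: x) (use assms in \<open>auto intro!: walk_mean_mono\<close>)

text \<open>In the decomposition at the first visit to the origin, the part without a visit up to time
  \<open>n\<close> is at most \<open>P\<^sub>x(n < \<sigma> < \<infinity>)\<close>, because \<open>d\<close> is dominated by the probability of a visit.\<close>

lemma harmonic_off_origin:
  assumes harm: "\<And>x. x \<noteq> 0 \<Longrightarrow> d x = walk_mean p d x"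
    and nonneg: "\<And>x. 0 \<le> d x" and le: "\<And>x. d x \<le> hit_gf p 1 x"
  shows "d x = hit_gf p 1 x * d 0"
proof -
  have bd: "bdd_fun d"
    using nonneg order_trans[OF le hit_gf_le_1] by (intro bdd_fun_unit) auto
  have d: "d x = avoid p d n x + (\<Sum>i\<le>n. hit p i x) * d 0" for n
    using first_hit_decomposition[of "\<lambda>_. d" p n x] harm bd by (simp add: sum_distrib_right)
  have rho: "hit_gf p 1 x = avoid p (hit_gf p 1) n x + (\<Sum>i\<le>n. hit p i x)" for n
    using first_hit_decomposition[of "\<lambda>_. hit_gf p 1" p n x] walk_mean_hit_gf[of 1 _ p]
    by (simp add: hit_gf_0)
  have sums: "(\<lambda>n. \<Sum>i\<le>n. hit p i x) \<longlonglongrightarrow> hit_gf p 1 x"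
    using hit_gf_sums[of 1 p x] by (simp add: sums_def_le)
  have "(\<lambda>n. hit_gf p 1 x - (\<Sum>i\<le>n. hit p i x)) \<longlonglongrightarrow> hit_gf p 1 x - hit_gf p 1 x"
    by (intro tendsto_intros sums)
  moreover have "hit_gf p 1 x - (\<Sum>i\<le>n. hit p i x) = avoid p (hit_gf p 1) n x" for n using rho[of n] by linarith
  ultimately have "(\<lambda>n. avoid p (hit_gf p 1) n x) \<longlonglongrightarrow> 0" by simp
  then have "(\<lambda>n. avoid p d n x) \<longlonglongrightarrow> 0"
    by (rule tendsto_sandwich[OF always_eventually always_eventually tendsto_const, rotated -1])
       (use nonneg le bd in \<open>auto intro!: avoid_nonneg avoid_mono\<close>)
  then have "(\<lambda>n. avoid p d n x + (\<Sum>i\<le>n. hit p i x) * d 0) \<longlonglongrightarrow> 0 + hit_gf p 1 x * d 0"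
    by (intro tendsto_intros sums)
  then show ?thesis using d by (simp add: LIMSEQ_const_iff)
qed

context catalytic
begin

abbreviation off_sq :: real where "off_sq \<equiv> (\<integral>k. (real k)\<^sup>2 \<partial>measure_pmf offs)"

lemma pgf_lower: assumes "0 \<le> s" "s \<le> 1" shows "1 - m * s \<le> pgf offs (1 - s)"
proof -
  have "1 - m * s = (\<integral>k. 1 - real k * s \<partial>measure_pmf offs)"
    using offs_int by (simp add: m_eq)
  also have "\<dots> \<le> pgf offs (1 - s)"
    unfolding pgf_def
  proof (rule integral_mono)
    show "1 - real k * s \<le> (1 - s) ^ k" for k
      using Bernoulli_inequality[of "- s" k] assms by simp
    show "integrable (measure_pmf offs) (\<lambda>k. (1 - s) ^ k)"
      by (intro integrable_bdd_fun bdd_fun_power_unit) (use assms in auto)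
    show "integrable (measure_pmf offs) (\<lambda>k. 1 - real k * s)"
      by (intro Bochner_Integration.integrable_diff integrable_mult_left offs_int) simp
  qed
  finally show ?thesis .
qed

lemma pgf_upper: assumes "0 \<le> s" "s \<le> 1" shows "pgf offs (1 - s) \<le> 1 - m * s + off_sq * s\<^sup>2"
proof -
  have "pgf offs (1 - s) \<le> (\<integral>k. 1 - real k * s + (real k)\<^sup>2 * s\<^sup>2 \<partial>measure_pmf offs)"
    unfolding pgf_def
  proof (rule integral_mono)
    show "integrable (measure_pmf offs) (\<lambda>k. (1 - s) ^ k)"
      by (intro integrable_bdd_fun bdd_fun_power_unit) (use assms in auto)
    show "integrable (measure_pmf offs) (\<lambda>k. 1 - real k * s + (real k)\<^sup>2 * s\<^sup>2)"
      by (intro Bochner_Integration.integrable_add Bochner_Integration.integrable_diff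
          integrable_mult_left offs_int offs_sq) simp
  qed (rule one_minus_power_le[OF assms])
  also have "\<dots> = 1 - m * s + off_sq * s\<^sup>2"
    using offs_int offs_sq by (simp add: m_eq)
  finally show ?thesis .
qed

text \<open>The probability that a particle which descends from one particle at \<open>x\<close> is beyond \<open>k\<close> at
  time \<open>n\<close>.\<close>

definition prob_above :: "int \<Rightarrow> nat \<Rightarrow> int \<Rightarrow> real" where
  "prob_above k n x = 1 - prodmean offs p (\<lambda>x. of_bool (x \<le> k)) n x"

lemma prob_above_unit: "0 \<le> prob_above k n x" "prob_above k n x \<le> 1"
  using prodmean_unit[of "\<lambda>x. of_bool (x \<le> k)" offs p n x] by (auto simp: prob_above_def)

lemma bdd_prob_above [simp, intro]: "bdd_fun (prob_above k n)"
  using prob_above_unit by (intro bdd_fun_unit)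

lemma prodmean_prob_above: "prodmean offs p (\<lambda>x. of_bool (x \<le> k)) n = (\<lambda>x. 1 - prob_above k n x)"
  by (simp add: prob_above_def fun_eq_iff)

lemma prob_above_0: "prob_above k 0 x = of_bool (k < x)" by (auto simp: prob_above_def)

lemma prob_above_Suc: "prob_above k (Suc n) x = (if x = 0 then 1 - pgf offs (1 - walk_mean p (prob_above k n) 0) else walk_mean p (prob_above k n) x)"
  unfolding prob_above_def[of k "Suc n" x] by (simp add: prodmean_prob_above walk_mean_diff)

lemma walk_mean_prob_above: "0 \<le> walk_mean p (prob_above k n) x" "walk_mean p (prob_above k n) x \<le> 1"
  using prob_above_unit by (auto intro!: walk_mean_nonneg walk_mean_le)

lemma prob_above_upper: "prob_above k n x \<le> mean_above k n x"
proof (induction n arbitrary: x)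
  case (Suc n)
  have wm: "walk_mean p (prob_above k n) x \<le> walk_mean p (mean_above k n) x" for x
    using Suc by (intro walk_mean_mono) auto
  show ?case
  proof (cases "x = 0")
    case True
    have "prob_above k (Suc n) 0 \<le> m * walk_mean p (prob_above k n) 0"
      using pgf_lower[OF walk_mean_prob_above, of k n 0] by (simp add: prob_above_Suc)
    also have "\<dots> \<le> m * walk_mean p (mean_above k n) 0" using wm m_nonneg by (intro mult_left_mono)
    finally show ?thesis using True by simp
  qed (use wm in \<open>simp add: prob_above_Suc\<close>)
qed (simp add: prob_above_0)

definition prob_above_const :: real where "prob_above_const = off_sq * mean_above_const\<^sup>2 * green_bound"

lemma prob_above_const_nonneg: "prob_above_const \<ge> 0"
  unfolding prob_above_const_def using green_bound_pos by (intro mult_nonneg_nonneg) auto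

text \<open>A second moment bound, carried through the recursion. The error is multiplied by \<open>e\<^sup>r\<close> in
  each generation, since \<open>\<phi>\<close> is an eigenfunction, while the claimed bound grows by \<open>e\<^bsup>2r\<^esup>\<close>. The
  gap leaves room for the new error, which arises at the origin only and is at most \<open>E[N\<^sup>2]\<close>
  times the square of the mean.\<close>

lemma prob_above_lower: "mean_above k n x - prob_above_const * exp (2 * (r * real n - t0 * real_of_int k)) * \<phi> x \<le> prob_above k n x"
proof (induction n arbitrary: x)
  case 0
  show ?case using prob_above_const_nonneg by (simp add: prob_above_0)
next
  case (Suc n)
  define Q where "Q n = prob_above_const * exp (2 * (r * real n - t0 * real_of_int k))" for n
  have Q_nonneg: "Q n \<ge> 0" for n using prob_above_const_nonneg by (simp add: Q_def)
  have Q_Suc: "Q n * exp r = Q (Suc n) * disc"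
    unfolding Q_def mult.assoc mult_exp_exp by (simp add: algebra_simps)
  have IH: "mean_above k n x - Q n * \<phi> x \<le> prob_above k n x" for x using Suc by (simp add: Q_def)
  have wm: "walk_mean p (mean_above k n) x - Q n * walk_mean p \<phi> x \<le> walk_mean p (prob_above k n) x" for x
  proof -
    have "walk_mean p (\<lambda>x. mean_above k n x - Q n * \<phi> x) x \<le> walk_mean p (prob_above k n) x"
      using IH by (intro walk_mean_mono) auto
    then show ?thesis by (simp add: walk_mean_diff walk_mean_cmult)
  qed
  show ?case
  proof (cases "x = 0")
    case False
    have "Q n * walk_mean p \<phi> x \<le> Q (Suc n) * \<phi> x"
    proof -
      have "Q n * walk_mean p \<phi> x = Q (Suc n) * \<phi> x * disc"
        using phi_step[OF False] Q_Suc by (simp add: mult_ac)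
      also have "\<dots> \<le> Q (Suc n) * \<phi> x" using Q_nonneg disc by (intro mult_right_le_one_le) auto
      finally show ?thesis .
    qed
    then show ?thesis using wm[of x] False by (simp add: prob_above_Suc Q_def)
  next
    case True
    define s where "s = walk_mean p (prob_above k n) 0"
    have s: "0 \<le> s" "s \<le> 1" using walk_mean_prob_above by (auto simp: s_def)
    have "s \<le> mean_above k (Suc n) 0"
    proof -
      have "s \<le> walk_mean p (mean_above k n) 0" unfolding s_def using prob_above_upper by (intro walk_mean_mono) auto
      also have "\<dots> \<le> m * walk_mean p (mean_above k n) 0"
        using m_gt_1 walk_mean_nonneg[of "mean_above k n" p 0] by (intro mult_le_cancel_right1[THEN iffD2]) auto
      finally show ?thesis by simp
    qed
    also have "\<dots> \<le> mean_above_const * exp (r * real (Suc n) - t0 * real_of_int k)"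
    proof -
      have "exp (t0 * real_of_int k) * disc ^ Suc n = exp (t0 * real_of_int k - r * real (Suc n))"
        by (simp only: exp_diff exp_minus power_inverse divide_inverse exp_of_nat2_mult)
      then have "exp (t0 * real_of_int k - r * real (Suc n)) * mean_above k (Suc n) 0 \<le> mean_above_const"
        using mean_above_origin_bound[of k "Suc n"] by (simp only: mult.assoc[symmetric])
      then have "exp (r * real (Suc n) - t0 * real_of_int k) * (exp (t0 * real_of_int k - r * real (Suc n)) * mean_above k (Suc n) 0)
         \<le> exp (r * real (Suc n) - t0 * real_of_int k) * mean_above_const"
        by (intro mult_left_mono) auto
      then show ?thesis unfolding mult.assoc[symmetric] mult_exp_exp by (simp add: mult.commute)
    qed
    finally have "s\<^sup>2 \<le> (mean_above_const * exp (r * real (Suc n) - t0 * real_of_int k))\<^sup>2" using s by (intro power_mono)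
    also have "\<dots> = mean_above_const\<^sup>2 * exp (2 * (r * real (Suc n) - t0 * real_of_int k))"
      by (simp only: power_mult_distrib exp_double)
    finally have "off_sq * s\<^sup>2 \<le> off_sq * (mean_above_const\<^sup>2 * exp (2 * (r * real (Suc n) - t0 * real_of_int k)))"
      by (intro mult_left_mono) auto
    also have "\<dots> = Q (Suc n) * (1 - disc)"
      unfolding Q_def prob_above_const_def green_bound_def using disc by simp
    finally have sq: "off_sq * s\<^sup>2 \<le> Q (Suc n) * (1 - disc)" .
    have "mean_above k (Suc n) 0 - Q n * exp r \<le> m * s"
    proof -
      have "m * (walk_mean p (mean_above k n) 0 - Q n * walk_mean p \<phi> 0) \<le> m * s"
        unfolding s_def using wm m_nonneg by (intro mult_left_mono)
      moreover have "m * (Q n * walk_mean p \<phi> 0) = Q n * exp r" using phi_step_0 by (metis mult.left_commute)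
      ultimately show ?thesis by (simp add: right_diff_distrib)
    qed
    moreover have "m * s - off_sq * s\<^sup>2 \<le> prob_above k (Suc n) 0"
      using pgf_upper[OF s] by (simp add: prob_above_Suc s_def)
    ultimately have "mean_above k (Suc n) 0 - Q (Suc n) \<le> prob_above k (Suc n) 0"
      using sq Q_Suc by (simp add: right_diff_distrib)
    then show ?thesis using True by (simp only: Q_def phi_0 mult_1_right)
  qed
qed

lemma pgf_quotient:
  assumes "0 < y" "y \<le> 1"
  shows "1 - pgf offs (1 - y) = y * (\<integral>k. (\<Sum>i<k. (1 - y) ^ i) \<partial>measure_pmf offs)"
    and "integrable (measure_pmf offs) (\<lambda>k. \<Sum>i<k. (1 - y) ^ i)"
proof -
  have "(\<Sum>i<k. (1 - y) ^ i) \<le> (\<Sum>i<k. 1)" "0 \<le> (\<Sum>i<k. (1 - y) ^ i)" for k :: nat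
    using assms by (auto intro!: sum_mono power_le_one sum_nonneg simp del: sum_constant)
  then show int: "integrable (measure_pmf offs) (\<lambda>k. \<Sum>i<k. (1 - y) ^ i)"
    by (intro Bochner_Integration.integrable_bound[OF offs_int]) auto
  have "1 - pgf offs (1 - y) = (\<integral>k. 1 - (1 - y) ^ k \<partial>measure_pmf offs)"
    unfolding pgf_def using assms by (subst Bochner_Integration.integral_diff) (auto intro!: integrable_bdd_fun bdd_fun_power_unit)
  also have "\<dots> = (\<integral>k. y * (\<Sum>i<k. (1 - y) ^ i) \<partial>measure_pmf offs)"
    by (intro Bochner_Integration.integral_cong refl) (use one_diff_power_eq[of "1 - y"] in simp)
  finally show "1 - pgf offs (1 - y) = y * (\<integral>k. (\<Sum>i<k. (1 - y) ^ i) \<partial>measure_pmf offs)" by simp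
qed

text \<open>The quotient \<open>(1 - E[(1 - y)\<^sup>N]) / y = E[\<Sum>\<^sub>i\<^sub><\<^sub>N (1 - y)\<^sup>i]\<close> is strictly decreasing in \<open>y\<close>,
  unless \<open>N \<le> 1\<close> almost surely, which would contradict \<open>m > 1\<close>. At every positive root it
  takes the value \<open>1 / \<rho>\<close>.\<close>

lemma survival_root_unique:
  assumes b1: "0 < b1" "1 - pgf offs (1 - walk_mean p (hit_gf p 1) 0 * b1) = b1"
    and b2: "b2 \<le> 1" "1 - pgf offs (1 - walk_mean p (hit_gf p 1) 0 * b2) = b2"
    and le: "b1 \<le> b2"
  shows "b1 = b2"
proof (rule ccontr)
  assume "b1 \<noteq> b2"
  then have ab: "b1 < b2" using le by simp
  define \<rho> where "\<rho> = walk_mean p (hit_gf p 1) 0"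
  have "\<rho> > 0" using supercritical m_nonneg unfolding \<rho>_def[symmetric]
    by (smt (verit) mult_nonneg_nonpos)
  have "\<rho> \<le> 1" unfolding \<rho>_def by (rule walk_mean_le) (auto simp: hit_gf_le_1)
  define y1 y2 where "y1 = \<rho> * b1" and "y2 = \<rho> * b2"
  have y: "0 < y1" "y1 < y2" "y2 \<le> 1"
    using ab b1 b2 \<open>\<rho> > 0\<close> \<open>\<rho> \<le> 1\<close> by (auto simp: y1_def y2_def intro: mult_le_one)
  let ?S = "\<lambda>y k. (\<Sum>i<k. (1 - y) ^ i) :: real"
  have int: "integrable (measure_pmf offs) (?S y1)" "integrable (measure_pmf offs) (?S y2)"
    using pgf_quotient(2) y by auto
  have "y1 * (\<integral>k. ?S y1 k \<partial>measure_pmf offs) = b1" "y2 * (\<integral>k. ?S y2 k \<partial>measure_pmf offs) = b2"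
    using b1 b2 pgf_quotient(1) y unfolding y1_def y2_def \<rho>_def by auto
  then have "\<rho> * (\<integral>k. ?S y1 k \<partial>measure_pmf offs) = 1" "\<rho> * (\<integral>k. ?S y2 k \<partial>measure_pmf offs) = 1"
    using b1 ab by (auto simp: y1_def y2_def)
  then have "(\<integral>k. ?S y1 k \<partial>measure_pmf offs) = (\<integral>k. ?S y2 k \<partial>measure_pmf offs)"
    using \<open>\<rho> > 0\<close> by (metis mult_left_cancel less_irrefl)
  then have zero: "(\<integral>k. ?S y1 k - ?S y2 k \<partial>measure_pmf offs) = 0" using int by simp
  have nonneg: "0 \<le> ?S y1 k - ?S y2 k" for k
    using y by (auto intro!: sum_mono power_mono)
  have "AE k in measure_pmf offs. ?S y1 k - ?S y2 k = 0"
    using zero nonneg int by (subst (asm) integral_nonneg_eq_0_iff_AE) auto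
  then have eq: "?S y1 k = ?S y2 k" if "k \<in> set_pmf offs" for k
    using that by (simp add: AE_measure_pmf_iff)
  have small: "k \<le> 1" if "k \<in> set_pmf offs" for k
  proof (rule ccontr)
    assume "\<not> k \<le> 1"
    then have "?S y2 k < ?S y1 k"
      using y by (intro sum_strict_mono_ex1) (auto intro!: power_mono bexI[of _ 1])
    then show False using eq[OF that] by simp
  qed
  have "m \<le> (\<integral>k. 1 \<partial>measure_pmf offs)"
    unfolding m_eq by (intro integral_mono_AE offs_int) (use small in \<open>auto simp: AE_measure_pmf_iff\<close>)
  then show False using m_gt_1 by simp
qed

end

section \<open>The family tree and its first generation\<close>

text \<open>A tree assigns to each label an offspring number and the displacement from the parent.
  Labels have the most recent index first, so the descendants of the \<open>i\<close>-th child of the root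
  are the labels \<open>u @ [i]\<close>.\<close>

type_synonym tree = "nat list \<Rightarrow> nat \<times> int"

definition sub :: "tree \<Rightarrow> nat \<Rightarrow> tree" where "sub t i = (\<lambda>u. t (u @ [i]))"

definition kids :: "int \<Rightarrow> tree \<Rightarrow> nat" where "kids x t = (if x = 0 then fst (t []) else 1)"

text \<open>The root label of the subtree of a child contains the displacement of the child, so
  \<open>child F x\<close> evaluates \<open>F\<close> from the position of a child whose parent is at \<open>x\<close>.\<close>

definition child :: "(int \<Rightarrow> tree \<Rightarrow> 'b) \<Rightarrow> int \<Rightarrow> tree \<Rightarrow> 'b" where
  "child F x s = F (x + snd (s [])) s"

text \<open>The positions at time \<open>n\<close> of the descendants of a particle at \<open>x\<close>. The recursion is on the
  first generation, so that the branching property is a step of an induction, and the values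
  are finite lists of integers, so that every functional of them is measurable.\<close>

primrec gen :: "nat \<Rightarrow> int \<Rightarrow> tree \<Rightarrow> int list" where
  "gen 0 = (\<lambda>x t. [x])"
| "gen (Suc n) = (\<lambda>x t. concat (map (\<lambda>i. child (gen n) x (sub t i)) [0..<kids x t]))"

definition tree_measure :: "nat pmf \<Rightarrow> int pmf \<Rightarrow> tree measure" where
  "tree_measure offs p = (\<Pi>\<^sub>M u\<in>(UNIV :: nat list set). measure_pmf (pair_pmf offs p))"

text \<open>Invariance under a change of the displacement of the root. For such functionals of the
  subtree of a child, the displacement of the child is independent of the rest of its subtree,
  and can be averaged out (\<open>nn_integral_child\<close>).\<close>

definition root_free :: "(tree \<Rightarrow> 'b) \<Rightarrow> bool" where
  "root_free F \<longleftrightarrow> (\<forall>t z. F (t([] := (fst (t []), z))) = F t)"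

lemma sub_upd [simp]: "sub (t([] := a)) i = sub t i"
  by (simp add: sub_def fun_eq_iff)

lemma root_free_gen: "root_free (gen n x)"
  by (cases n) (auto simp: root_free_def kids_def)

locale tree_space =
  fixes offs :: "nat pmf" and p :: "int pmf"
begin

abbreviation TM :: "tree measure" where "TM \<equiv> tree_measure offs p"

sublocale prob_space TM
  unfolding tree_measure_def by (rule prob_space_PiM) (rule measure_pmf.prob_space_axioms)

lemma space_TM [simp]: "space TM = UNIV"
  by (simp add: tree_measure_def space_PiM)

lemma emeasure_TM [simp]: "emeasure TM UNIV = 1"
  using emeasure_space_1 by simp

lemma measure_TM [simp]: "measure TM UNIV = 1"
  using prob_space by simp

lemma measurable_label: "(\<lambda>t. t u) \<in> measurable TM (count_space UNIV)"
proof -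
  have "(\<lambda>t. t u) \<in> measurable TM (measure_pmf (pair_pmf offs p))"
    unfolding tree_measure_def by (rule measurable_component_singleton) simp
  then show ?thesis by simp
qed

lemma measurable_to_TM:
  assumes "\<And>u. (\<lambda>x. f x u) \<in> measurable M (count_space UNIV)"
  shows "f \<in> measurable M TM"
proof -
  have "(\<lambda>x u. f x u) \<in> measurable M TM"
    unfolding tree_measure_def by (rule measurable_PiM_single') (use assms in auto)
  then show ?thesis by simp
qed

lemma measurable_sub [measurable]: "(\<lambda>t. sub t i) \<in> measurable TM TM"
  by (rule measurable_to_TM) (simp add: sub_def measurable_label)

lemma measurable_kids [measurable]: "kids x \<in> measurable TM (count_space UNIV)"
proof -
  have "(\<lambda>t. fst (t [])) \<in> measurable TM (count_space UNIV)"
    by (rule measurable_compose[OF measurable_label]) simp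
  then show ?thesis by (cases "x = 0") (simp_all add: kids_def[abs_def])
qed

lemma measurable_child [measurable]:
  assumes "\<And>x. F x \<in> measurable TM N"
  shows "child F x \<in> measurable TM N"
proof -
  have "(\<lambda>s. F (x + snd (s [])) s) \<in> measurable TM N"
  proof (rule measurable_compose_countable[where f = "\<lambda>y s. F y s"])
    show "(\<lambda>s. x + snd (s [])) \<in> measurable TM (count_space UNIV)"
      by (rule measurable_compose[OF measurable_label]) simp
  qed (rule assms)
  then show ?thesis by (simp add: child_def[abs_def])
qed

lemma measurable_gen [measurable]: "gen n x \<in> measurable TM (count_space UNIV)"
proof (induction n arbitrary: x)
  case (Suc n)
  have piece: "(\<lambda>t. child (gen n) x (sub t i)) \<in> measurable TM (count_space UNIV)" for i
    by (rule measurable_compose[OF measurable_sub measurable_child[OF Suc]])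
  have "(\<lambda>t. concat (map (\<lambda>i. child (gen n) x (sub t i)) [0..<k])) \<in> measurable TM (count_space UNIV)" for k
  proof (induction k)
    case (Suc k)
    have "(\<lambda>t. concat (map (\<lambda>i. child (gen n) x (sub t i)) [0..<k]) @ child (gen n) x (sub t k)) \<in> measurable TM (count_space UNIV)"
    proof (rule measurable_compose_countable[where f = "\<lambda>l t. l @ child (gen n) x (sub t k)"])
      show "(\<lambda>t. l @ child (gen n) x (sub t k)) \<in> measurable TM (count_space UNIV)" for l
        by (rule measurable_compose[OF piece]) simp
    qed (rule Suc)
    then show ?case by simp
  qed simp
  then show ?case
    unfolding gen.simps by (rule measurable_compose_countable[OF _ measurable_kids])
qed simp

lemma distr_sub: "distr TM TM (\<lambda>t. sub t i) = TM"
proof -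
  have "distr (Pi\<^sub>M UNIV (\<lambda>_. measure_pmf (pair_pmf offs p))) (Pi\<^sub>M UNIV (\<lambda>_. measure_pmf (pair_pmf offs p)))
     (\<lambda>\<omega>. \<lambda>u\<in>UNIV. \<omega> (u @ [i])) = Pi\<^sub>M UNIV (\<lambda>_. measure_pmf (pair_pmf offs p))"
    by (rule distr_PiM_reindex) (auto simp: inj_on_def measure_pmf.prob_space_axioms)
  then show ?thesis by (simp add: tree_measure_def sub_def[abs_def] restrict_UNIV)
qed

lemma measurable_plant: "(\<lambda>(a, X). X([] := a)) \<in> measurable (measure_pmf (pair_pmf offs p) \<Otimes>\<^sub>M TM) TM"
proof (rule measurable_to_TM)
  fix u
  show "(\<lambda>x. (case x of (a, X) \<Rightarrow> X([] := a)) u) \<in> measurable (measure_pmf (pair_pmf offs p) \<Otimes>\<^sub>M TM) (count_space UNIV)"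
  proof (cases "u = []")
    case True
    have "fst \<in> measurable (measure_pmf (pair_pmf offs p) \<Otimes>\<^sub>M TM) (measure_pmf (pair_pmf offs p))" by (rule measurable_fst)
    then show ?thesis using True by (simp add: case_prod_beta')
  next
    case False
    have "(\<lambda>x. snd x u) \<in> measurable (measure_pmf (pair_pmf offs p) \<Otimes>\<^sub>M TM) (count_space UNIV)"
      by (rule measurable_compose[OF measurable_snd measurable_label])
    then show ?thesis using False by (simp add: case_prod_beta')
  qed
qed

text \<open>The root label is independent of all other labels: replacing it by an independent copy does
  not change the law of the tree.\<close>

lemma distr_plant: "distr (measure_pmf (pair_pmf offs p) \<Otimes>\<^sub>M TM) TM (\<lambda>(a, X). X([] := a)) = TM"
  using distr_pair_PiM_eq_PiM[of "UNIV :: nat list set" "\<lambda>_. measure_pmf (pair_pmf offs p)" "[]"]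
  by (simp add: tree_measure_def measure_pmf.prob_space_axioms)

lemma nn_integral_root:
  assumes [measurable]: "F \<in> borel_measurable TM"
  shows "(\<integral>\<^sup>+t. F t \<partial>TM) = (\<integral>\<^sup>+a. \<integral>\<^sup>+X. F (X([] := a)) \<partial>TM \<partial>measure_pmf (pair_pmf offs p))"
proof -
  have "(\<integral>\<^sup>+t. F t \<partial>TM) = (\<integral>\<^sup>+t. F t \<partial>distr (measure_pmf (pair_pmf offs p) \<Otimes>\<^sub>M TM) TM (\<lambda>(a, X). X([] := a)))"
    by (simp only: distr_plant)
  also have "\<dots> = (\<integral>\<^sup>+y. F (case y of (a, X) \<Rightarrow> X([] := a)) \<partial>(measure_pmf (pair_pmf offs p) \<Otimes>\<^sub>M TM))"
    by (rule nn_integral_distr[OF measurable_plant]) measurable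
  also have "\<dots> = (\<integral>\<^sup>+a. \<integral>\<^sup>+X. F (case (a, X) of (a, X) \<Rightarrow> X([] := a)) \<partial>TM \<partial>measure_pmf (pair_pmf offs p))"
    by (rule nn_integral_fst[symmetric]) (rule measurable_compose[OF measurable_plant assms])
  finally show ?thesis by simp
qed

lemma nn_integral_sub:
  assumes [measurable]: "G \<in> borel_measurable TM"
  shows "(\<integral>\<^sup>+t. G (sub t i) \<partial>TM) = (\<integral>\<^sup>+t. G t \<partial>TM)"
  using nn_integral_distr[OF measurable_sub[of i], of G] by (simp add: distr_sub)

lemma indep_labels: "indep_vars (\<lambda>_. measure_pmf (pair_pmf offs p)) (\<lambda>u t. t u) UNIV"
proof (subst indep_vars_iff_distr_eq_PiM')
  show "random_variable (measure_pmf (pair_pmf offs p)) (\<lambda>t. t u)" for u using measurable_label by simp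
  have "distr TM (measure_pmf (pair_pmf offs p)) (\<lambda>t. t u) = measure_pmf (pair_pmf offs p)" for u
    unfolding tree_measure_def by (rule distr_PiM_component) (auto simp: measure_pmf.prob_space_axioms)
  then show "distr TM (\<Pi>\<^sub>M i\<in>UNIV. measure_pmf (pair_pmf offs p)) (\<lambda>t. \<lambda>u\<in>UNIV. t u) =
    (\<Pi>\<^sub>M i\<in>UNIV. distr TM (measure_pmf (pair_pmf offs p)) (\<lambda>t. t i))"
    by (simp add: tree_measure_def[symmetric] distr_id restrict_UNIV)
qed simp

lemma indep_sub: "indep_vars (\<lambda>_. TM) (\<lambda>i t. sub t i) UNIV"
proof -
  define K where "K i = range (\<lambda>u. u @ [i])" for i :: nat
  have "indep_vars (\<lambda>i. Pi\<^sub>M (K i) (\<lambda>_. measure_pmf (pair_pmf offs p))) (\<lambda>i t. restrict (\<lambda>u. t u) (K i)) UNIV"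
    by (rule indep_vars_restrict[OF indep_labels]) (auto simp: disjoint_family_on_def K_def)
  then have "indep_vars (\<lambda>_. TM) (\<lambda>i t. (\<lambda>f u. f (u @ [i])) (restrict (\<lambda>u. t u) (K i))) UNIV"
  proof (rule indep_vars_compose2)
    fix i
    show "(\<lambda>f u. f (u @ [i])) \<in> measurable (Pi\<^sub>M (K i) (\<lambda>_. measure_pmf (pair_pmf offs p))) TM"
    proof (rule measurable_to_TM)
      fix u
      have "(\<lambda>f. f (u @ [i])) \<in> measurable (Pi\<^sub>M (K i) (\<lambda>_. measure_pmf (pair_pmf offs p))) (measure_pmf (pair_pmf offs p))"
        by (rule measurable_component_singleton) (simp add: K_def)
      then show "(\<lambda>f. f (u @ [i])) \<in> measurable (Pi\<^sub>M (K i) (\<lambda>_. measure_pmf (pair_pmf offs p))) (count_space UNIV)" by simp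
    qed
  qed
  then show ?thesis by (simp add: sub_def[abs_def] K_def)
qed

lemma nn_integral_child:
  assumes F: "\<And>x. F x \<in> borel_measurable TM" and free: "\<And>x. root_free (F x)"
  shows "(\<integral>\<^sup>+s. child F x s \<partial>TM) = (\<integral>\<^sup>+z. (\<integral>\<^sup>+t. F (x + z) t \<partial>TM) \<partial>measure_pmf p)"
proof -
  define J where "J n y = (\<integral>\<^sup>+X. F y (X([] := (n, 0))) \<partial>TM)" for n y
  have upd: "F y (X([] := a)) = F y (X([] := (fst a, 0)))" for y X a
    using free[of y, unfolded root_free_def, rule_format, of "X([] := a)" 0] by simp
  have "(\<integral>\<^sup>+s. child F x s \<partial>TM) = (\<integral>\<^sup>+a. \<integral>\<^sup>+X. F (x + snd a) (X([] := a)) \<partial>TM \<partial>measure_pmf (pair_pmf offs p))"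
    by (subst nn_integral_root[OF measurable_child[OF F]]) (simp add: child_def)
  also have "\<dots> = (\<integral>\<^sup>+a. J (fst a) (x + snd a) \<partial>measure_pmf (pair_pmf offs p))"
    unfolding J_def by (subst upd) simp
  also have "\<dots> = (\<integral>\<^sup>+z. \<integral>\<^sup>+n. J n (x + z) \<partial>measure_pmf offs \<partial>measure_pmf p)"
    by (subst pair_commute_pmf) (simp add: nn_integral_pair_pmf' case_prod_beta')
  also have "\<dots> = (\<integral>\<^sup>+z. (\<integral>\<^sup>+t. F (x + z) t \<partial>TM) \<partial>measure_pmf p)"
  proof (intro nn_integral_cong)
    fix z
    have "(\<integral>\<^sup>+t. F (x + z) t \<partial>TM) = (\<integral>\<^sup>+a. J (fst a) (x + z) \<partial>measure_pmf (pair_pmf offs p))"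
      unfolding J_def by (subst nn_integral_root[OF F], subst upd) simp
    also have "\<dots> = (\<integral>\<^sup>+n. J n (x + z) \<partial>measure_pmf offs)"
      by (simp add: nn_integral_pair_pmf')
    finally show "(\<integral>\<^sup>+n. J n (x + z) \<partial>measure_pmf offs) = (\<integral>\<^sup>+t. F (x + z) t \<partial>TM)" by simp
  qed
  finally show ?thesis .
qed

lemma nn_integral_prod_sub:
  assumes [measurable]: "G \<in> borel_measurable TM"
  shows "(\<integral>\<^sup>+t. (\<Prod>i<k. G (sub t i)) \<partial>TM) = (\<integral>\<^sup>+t. G t \<partial>TM) ^ k"
proof -
  have "indep_vars (\<lambda>_. borel) (\<lambda>i t. G (sub t i)) {..<k}"
    by (rule indep_vars_subset[OF indep_vars_compose2[OF indep_sub]]) auto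
  then have "(\<integral>\<^sup>+t. (\<Prod>i<k. G (sub t i)) \<partial>TM) = (\<Prod>i<k. \<integral>\<^sup>+t. G (sub t i) \<partial>TM)"
    by (intro indep_vars_nn_integral) auto
  then show ?thesis by (simp add: nn_integral_sub)
qed

lemma nn_integral_kids:
  assumes meas: "\<And>k. (\<lambda>t. h k t) \<in> borel_measurable TM"
    and free: "\<And>k a t. h k (t([] := a)) = h k t"
  shows "(\<integral>\<^sup>+t. h (fst (t [])) t \<partial>TM) = (\<integral>\<^sup>+k. (\<integral>\<^sup>+t. h k t \<partial>TM) \<partial>measure_pmf offs)"
proof -
  have "(\<lambda>t. h (fst (t [])) t) \<in> borel_measurable TM"
  proof (rule measurable_compose_countable[where f = h])
    show "(\<lambda>t. fst (t [])) \<in> measurable TM (count_space UNIV)"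
      by (rule measurable_compose[OF measurable_label]) simp
  qed (rule meas)
  from nn_integral_root[OF this]
  have "(\<integral>\<^sup>+t. h (fst (t [])) t \<partial>TM) = (\<integral>\<^sup>+a. (\<integral>\<^sup>+X. h (fst a) X \<partial>TM) \<partial>measure_pmf (pair_pmf offs p))"
    by (simp add: free)
  also have "\<dots> = (\<integral>\<^sup>+k. (\<integral>\<^sup>+t. h k t \<partial>TM) \<partial>measure_pmf offs)" by (simp add: nn_integral_pair_pmf')
  finally show ?thesis .
qed

end

section \<open>One generation of branching\<close>

lemma prod_list_concat_map:
  "prod_list (map u (concat (map f [0..<k]))) = (\<Prod>i<k. prod_list (map u (f i)) :: 'a :: comm_monoid_mult)"
  by (induction k) (auto simp: mult.commute)

lemma sum_list_concat_map:
  "sum_list (map u (concat (map f [0..<k]))) = (\<Sum>i<k. sum_list (map u (f i)) :: 'a :: comm_monoid_add)"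
  by (induction k) (auto simp: add.commute)

lemma nn_integral_walk_mean:
  assumes "bdd_fun f" "\<And>x. 0 \<le> f x"
  shows "(\<integral>\<^sup>+z. ennreal (f (x + z)) \<partial>measure_pmf p) = ennreal (walk_mean p f x)"
  unfolding walk_mean_def using assms by (intro nn_integral_eq_integral) auto

context tree_space
begin

text \<open>Given the number of children, the subtrees are independent copies of the tree, and the
  displacement of a child is independent of its descendants. The next lemma is the additive
  counterpart.\<close>

lemma nn_branch_prod:
  fixes F :: "int \<Rightarrow> tree \<Rightarrow> ennreal"
  assumes F: "\<And>x. F x \<in> borel_measurable TM" and free: "\<And>x. root_free (F x)"
    and f: "\<And>y. (\<integral>\<^sup>+t. F y t \<partial>TM) = ennreal (f y)" and unit: "\<And>y. 0 \<le> f y" "\<And>y. f y \<le> 1"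
  shows "(\<integral>\<^sup>+t. (\<Prod>i<kids x t. child F x (sub t i)) \<partial>TM)
     = ennreal (if x = 0 then pgf offs (walk_mean p f 0) else walk_mean p f x)"
proof -
  have bdd: "bdd_fun f" using unit by (rule bdd_fun_unit)
  have meas: "child F x \<in> borel_measurable TM" for x by (rule measurable_child[OF F])
  have one: "(\<integral>\<^sup>+t. child F x t \<partial>TM) = ennreal (walk_mean p f x)"
    unfolding nn_integral_child[OF F free] f by (rule nn_integral_walk_mean[OF bdd unit(1)])
  have wm: "0 \<le> walk_mean p f 0" "walk_mean p f 0 \<le> 1"
    using bdd unit by (auto intro: walk_mean_nonneg walk_mean_le)
  show ?thesis
  proof (cases "x = 0")
    case True
    have "(\<integral>\<^sup>+t. (\<Prod>i<fst (t []). child F 0 (sub t i)) \<partial>TM)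
        = (\<integral>\<^sup>+k. (\<integral>\<^sup>+t. (\<Prod>i<k. child F 0 (sub t i)) \<partial>TM) \<partial>measure_pmf offs)"
    proof (rule nn_integral_kids)
      show "(\<lambda>t. \<Prod>i<k. child F 0 (sub t i)) \<in> borel_measurable TM" for k
        using meas[of 0] by measurable
    qed simp
    also have "\<dots> = (\<integral>\<^sup>+k. ennreal (walk_mean p f 0 ^ k) \<partial>measure_pmf offs)"
      using one True wm by (simp add: nn_integral_prod_sub[OF meas] ennreal_power)
    also have "\<dots> = ennreal (pgf offs (walk_mean p f 0))"
      unfolding pgf_def using wm by (intro nn_integral_eq_integral integrable_bdd_fun bdd_fun_power_unit) auto
    finally show ?thesis using True by (simp add: kids_def)
  next
    case False
    then show ?thesis using nn_integral_sub[OF meas] one by (simp add: kids_def)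
  qed
qed

lemma nn_branch_sum:
  fixes F :: "int \<Rightarrow> tree \<Rightarrow> ennreal"
  assumes F: "\<And>x. F x \<in> borel_measurable TM" and free: "\<And>x. root_free (F x)"
  shows "(\<integral>\<^sup>+t. (\<Sum>i<kids x t. child F x (sub t i)) \<partial>TM)
     = (if x = 0 then (\<integral>\<^sup>+k. ennreal (real k) \<partial>measure_pmf offs) else 1) * (\<integral>\<^sup>+z. (\<integral>\<^sup>+t. F (x + z) t \<partial>TM) \<partial>measure_pmf p)"
proof -
  have meas: "child F x \<in> borel_measurable TM" for x by (rule measurable_child[OF F])
  show ?thesis
  proof (cases "x = 0")
    case True
    have "(\<integral>\<^sup>+t. (\<Sum>i<fst (t []). child F 0 (sub t i)) \<partial>TM)
        = (\<integral>\<^sup>+k. (\<integral>\<^sup>+t. (\<Sum>i<k. child F 0 (sub t i)) \<partial>TM) \<partial>measure_pmf offs)"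
    proof (rule nn_integral_kids)
      show "(\<lambda>t. \<Sum>i<k. child F 0 (sub t i)) \<in> borel_measurable TM" for k
        using meas[of 0] by measurable
    qed simp
    also have "\<dots> = (\<integral>\<^sup>+k. ennreal (real k) * (\<integral>\<^sup>+t. child F 0 t \<partial>TM) \<partial>measure_pmf offs)"
    proof (intro nn_integral_cong)
      fix k
      have "(\<integral>\<^sup>+t. (\<Sum>i<k. child F 0 (sub t i)) \<partial>TM) = (\<Sum>i<k. (\<integral>\<^sup>+t. child F 0 (sub t i) \<partial>TM))"
        by (intro nn_integral_sum measurable_compose[OF measurable_sub meas])
      then show "(\<integral>\<^sup>+t. (\<Sum>i<k. child F 0 (sub t i)) \<partial>TM) = ennreal (real k) * (\<integral>\<^sup>+t. child F 0 t \<partial>TM)"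
        by (simp add: nn_integral_sub[OF meas] ennreal_of_nat_eq_real_of_nat)
    qed
    finally show ?thesis using True nn_integral_child[OF F free, where x = 0] by (simp add: kids_def nn_integral_multc)
  next
    case False
    then show ?thesis using nn_integral_sub[OF meas] nn_integral_child[OF F free] by (simp add: kids_def)
  qed
qed

lemma measurable_gen_fun [measurable]: "(\<lambda>t. f (gen n x t)) \<in> borel_measurable TM"
  by (rule measurable_compose[OF measurable_gen]) simp

lemma root_free_compose: "root_free F \<Longrightarrow> root_free (\<lambda>t. g (F t))"
  by (simp add: root_free_def)

lemma prod_gen:
  assumes u: "\<And>x. 0 \<le> u x" "\<And>x. u x \<le> 1"
  shows "(\<integral>\<^sup>+t. ennreal (prod_list (map u (gen n x t))) \<partial>TM) = ennreal (prodmean offs p u n x)"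
proof (induction n arbitrary: x)
  case (Suc n)
  define F where "F = (\<lambda>x t. ennreal (prod_list (map u (gen n x t))))"
  have pl: "0 \<le> prod_list (map u l)" for l using u by (induction l) auto
  have "ennreal (prod_list (map u (gen (Suc n) x t))) = (\<Prod>i<kids x t. child F x (sub t i))" for t
    unfolding gen.simps prod_list_concat_map by (subst prod_ennreal[symmetric]) (auto simp: pl F_def child_def)
  moreover have "(\<integral>\<^sup>+t. (\<Prod>i<kids x t. child F x (sub t i)) \<partial>TM)
     = ennreal (if x = 0 then pgf offs (walk_mean p (prodmean offs p u n) 0) else walk_mean p (prodmean offs p u n) x)"
  proof (rule nn_branch_prod)
    show "root_free (F x)" for x unfolding F_def by (rule root_free_compose[OF root_free_gen])
    show "F x \<in> borel_measurable TM" for x unfolding F_def by (rule measurable_gen_fun)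
  qed (use Suc prodmean_unit[of u offs p n, OF u] in \<open>auto simp: F_def\<close>)
  ultimately show ?case by simp
qed simp

lemma sum_gen:
  assumes m: "(\<integral>\<^sup>+k. ennreal (real k) \<partial>measure_pmf offs) = ennreal m" "m \<ge> 0"
    and h: "bdd_fun h" "\<And>x. 0 \<le> h x"
  shows "(\<integral>\<^sup>+t. ennreal (sum_list (map h (gen n x t))) \<partial>TM) = ennreal (popmean p m h n x)"
proof (induction n arbitrary: x)
  case (Suc n)
  define F where "F = (\<lambda>x t. ennreal (sum_list (map h (gen n x t))))"
  have pl: "0 \<le> sum_list (map h l)" for l using h by (induction l) auto
  have "ennreal (sum_list (map h (gen (Suc n) x t))) = (\<Sum>i<kids x t. child F x (sub t i))" for t
    unfolding gen.simps sum_list_concat_map by (subst sum_ennreal[symmetric]) (auto simp: pl F_def child_def)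
  moreover have "(\<integral>\<^sup>+t. (\<Sum>i<kids x t. child F x (sub t i)) \<partial>TM)
     = (if x = 0 then (\<integral>\<^sup>+k. ennreal (real k) \<partial>measure_pmf offs) else 1) * (\<integral>\<^sup>+z. (\<integral>\<^sup>+t. F (x + z) t \<partial>TM) \<partial>measure_pmf p)"
  proof (rule nn_branch_sum)
    show "root_free (F x)" for x unfolding F_def by (rule root_free_compose[OF root_free_gen])
    show "F x \<in> borel_measurable TM" for x unfolding F_def by (rule measurable_gen_fun)
  qed
  moreover have "(\<integral>\<^sup>+z. (\<integral>\<^sup>+t. F (x + z) t \<partial>TM) \<partial>measure_pmf p) = ennreal (walk_mean p (popmean p m h n) x)"
    unfolding F_def Suc using h m(2) by (intro nn_integral_walk_mean popmean_nonneg) auto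
  ultimately show ?case
    using m by (simp add: ennreal_mult'' walk_mean_nonneg popmean_nonneg h)
qed simp

text \<open>The cross terms vanish because the subtrees are independent and \<open>G\<close> is centred.\<close>

lemma sum_sub_square:
  assumes [measurable]: "G \<in> borel_measurable TM" and int: "integrable TM G" "integrable TM (\<lambda>t. (G t)\<^sup>2)"
    and zero: "(\<integral>t. G t \<partial>TM) = 0"
  shows "(\<integral>\<^sup>+t. ennreal ((\<Sum>i<k. G (sub t i))\<^sup>2) \<partial>TM) = ennreal (real k) * (\<integral>\<^sup>+t. ennreal ((G t)\<^sup>2) \<partial>TM)"
proof -
  have sub_int: "integrable TM (\<lambda>t. g (sub t i))" "(\<integral>t. g (sub t i) \<partial>TM) = (\<integral>t. g t \<partial>TM)"
    if "integrable TM g" for g :: "tree \<Rightarrow> real" and i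
  proof -
    have [measurable]: "g \<in> borel_measurable TM" using that by auto
    show "integrable TM (\<lambda>t. g (sub t i))"
      using that integrable_distr_eq[OF measurable_sub[of i], of g] by (simp add: distr_sub)
    show "(\<integral>t. g (sub t i) \<partial>TM) = (\<integral>t. g t \<partial>TM)"
      using integral_distr[OF measurable_sub[of i], of g] by (simp add: distr_sub)
  qed
  have ind: "indep_vars (\<lambda>_. borel) (\<lambda>i t. G (sub t i)) UNIV"
    by (rule indep_vars_compose2[OF indep_sub]) auto
  have pair: "integrable TM (\<lambda>t. G (sub t i) * G (sub t j))" "(\<integral>t. G (sub t i) * G (sub t j) \<partial>TM) = 0" if "i \<noteq> j" for i j
  proof -
    have iv: "indep_vars (\<lambda>_. borel) (\<lambda>i t. G (sub t i)) {i, j}"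
      by (rule indep_vars_subset[OF ind]) simp
    show "integrable TM (\<lambda>t. G (sub t i) * G (sub t j))"
      using indep_vars_integrable[OF _ iv] sub_int(1)[OF int(1)] that by simp
    show "(\<integral>t. G (sub t i) * G (sub t j) \<partial>TM) = 0"
      using indep_vars_lebesgue_integral[OF _ iv] sub_int[OF int(1)] zero that by simp
  qed
  have rec: "integrable TM (\<lambda>t. (\<Sum>i<k. G (sub t i))\<^sup>2) \<and> (\<integral>t. (\<Sum>i<k. G (sub t i))\<^sup>2 \<partial>TM) = real k * (\<integral>t. (G t)\<^sup>2 \<partial>TM)"
  proof (induction k)
    case (Suc k)
    have eq: "(\<Sum>i<Suc k. G (sub t i))\<^sup>2 = (\<Sum>i<k. G (sub t i))\<^sup>2 + 2 * (\<Sum>i<k. G (sub t i) * G (sub t k)) + (G (sub t k))\<^sup>2" for t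
      by (simp add: power2_sum sum_distrib_right)
    have 1: "integrable TM (\<lambda>t. 2 * (\<Sum>i<k. G (sub t i) * G (sub t k)))"
      "(\<integral>t. 2 * (\<Sum>i<k. G (sub t i) * G (sub t k)) \<partial>TM) = 0"
    proof -
      have int_sum: "integrable TM (\<lambda>t. \<Sum>i<k. G (sub t i) * G (sub t k))"
        by (intro Bochner_Integration.integrable_sum pair(1)) auto
      then show "integrable TM (\<lambda>t. 2 * (\<Sum>i<k. G (sub t i) * G (sub t k)))" by simp
      have "(\<integral>t. (\<Sum>i<k. G (sub t i) * G (sub t k)) \<partial>TM) = (\<Sum>i<k. \<integral>t. G (sub t i) * G (sub t k) \<partial>TM)"
        by (intro Bochner_Integration.integral_sum pair(1)) auto
      also have "\<dots> = 0" using pair(2)[of _ k] by (intro sum.neutral) auto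
      finally show "(\<integral>t. 2 * (\<Sum>i<k. G (sub t i) * G (sub t k)) \<partial>TM) = 0" by simp
    qed
    have 2: "integrable TM (\<lambda>t. (G (sub t k))\<^sup>2)" "(\<integral>t. (G (sub t k))\<^sup>2 \<partial>TM) = (\<integral>t. (G t)\<^sup>2 \<partial>TM)"
      using sub_int[OF int(2)] by auto
    show ?case unfolding eq using Suc 1 2 by (simp add: algebra_simps)
  qed simp
  have "(\<integral>\<^sup>+t. ennreal ((\<Sum>i<k. G (sub t i))\<^sup>2) \<partial>TM) = ennreal (real k * (\<integral>t. (G t)\<^sup>2 \<partial>TM))"
    using rec by (subst nn_integral_eq_integral) auto
  also have "\<dots> = ennreal (real k) * (\<integral>\<^sup>+t. ennreal ((G t)\<^sup>2) \<partial>TM)"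
    using int(2) by (subst nn_integral_eq_integral) (auto simp: ennreal_mult)
  finally show ?thesis .
qed

end

section \<open>The additive martingale\<close>

sublocale catalytic \<subseteq> tree_space offs p .

context catalytic
begin

lemma nn_mean: "(\<integral>\<^sup>+k. ennreal (real k) \<partial>measure_pmf offs) = ennreal m"
  unfolding m_eq by (intro nn_integral_eq_integral offs_int) auto

definition W :: "nat \<Rightarrow> int \<Rightarrow> tree \<Rightarrow> real" where
  "W n x t = disc ^ n * sum_list (map \<phi> (gen n x t))"

lemma W_nonneg: "0 \<le> W n x t"
proof -
  have "0 \<le> sum_list (map \<phi> l)" for l by (induction l) auto
  then show ?thesis by (simp add: W_def)
qed

lemma measurable_W [measurable]: "W n x \<in> borel_measurable TM"
  unfolding W_def[abs_def] by (rule measurable_gen_fun)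

lemma root_free_W: "root_free (W n x)"
  unfolding W_def[abs_def] by (rule root_free_compose[OF root_free_gen])

lemma W_0 [simp]: "W 0 x t = \<phi> x" by (simp add: W_def)

lemma W_Suc: "W (Suc n) x t = disc * (\<Sum>i<kids x t. child (W n) x (sub t i))"
  by (simp add: W_def sum_list_concat_map child_def sum_distrib_left mult_ac)

lemma popmean_phi: "popmean p m \<phi> n x = exp r ^ n * \<phi> x"
proof (induction n arbitrary: x)
  case (Suc n)
  then have "popmean p m \<phi> n = (\<lambda>x. exp r ^ n * \<phi> x)" by (rule ext)
  then show ?case using phi_step[of x] phi_step_0 by (simp add: walk_mean_cmult mult_ac)
qed simp

lemma nn_integral_W: "(\<integral>\<^sup>+t. ennreal (W n x t) \<partial>TM) = ennreal (\<phi> x)"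
proof -
  have "(\<integral>\<^sup>+t. ennreal (W n x t) \<partial>TM) = ennreal (disc ^ n) * (\<integral>\<^sup>+t. ennreal (sum_list (map \<phi> (gen n x t))) \<partial>TM)"
    by (simp add: W_def ennreal_mult' nn_integral_cmult)
  also have "\<dots> = ennreal (disc ^ n * (exp r ^ n * \<phi> x))"
    by (subst sum_gen[OF nn_mean m_nonneg]) (auto simp: popmean_phi ennreal_mult)
  also have "disc ^ n * (exp r ^ n * \<phi> x) = \<phi> x"
    by (simp add: exp_minus flip: mult.assoc power_mult_distrib)
  finally show ?thesis .
qed

definition dW :: "nat \<Rightarrow> int \<Rightarrow> tree \<Rightarrow> real" where
  "dW n x t = W (Suc n) x t - W n x t"

lemma measurable_dW [measurable]: "dW n x \<in> borel_measurable TM"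
  unfolding dW_def[abs_def] by measurable

lemma root_free_dW: "root_free (dW n x)"
  using root_free_W[of "Suc n" x] root_free_W[of n x] by (simp add: root_free_def dW_def)

lemma dW_Suc: "dW (Suc n) x t = disc * (\<Sum>i<kids x t. child (dW n) x (sub t i))"
proof -
  have "child (dW n) x s = child (W (Suc n)) x s - child (W n) x s" for s
    by (simp only: child_def dW_def)
  then show ?thesis by (simp only: dW_def[of "Suc n"] W_Suc right_diff_distrib sum_subtractf)
qed

lemma child_W_integral:
  "integrable TM (child (W n) x)" "(\<integral>t. child (W n) x t \<partial>TM) = walk_mean p \<phi> x"
proof -
  have "(\<integral>\<^sup>+t. ennreal (child (W n) x t) \<partial>TM) = (\<integral>\<^sup>+t. child (\<lambda>x t. ennreal (W n x t)) x t \<partial>TM)"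
    by (simp add: child_def)
  also have "\<dots> = ennreal (walk_mean p \<phi> x)"
  proof (subst nn_integral_child)
    show "root_free (\<lambda>t. ennreal (W n x t))" for x by (rule root_free_compose[OF root_free_W])
  qed (simp_all add: nn_integral_W nn_integral_walk_mean)
  finally have nn: "(\<integral>\<^sup>+t. ennreal (child (W n) x t) \<partial>TM) = ennreal (walk_mean p \<phi> x)" .
  have meas: "child (W n) x \<in> borel_measurable TM" by (rule measurable_child) measurable
  have nonneg: "0 \<le> child (W n) x t" for t by (simp add: child_def W_nonneg)
  show "integrable TM (child (W n) x)"
    using nn meas nonneg by (intro integrableI_nonneg) auto
  show "(\<integral>t. child (W n) x t \<partial>TM) = walk_mean p \<phi> x"
    using nn meas nonneg by (subst integral_eq_nn_integral) (auto simp: walk_mean_nonneg)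
qed

text \<open>The martingale property, seen from the position of the parent.\<close>

lemma child_dW_integral:
  "integrable TM (child (dW n) x)" "(\<integral>t. child (dW n) x t \<partial>TM) = 0"
proof -
  have "child (dW n) x = (\<lambda>t. child (W (Suc n)) x t - child (W n) x t)"
    by (simp add: child_def dW_def fun_eq_iff)
  then show "integrable TM (child (dW n) x)" "(\<integral>t. child (dW n) x t \<partial>TM) = 0"
    using child_W_integral[of n x] child_W_integral[of "Suc n" x] by simp_all
qed

definition var_const :: real where "var_const = 2 * off_sq + 2"

lemma var_const: "var_const \<ge> 2" by (simp add: var_const_def)

lemma dW_0_square: "(\<integral>\<^sup>+t. ennreal ((dW 0 x t)\<^sup>2) \<partial>TM) \<le> ennreal (var_const * \<phi> x)"
proof (cases "x = 0")
  case True
  have "(dW 0 0 t)\<^sup>2 \<le> 2 * (real (fst (t [])))\<^sup>2 + 2" for t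
  proof -
    have "0 \<le> (\<Sum>i<fst (t []). \<phi> (snd (t [i])))" by (intro sum_nonneg) simp
    moreover have "(\<Sum>i<fst (t []). \<phi> (snd (t [i]))) \<le> (\<Sum>i<fst (t []). 1)" by (intro sum_mono) simp
    moreover have "W 1 0 t = disc * (\<Sum>i<fst (t []). \<phi> (snd (t [i])))"
      by (simp add: W_Suc[of 0, simplified] kids_def child_def sub_def)
    ultimately have "0 \<le> W 1 0 t" "W 1 0 t \<le> real (fst (t []))"
      using mult_left_le_one_le[of "\<Sum>i<fst (t []). \<phi> (snd (t [i]))" disc] disc by auto
    then have "(dW 0 0 t)\<^sup>2 \<le> (real (fst (t [])) + 1)\<^sup>2"
      by (intro abs_le_square_iff[THEN iffD1]) (simp add: dW_def)
    also have "\<dots> \<le> 2 * (real (fst (t [])))\<^sup>2 + 2"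
      using sum_squares_bound[of "real (fst (t []))" 1] by (simp add: power2_sum)
    finally show ?thesis .
  qed
  then have "(\<integral>\<^sup>+t. ennreal ((dW 0 0 t)\<^sup>2) \<partial>TM) \<le> (\<integral>\<^sup>+t. ennreal (2 * (real (fst (t [])))\<^sup>2 + 2) \<partial>TM)"
    by (intro nn_integral_mono ennreal_leI)
  also have "\<dots> = (\<integral>\<^sup>+k. ennreal (2 * (real k)\<^sup>2 + 2) \<partial>measure_pmf offs)"
    using nn_integral_kids[of "\<lambda>k t. ennreal (2 * (real k)\<^sup>2 + 2)"] by simp
  also have "\<dots> = ennreal (\<integral>k. 2 * (real k)\<^sup>2 + 2 \<partial>measure_pmf offs)"
    using offs_sq by (intro nn_integral_eq_integral) auto
  also have "\<dots> = ennreal var_const" using offs_sq by (simp add: var_const_def)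
  finally show ?thesis using True by simp
next
  case False
  have "(dW 0 x t)\<^sup>2 \<le> disc * child (W 0) x (sub t 0) + \<phi> x" for t
  proof -
    have "dW 0 x t = disc * child (W 0) x (sub t 0) - \<phi> x"
      using False by (simp add: dW_def W_Suc kids_def)
    moreover have "0 \<le> child (W 0) x (sub t 0)" "child (W 0) x (sub t 0) \<le> 1" by (simp_all add: child_def)
    moreover have "(a - c)\<^sup>2 \<le> a + c" if "0 \<le> a" "a \<le> 1" "0 \<le> c" "c \<le> 1" for a c :: real
    proof -
      have "a * a \<le> a" "c * c \<le> c" "0 \<le> a * c" using that by (auto simp: mult_left_le)
      then show ?thesis by (simp add: power2_eq_square algebra_simps)
    qed
    ultimately show ?thesis using disc by (simp add: mult_le_one)
  qed
  then have "(\<integral>\<^sup>+t. ennreal ((dW 0 x t)\<^sup>2) \<partial>TM) \<le> (\<integral>\<^sup>+t. ennreal (disc * child (W 0) x (sub t 0) + \<phi> x) \<partial>TM)"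
    by (intro nn_integral_mono ennreal_leI)
  also have "\<dots> = (\<integral>\<^sup>+t. ennreal (disc * child (W 0) x t + \<phi> x) \<partial>TM)"
    by (rule nn_integral_sub[of "\<lambda>t. ennreal (disc * child (W 0) x t + \<phi> x)"])
       (use measurable_child[of "W 0" borel x] in measurable)
  also have "\<dots> = ennreal (\<integral>t. disc * child (W 0) x t + \<phi> x \<partial>TM)"
    using child_W_integral(1)[of 0 x]
    by (intro nn_integral_eq_integral Bochner_Integration.integrable_add integrable_mult_right) (auto simp: child_def[abs_def])
  also have "(\<integral>t. disc * child (W 0) x t + \<phi> x \<partial>TM) = disc * walk_mean p \<phi> x + \<phi> x"
    using child_W_integral[of 0 x] by simp
  also have "\<dots> = 2 * \<phi> x" using phi_step[OF False] by (simp add: exp_minus)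
  also have "ennreal (2 * \<phi> x) \<le> ennreal (var_const * \<phi> x)"
    using var_const by (intro ennreal_leI mult_right_mono) auto
  finally show ?thesis .
qed

text \<open>An increment is \<open>e\<^bsup>-r\<^esup>\<close> times the sum over the children of their centred and independent
  increments of the previous order. So its second moment is \<open>e\<^bsup>-2r\<^esup>\<close> times the mean operator
  applied to the previous second moment, and each generation gains a factor \<open>e\<^bsup>-2r\<^esup> e\<^sup>r = e\<^bsup>-r\<^esup>\<close>.\<close>

lemma dW_square: "(\<integral>\<^sup>+t. ennreal ((dW n x t)\<^sup>2) \<partial>TM) \<le> ennreal (var_const * disc ^ n * \<phi> x)"
proof (induction n arbitrary: x)
  case 0
  then show ?case using dW_0_square by simp
next
  case (Suc n)
  have meas [measurable]: "child (dW n) x \<in> borel_measurable TM" for x by (rule measurable_child) measurable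
  have sq: "(\<integral>\<^sup>+t. ennreal ((child (dW n) x t)\<^sup>2) \<partial>TM) \<le> ennreal (var_const * disc ^ n * walk_mean p \<phi> x)" for x
  proof -
    have "(\<integral>\<^sup>+t. ennreal ((child (dW n) x t)\<^sup>2) \<partial>TM) = (\<integral>\<^sup>+t. child (\<lambda>x t. ennreal ((dW n x t)\<^sup>2)) x t \<partial>TM)"
      by (simp add: child_def)
    also have "\<dots> = (\<integral>\<^sup>+z. (\<integral>\<^sup>+t. ennreal ((dW n (x + z) t)\<^sup>2) \<partial>TM) \<partial>measure_pmf p)"
      by (rule nn_integral_child) (measurable, rule root_free_compose[OF root_free_dW])
    also have "\<dots> \<le> (\<integral>\<^sup>+z. ennreal (var_const * disc ^ n * \<phi> (x + z)) \<partial>measure_pmf p)"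
      by (intro nn_integral_mono Suc)
    also have "\<dots> = ennreal (walk_mean p (\<lambda>y. var_const * disc ^ n * \<phi> y) x)"
      using var_const by (intro nn_integral_walk_mean) auto
    finally show ?thesis by (simp add: walk_mean_cmult)
  qed
  have sq_int: "integrable TM (\<lambda>t. (child (dW n) x t)\<^sup>2)"
    by (rule integrableI_nonneg) (use sq[of x] in \<open>auto intro: le_less_trans\<close>)
  have scale: "(\<integral>\<^sup>+t. ennreal ((dW (Suc n) x t)\<^sup>2) \<partial>TM) = ennreal (disc\<^sup>2) * (\<integral>\<^sup>+t. ennreal ((\<Sum>i<kids x t. child (dW n) x (sub t i))\<^sup>2) \<partial>TM)"
  proof -
    have "(\<lambda>t. (\<Sum>i<kids x t. child (dW n) x (sub t i))\<^sup>2) \<in> borel_measurable TM"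
      by (rule measurable_compose_countable[where f = "\<lambda>k t. (\<Sum>i<k. child (dW n) x (sub t i))\<^sup>2", OF _ measurable_kids]) measurable
    then show ?thesis unfolding dW_Suc power_mult_distrib
      by (subst nn_integral_cmult[symmetric]) (auto simp: ennreal_mult)
  qed
  show ?case
  proof (cases "x = 0")
    case True
    have "(\<integral>\<^sup>+t. ennreal ((\<Sum>i<fst (t []). child (dW n) 0 (sub t i))\<^sup>2) \<partial>TM)
        = (\<integral>\<^sup>+k. (\<integral>\<^sup>+t. ennreal ((\<Sum>i<k. child (dW n) 0 (sub t i))\<^sup>2) \<partial>TM) \<partial>measure_pmf offs)"
      by (rule nn_integral_kids[of "\<lambda>k t. ennreal ((\<Sum>i<k. child (dW n) 0 (sub t i))\<^sup>2)"]) auto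
    also have "\<dots> = (\<integral>\<^sup>+k. ennreal (real k) * (\<integral>\<^sup>+t. ennreal ((child (dW n) 0 t)\<^sup>2) \<partial>TM) \<partial>measure_pmf offs)"
      using sum_sub_square[OF meas child_dW_integral(1) sq_int child_dW_integral(2)] unfolding True by simp
    also have "\<dots> = ennreal m * (\<integral>\<^sup>+t. ennreal ((child (dW n) 0 t)\<^sup>2) \<partial>TM)"
      by (simp add: nn_integral_multc nn_mean)
    also have "\<dots> \<le> ennreal m * ennreal (var_const * disc ^ n * walk_mean p \<phi> 0)"
      by (intro mult_left_mono sq) simp
    finally have "(\<integral>\<^sup>+t. ennreal ((dW (Suc n) x t)\<^sup>2) \<partial>TM) \<le> ennreal (disc\<^sup>2) * (ennreal m * ennreal (var_const * disc ^ n * walk_mean p \<phi> 0))"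
      unfolding scale using True by (simp add: kids_def mult_left_mono)
    also have "\<dots> = ennreal (disc\<^sup>2 * (m * (var_const * disc ^ n * walk_mean p \<phi> 0)))"
      using m_nonneg var_const by (simp add: ennreal_mult[symmetric] walk_mean_nonneg)
    also have "disc\<^sup>2 * (m * (var_const * disc ^ n * walk_mean p \<phi> 0)) = var_const * disc ^ n * disc * (m * (disc * walk_mean p \<phi> 0))"
      by (simp add: power2_eq_square mult_ac)
    finally show ?thesis using True malthus by (simp add: mult_ac)
  next
    case False
    have "(\<integral>\<^sup>+t. ennreal ((dW (Suc n) x t)\<^sup>2) \<partial>TM) = ennreal (disc\<^sup>2) * (\<integral>\<^sup>+t. ennreal ((child (dW n) x t)\<^sup>2) \<partial>TM)"
      unfolding scale using False nn_integral_sub[of "\<lambda>t. ennreal ((child (dW n) x t)\<^sup>2)" 0] by (simp add: kids_def)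
    also have "\<dots> \<le> ennreal (disc\<^sup>2) * ennreal (var_const * disc ^ n * walk_mean p \<phi> x)"
      by (intro mult_left_mono sq) simp
    also have "\<dots> = ennreal (disc\<^sup>2 * (var_const * disc ^ n * walk_mean p \<phi> x))"
      using var_const by (simp add: ennreal_mult[symmetric] walk_mean_nonneg)
    also have "disc\<^sup>2 * (var_const * disc ^ n * walk_mean p \<phi> x) = var_const * disc ^ Suc n * \<phi> x"
      using phi_step[OF False] by (simp add: power2_eq_square exp_minus)
    finally show ?thesis .
  qed
qed

end

section \<open>Survival and the martingale limit\<close>

context tree_space
begin

text \<open>An event that happens exactly when a second event happens for every child has a probability
  given by the generating function of the offspring law. When the two events coincide this is
  a fixed point equation.\<close>

lemma branch_event:
  assumes meas: "\<And>x. {t. E x t} \<in> sets TM" and free: "\<And>x. root_free (E x)"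
    and rec: "\<And>t. E' t \<longleftrightarrow> (\<forall>i<kids x t. child E x (sub t i))"
  shows "prob {t. E' t} =
    (if x = 0 then pgf offs (walk_mean p (\<lambda>y. prob {t. E y t}) 0) else walk_mean p (\<lambda>y. prob {t. E y t}) x)"
proof -
  define F :: "int \<Rightarrow> tree \<Rightarrow> ennreal" where "F = (\<lambda>y t. indicator {t. E y t} t)"
  have ind: "(\<Prod>i<kids x t. child F x (sub t i)) = indicator {t. E' t} t" for t
    unfolding F_def child_def rec indicator_def by (auto simp: child_def prod_eq_1_iff intro: prod_zero)
  have "(\<integral>\<^sup>+t. (\<Prod>i<kids x t. child F x (sub t i)) \<partial>TM)
     = ennreal (if x = 0 then pgf offs (walk_mean p (\<lambda>y. prob {t. E y t}) 0) else walk_mean p (\<lambda>y. prob {t. E y t}) x)"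
  proof (rule nn_branch_prod)
    show "F y \<in> borel_measurable TM" for y
      unfolding F_def using meas[of y] by (intro borel_measurable_indicator)
    show "root_free (F y)" for y
      using free[of y] by (simp add: F_def root_free_def indicator_def)
    show "(\<integral>\<^sup>+t. F y t \<partial>TM) = ennreal (prob {t. E y t})" for y
      unfolding F_def using meas[of y] by (simp add: emeasure_eq_measure)
  qed auto
  moreover have "{t. E' t} \<in> sets TM"
  proof -
    have "(\<lambda>t. \<Prod>i<kids x t. child F x (sub t i)) \<in> borel_measurable TM"
    proof (rule measurable_compose_countable[where f = "\<lambda>k t. \<Prod>i<k. child F x (sub t i)", OF _ measurable_kids])
      have F: "F y \<in> borel_measurable TM" for y
        unfolding F_def using meas[of y] by (intro borel_measurable_indicator)
      show "(\<lambda>t. \<Prod>i<k. child F x (sub t i)) \<in> borel_measurable TM" for k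
        by (intro borel_measurable_prod_ennreal measurable_compose[OF measurable_sub measurable_child[OF F]])
    qed
    then have "(\<lambda>t. indicator {t. E' t} t :: ennreal) \<in> borel_measurable TM" unfolding ind .
    then show ?thesis by (simp add: borel_measurable_indicator_iff)
  qed
  ultimately have "ennreal (prob {t. E' t}) = ennreal (if x = 0 then pgf offs (walk_mean p (\<lambda>y. prob {t. E y t}) 0) else walk_mean p (\<lambda>y. prob {t. E y t}) x)"
    unfolding ind by (simp add: emeasure_eq_measure)
  moreover have "0 \<le> pgf offs (walk_mean p (\<lambda>y. prob {t. E y t}) 0)" "0 \<le> walk_mean p (\<lambda>y. prob {t. E y t}) x"
    by (intro pgf_unit walk_mean_nonneg walk_mean_le bdd_fun_unit; simp)+
  ultimately show ?thesis by (auto simp: ennreal_inj split: if_splits)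
qed

lemma set_gen_Suc: "c \<in> set (gen (Suc n) x t) \<longleftrightarrow> (\<exists>i<kids x t. c \<in> set (child (gen n) x (sub t i)))"
  by auto

definition extinct :: "int \<Rightarrow> tree \<Rightarrow> bool" where
  "extinct x t \<longleftrightarrow> (\<forall>\<^sub>F n in sequentially. 0 \<notin> set (gen n x t))"

lemma pred_gen: "{t. Q (gen n x t)} \<in> sets TM"
proof -
  have "gen n x -` {l. Q l} \<inter> space TM \<in> sets TM" by (rule measurable_sets[OF measurable_gen]) simp
  then show ?thesis by (simp add: vimage_def)
qed

lemma extinct_measurable: "{t. extinct x t} \<in> sets TM"
proof -
  have "{t. extinct x t} = (\<Union>n0. \<Inter>n\<in>{n0..}. {t. 0 \<notin> set (gen n x t)})"
    by (auto simp: extinct_def eventually_sequentially)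
  also have "\<dots> \<in> sets TM"
    by (intro sets.countable_UN sets.countable_INT' pred_gen image_subsetI) (auto intro: pred_gen)
  finally show ?thesis .
qed

lemma root_free_extinct: "root_free (extinct x)"
  using root_free_gen by (simp add: root_free_def extinct_def)

lemma extinct_rec: "extinct x t \<longleftrightarrow> (\<forall>i<kids x t. child extinct x (sub t i))"
proof -
  have "extinct x t \<longleftrightarrow> (\<forall>\<^sub>F n in sequentially. 0 \<notin> set (gen (Suc n) x t))"
    unfolding extinct_def by (rule eventually_sequentially_Suc[symmetric])
  also have "\<dots> \<longleftrightarrow> (\<forall>\<^sub>F n in sequentially. \<forall>i\<in>{..<kids x t}. 0 \<notin> set (child (gen n) x (sub t i)))"
    unfolding set_gen_Suc by (intro arg_cong[where f = "\<lambda>P. eventually P sequentially"] ext) auto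
  also have "\<dots> \<longleftrightarrow> (\<forall>i\<in>{..<kids x t}. \<forall>\<^sub>F n in sequentially. 0 \<notin> set (child (gen n) x (sub t i)))"
    by (rule eventually_ball_finite_distrib) simp
  finally show ?thesis by (auto simp: child_def extinct_def)
qed

text \<open>Until the origin is visited there is a single particle, and it moves as the underlying
  walk.\<close>

lemma no_hit_prob: "prob {t. \<forall>i\<le>n. 0 \<notin> set (gen i x t)} = 1 - (\<Sum>i\<le>n. hit p i x)"
proof (induction n arbitrary: x)
  case 0
  then show ?case by simp
next
  case (Suc n)
  show ?case
  proof (cases "x = 0")
    case True
    then have "0 \<in> set (gen 0 x t)" for t by simp
    then have empty: "{t. \<forall>i\<le>Suc n. 0 \<notin> set (gen i x t)} = {}" by blast
    show ?thesis unfolding empty using True by (simp add: sum.atMost_Suc_shift del: sum.atMost_Suc)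
  next
    case False
    define E where "E = (\<lambda>x t. \<forall>i\<le>n. 0 \<notin> set (gen i x t))"
    have "prob {t. \<forall>i\<le>Suc n. 0 \<notin> set (gen i x t)}
        = (if x = 0 then pgf offs (walk_mean p (\<lambda>y. prob {t. E y t}) 0) else walk_mean p (\<lambda>y. prob {t. E y t}) x)"
    proof (rule branch_event)
      show "{t. E y t} \<in> sets TM" for y
      proof -
        have "{t. E y t} = (\<Inter>i\<in>{..n}. {t. 0 \<notin> set (gen i y t)})" by (auto simp: E_def)
        also have "\<dots> \<in> sets TM" by (intro sets.countable_INT' pred_gen image_subsetI) (auto intro: pred_gen)
        finally show ?thesis .
      qed
      show "root_free (E y)" for y using root_free_gen by (simp add: root_free_def E_def)
      fix t
      have "(\<forall>i\<le>Suc n. Q i) \<longleftrightarrow> Q 0 \<and> (\<forall>i\<le>n. Q (Suc i))" for Q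
        by (metis Suc_le_mono nat.exhaust zero_le)
      from this[of "\<lambda>i. 0 \<notin> set (gen i x t)"]
      have "(\<forall>i\<le>Suc n. 0 \<notin> set (gen i x t)) \<longleftrightarrow> (\<forall>i\<le>n. 0 \<notin> set (gen (Suc i) x t))"
        using False by simp
      then show "(\<forall>i\<le>Suc n. 0 \<notin> set (gen i x t)) \<longleftrightarrow> (\<forall>i<kids x t. child E x (sub t i))"
        using False unfolding set_gen_Suc by (auto simp: kids_def child_def E_def)
    qed
    also have "\<dots> = walk_mean p (\<lambda>y. 1 - (\<Sum>i\<le>n. hit p i y)) x" using False Suc by (simp add: E_def)
    also have "\<dots> = 1 - (\<Sum>i\<le>n. walk_mean p (hit p i) x)" by (simp add: walk_mean_diff walk_mean_sum)
    also have "\<dots> = 1 - (\<Sum>i\<le>Suc n. hit p i x)"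
      using False by (simp add: sum.atMost_Suc_shift del: sum.atMost_Suc)
    finally show ?thesis .
  qed
qed

lemma survive_le_hit: "1 - prob {t. extinct x t} \<le> hit_gf p 1 x"
proof -
  have le: "1 - prob {t. extinct x t} \<le> 1 - prob (\<Inter>n. {t. \<forall>i\<le>n. 0 \<notin> set (gen i x t)})"
    by (intro diff_left_mono finite_measure_mono extinct_measurable) (auto simp: extinct_def intro!: always_eventually)
  have 1: "(\<lambda>n. prob {t. \<forall>i\<le>n. 0 \<notin> set (gen i x t)}) \<longlonglongrightarrow> prob (\<Inter>n. {t. \<forall>i\<le>n. 0 \<notin> set (gen i x t)})"
  proof (rule finite_Lim_measure_decseq)
    show "range (\<lambda>n. {t. \<forall>i\<le>n. 0 \<notin> set (gen i x t)}) \<subseteq> sets TM"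
    proof (rule image_subsetI)
      fix n
      have "{t. \<forall>i\<le>n. 0 \<notin> set (gen i x t)} = (\<Inter>i\<in>{..n}. {t. 0 \<notin> set (gen i x t)})" by auto
      also have "\<dots> \<in> sets TM" by (intro sets.countable_INT' pred_gen image_subsetI) (auto intro: pred_gen)
      finally show "{t. \<forall>i\<le>n. 0 \<notin> set (gen i x t)} \<in> sets TM" .
    qed
    show "decseq (\<lambda>n. {t. \<forall>i\<le>n. 0 \<notin> set (gen i x t)})" by (auto simp: decseq_def)
  qed
  have 2: "(\<lambda>n. 1 - (\<Sum>i\<le>n. hit p i x)) \<longlonglongrightarrow> 1 - hit_gf p 1 x"
    using hit_gf_sums[of 1 p x] by (intro tendsto_intros) (simp add: sums_def_le)
  have "prob (\<Inter>n. {t. \<forall>i\<le>n. 0 \<notin> set (gen i x t)}) = 1 - hit_gf p 1 x"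
    by (rule LIMSEQ_unique[OF 1[unfolded no_hit_prob] 2])
  then show ?thesis using le by simp
qed

lemma length_gen_Suc: "0 \<notin> set (gen n x t) \<Longrightarrow> length (gen (Suc n) x t) = length (gen n x t)"
proof (induction n arbitrary: x t)
  case 0
  then show ?case by (simp add: kids_def child_def)
next
  case (Suc n)
  have "length (child (gen (Suc n)) x (sub t i)) = length (child (gen n) x (sub t i))" if "i < kids x t" for i
    unfolding child_def by (rule Suc.IH) (use Suc.prems that in \<open>auto simp: child_def\<close>)
  then have "(\<Sum>i\<leftarrow>[0..<kids x t]. length (child (gen (Suc n)) x (sub t i))) = (\<Sum>i\<leftarrow>[0..<kids x t]. length (child (gen n) x (sub t i)))"
    by (intro arg_cong[where f = sum_list] map_cong) auto
  then show ?case unfolding gen.simps(2)[of "Suc n"] gen.simps(2)[of n] length_concat map_map o_def .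
qed

end

context catalytic
begin

lemma sum_list_phi_le: "sum_list (map \<phi> l) \<le> real (length l)"
proof (induction l)
  case (Cons a l)
  then show ?case using add_mono[OF phi_le_1[of a] Cons] by (simp del: phi_le_1)
qed simp

text \<open>Without further visits to the origin the number of particles is constant, while the
  normalisation decays.\<close>

lemma extinct_imp_W_tendsto_0:
  assumes "extinct x t" shows "(\<lambda>n. W n x t) \<longlonglongrightarrow> 0"
proof -
  obtain n0 where n0: "\<And>n. n \<ge> n0 \<Longrightarrow> 0 \<notin> set (gen n x t)"
    using assms by (auto simp: extinct_def eventually_sequentially)
  have len: "length (gen (n0 + j) x t) = length (gen n0 x t)" for j
    by (induction j) (use length_gen_Suc[OF n0] in auto)
  have ev: "\<forall>\<^sub>F n in sequentially. W n x t \<le> disc ^ n * real (length (gen n0 x t))"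
    using eventually_ge_at_top[of n0]
  proof eventually_elim
    case (elim n)
    then have "length (gen n x t) = length (gen n0 x t)" using len[of "n - n0"] by simp
    then show ?case unfolding W_def using sum_list_phi_le[of "gen n x t"] by (intro mult_left_mono) auto
  qed
  have "(\<lambda>n. disc ^ n * real (length (gen n0 x t))) \<longlonglongrightarrow> 0 * real (length (gen n0 x t))"
    using disc by (intro tendsto_mult tendsto_const LIMSEQ_realpow_zero) auto
  then have lim: "(\<lambda>n. disc ^ n * real (length (gen n0 x t))) \<longlonglongrightarrow> 0" by simp
  show ?thesis
    by (rule tendsto_sandwich[OF _ ev tendsto_const lim]) (simp add: W_nonneg)
qed

definition vanishes :: "int \<Rightarrow> tree \<Rightarrow> bool" where
  "vanishes x t \<longleftrightarrow> (\<lambda>n. W n x t) \<longlonglongrightarrow> 0"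

lemma vanishes_measurable: "{t. vanishes x t} \<in> sets TM"
proof -
  have iff: "vanishes x t \<longleftrightarrow> (\<forall>k. \<exists>N. \<forall>n\<ge>N. W n x t < inverse (real (Suc k)))" for t
  proof
    assume "vanishes x t"
    then show "\<forall>k. \<exists>N. \<forall>n\<ge>N. W n x t < inverse (real (Suc k))"
    proof (intro allI)
      fix k
      have "(\<lambda>n. W n x t) \<longlonglongrightarrow> 0" using \<open>vanishes x t\<close> by (simp only: vanishes_def)
      from order_tendstoD(2)[OF this, of "inverse (real (Suc k))"]
      show "\<exists>N. \<forall>n\<ge>N. W n x t < inverse (real (Suc k))" unfolding eventually_sequentially by simp
    qed
  next
    assume *: "\<forall>k. \<exists>N. \<forall>n\<ge>N. W n x t < inverse (real (Suc k))"
    show "vanishes x t" unfolding vanishes_def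
    proof (rule LIMSEQ_I)
      fix e :: real assume "e > 0"
      then obtain k where "inverse (real (Suc k)) < e" using reals_Archimedean by blast
      moreover obtain N where "\<forall>n\<ge>N. W n x t < inverse (real (Suc k))" using * by blast
      ultimately have "\<forall>n\<ge>N. norm (W n x t - 0) < e" using W_nonneg[of _ x t] by (auto intro: less_trans)
      then show "\<exists>N. \<forall>n\<ge>N. norm (W n x t - 0) < e" by blast
    qed
  qed
  have "{t. vanishes x t} = (\<Inter>k. \<Union>N. \<Inter>n\<in>{N..}. {t. W n x t < inverse (real (Suc k))})"
  proof (intro set_eqI)
    fix t
    have "t \<in> (\<Inter>k. \<Union>N. \<Inter>n\<in>{N..}. {t. W n x t < inverse (real (Suc k))})
        \<longleftrightarrow> (\<forall>k. \<exists>N. \<forall>n\<in>{N..}. W n x t < inverse (real (Suc k)))"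
      by (simp only: INT_iff UN_iff mem_Collect_eq UNIV_I Ball_def Bex_def simp_thms)
    also have "\<dots> \<longleftrightarrow> t \<in> {t. vanishes x t}"
      by (simp only: iff Ball_def atLeast_iff mem_Collect_eq)
    finally show "t \<in> {t. vanishes x t} \<longleftrightarrow> t \<in> (\<Inter>k. \<Union>N. \<Inter>n\<in>{N..}. {t. W n x t < inverse (real (Suc k))})" ..
  qed
  also have "\<dots> \<in> sets TM"
  proof -
    have "{t. W n x t < c} \<in> sets TM" for n c
      using measurable_sets[OF measurable_W[of n x], of "{..<c}"] by (simp add: vimage_def)
    then show ?thesis by (intro sets.countable_INT' sets.countable_UN image_subsetI) (auto intro!: sets.countable_INT' sets.countable_UN)
  qed
  finally show ?thesis .
qed

lemma root_free_vanishes: "root_free (vanishes x)"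
  using root_free_W by (simp add: root_free_def vanishes_def)

text \<open>Exact for every tree, because a finite sum of nonnegative sequences tends to 0 if and only
  if each of them does. This is why the event that \<open>W\<close> tends to 0 is preferred to the event
  that its almost sure limit vanishes.\<close>

lemma vanishes_rec: "vanishes x t \<longleftrightarrow> (\<forall>i<kids x t. child vanishes x (sub t i))"
proof -
  let ?c = "\<lambda>i n. child (W n) x (sub t i)"
  have nonneg: "0 \<le> ?c i n" for i n by (simp add: child_def W_nonneg)
  have "vanishes x t \<longleftrightarrow> (\<lambda>n. disc * (\<Sum>i<kids x t. ?c i n)) \<longlonglongrightarrow> disc * 0"
    unfolding vanishes_def W_Suc[symmetric] by (simp add: filterlim_sequentially_Suc[of "\<lambda>n. W n x t"])
  also have "\<dots> \<longleftrightarrow> (\<lambda>n. \<Sum>i<kids x t. ?c i n) \<longlonglongrightarrow> 0"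
    by (rule tendsto_mult_left_iff) simp
  also have "\<dots> \<longleftrightarrow> (\<forall>i<kids x t. (\<lambda>n. ?c i n) \<longlonglongrightarrow> 0)"
  proof
    assume lim: "(\<lambda>n. \<Sum>i<kids x t. ?c i n) \<longlonglongrightarrow> 0"
    show "\<forall>i<kids x t. (\<lambda>n. ?c i n) \<longlonglongrightarrow> 0"
    proof (intro allI impI)
      fix i assume "i < kids x t"
      then have "?c i n \<le> (\<Sum>i<kids x t. ?c i n)" for n
        using nonneg by (intro member_le_sum) auto
      then show "(\<lambda>n. ?c i n) \<longlonglongrightarrow> 0"
        by (intro tendsto_sandwich[OF always_eventually always_eventually tendsto_const lim]) (auto simp: nonneg)
    qed
  qed (auto intro: tendsto_null_sum)
  finally show ?thesis by (simp add: child_def vanishes_def)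
qed

definition \<eta> :: real where "\<eta> = exp (- r / 2)"

lemma eta: "0 < \<eta>" "\<eta> < 1" "disc ^ n = \<eta> ^ n * \<eta> ^ n"
  using r_pos by (auto simp: \<eta>_def mult_exp_exp simp flip: power_mult_distrib)

definition L1_const :: real where "L1_const = var_const + 1"

lemma L1_const: "L1_const > 0" using var_const by (simp add: L1_const_def)

text \<open>The bound \<open>\<bar>a\<bar> \<le> a\<^sup>2 / c + c\<close> with \<open>c = \<eta>\<^sup>n\<close> balances the second moment, which is of order
  \<open>\<eta>\<^bsup>2n\<^esup>\<close>.\<close>

lemma dW_L1: "(\<integral>\<^sup>+t. ennreal \<bar>dW n x t\<bar> \<partial>TM) \<le> ennreal (L1_const * \<eta> ^ n)"
proof -
  have abs_le: "\<bar>a\<bar> \<le> (1 / c) * a\<^sup>2 + c" if "c > 0" for a c :: real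
  proof (cases "\<bar>a\<bar> \<le> c")
    case False
    then have "\<bar>a\<bar> * c \<le> \<bar>a\<bar> * \<bar>a\<bar>" by (intro mult_left_mono) auto
    then have "\<bar>a\<bar> \<le> a\<^sup>2 / c" using that by (simp add: field_simps power2_eq_square)
    then show ?thesis using that by simp
  qed (use that in \<open>simp add: add_increasing\<close>)
  have "(\<integral>\<^sup>+t. ennreal \<bar>dW n x t\<bar> \<partial>TM) \<le> (\<integral>\<^sup>+t. ennreal (1 / \<eta> ^ n) * ennreal ((dW n x t)\<^sup>2) + ennreal (\<eta> ^ n) \<partial>TM)"
    using abs_le[of "\<eta> ^ n"] eta
    by (intro nn_integral_mono) (simp add: ennreal_mult[symmetric] ennreal_plus[symmetric] ennreal_leI del: ennreal_plus)
  also have "\<dots> = ennreal (1 / \<eta> ^ n) * (\<integral>\<^sup>+t. ennreal ((dW n x t)\<^sup>2) \<partial>TM) + ennreal (\<eta> ^ n)"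
    by (simp add: nn_integral_add nn_integral_cmult)
  also have "\<dots> \<le> ennreal (1 / \<eta> ^ n) * ennreal (var_const * disc ^ n * \<phi> x) + ennreal (\<eta> ^ n)"
    by (intro add_right_mono mult_left_mono dW_square) simp
  also have "\<dots> = ennreal (1 / \<eta> ^ n * (var_const * disc ^ n * \<phi> x) + \<eta> ^ n)"
    using eta var_const by (simp add: ennreal_mult[symmetric] ennreal_plus[symmetric] del: ennreal_plus)
  also have "\<dots> \<le> ennreal (L1_const * \<eta> ^ n)"
  proof (rule ennreal_leI)
    have "1 / \<eta> ^ n * (var_const * disc ^ n * \<phi> x) = var_const * \<eta> ^ n * \<phi> x"
      using eta(1) by (simp add: eta(3))
    also have "\<dots> \<le> var_const * \<eta> ^ n" using eta var_const by (simp add: mult_left_le)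
    finally show "1 / \<eta> ^ n * (var_const * disc ^ n * \<phi> x) + \<eta> ^ n \<le> L1_const * \<eta> ^ n"
      by (simp add: L1_const_def algebra_simps)
  qed
  finally show ?thesis .
qed

text \<open>A lower limit in the extended nonnegative reals is measurable without a case distinction on
  convergence, and it is nonnegative for every tree.\<close>

definition Winf :: "tree \<Rightarrow> real" where
  "Winf t = enn2real (liminf (\<lambda>n. ennreal (W n 0 t)))"

lemma measurable_Winf [measurable]: "Winf \<in> borel_measurable TM"
  unfolding Winf_def[abs_def] by measurable

lemma Winf_nonneg: "Winf t \<ge> 0" by (simp add: Winf_def)

lemma eta_sums: "(\<lambda>j. L1_const * \<eta> ^ (n + j)) sums (L1_const * \<eta> ^ n / (1 - \<eta>))"
  using sums_mult[OF geometric_sums[of \<eta>], of "L1_const * \<eta> ^ n"] eta by (simp add: power_add mult_ac)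

lemma increments_nn: "(\<integral>\<^sup>+t. (\<Sum>j. ennreal \<bar>dW (n + j) 0 t\<bar>) \<partial>TM) \<le> ennreal (L1_const * \<eta> ^ n / (1 - \<eta>))"
proof -
  have "(\<integral>\<^sup>+t. (\<Sum>j. ennreal \<bar>dW (n + j) 0 t\<bar>) \<partial>TM) = (\<Sum>j. \<integral>\<^sup>+t. ennreal \<bar>dW (n + j) 0 t\<bar> \<partial>TM)"
    by (rule nn_integral_suminf) measurable
  also have "\<dots> \<le> (\<Sum>j. ennreal (L1_const * \<eta> ^ (n + j)))" by (intro suminf_le dW_L1) auto
  also have "\<dots> = ennreal (L1_const * \<eta> ^ n / (1 - \<eta>))"
    using eta_sums L1_const eta by (intro suminf_ennreal_eq) auto
  finally show ?thesis .
qed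

text \<open>The increments are absolutely summable almost surely, as the expectation of their sum is
  finite.\<close>

lemma W_converges: "AE t in TM. (\<lambda>n. W n 0 t) \<longlonglongrightarrow> Winf t
    \<and> (\<forall>n. ennreal \<bar>Winf t - W n 0 t\<bar> \<le> (\<Sum>j. ennreal \<bar>dW (n + j) 0 t\<bar>))"
proof -
  have "AE t in TM. (\<Sum>j. ennreal \<bar>dW (0 + j) 0 t\<bar>) \<noteq> \<infinity>"
    by (rule nn_integral_PInf_AE) (use increments_nn[of 0] in \<open>auto simp: top_unique\<close>)
  then show ?thesis
  proof eventually_elim
    case (elim t)
    have summ: "summable (\<lambda>j. \<bar>dW j 0 t\<bar>)"
      by (rule summable_suminf_not_top) (use elim in \<open>auto simp: infinity_ennreal_def\<close>)
    have W: "W n 0 t = (\<Sum>j<n. dW j 0 t) + 1" for n by (induction n) (auto simp: dW_def)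
    have "(\<lambda>n. (\<Sum>j<n. dW j 0 t) + 1) \<longlonglongrightarrow> (\<Sum>j. dW j 0 t) + 1"
      by (intro tendsto_add tendsto_const summable_LIMSEQ summable_rabs_cancel[OF summ])
    then obtain L where L: "(\<lambda>n. W n 0 t) \<longlonglongrightarrow> L" unfolding W[symmetric] by blast
    then have "L \<ge> 0" by (rule tendsto_lowerbound) (auto simp: W_nonneg)
    have "(\<lambda>n. ennreal (W n 0 t)) \<longlonglongrightarrow> ennreal L" using L by (rule tendsto_ennrealI)
    then have "liminf (\<lambda>n. ennreal (W n 0 t)) = ennreal L" by (intro lim_imp_Liminf) auto
    then have Lim: "Winf t = L" using \<open>L \<ge> 0\<close> by (simp add: Winf_def)
    have "ennreal \<bar>L - W n 0 t\<bar> \<le> (\<Sum>j. ennreal \<bar>dW (n + j) 0 t\<bar>)" for n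
    proof -
      have "(\<lambda>j. W (n + j) 0 t) \<longlonglongrightarrow> L" using LIMSEQ_ignore_initial_segment[OF L, of n] by (simp add: add.commute)
      from telescope_sums[OF this] have s: "(\<lambda>j. dW (n + j) 0 t) sums (L - W n 0 t)" by (simp add: dW_def)
      have summ': "summable (\<lambda>j. \<bar>dW (n + j) 0 t\<bar>)"
        using summ summable_iff_shift[of "\<lambda>j. \<bar>dW j 0 t\<bar>" n] by (simp add: add.commute)
      have le: "\<bar>L - W n 0 t\<bar> \<le> (\<Sum>j. \<bar>dW (n + j) 0 t\<bar>)"
        using summable_rabs[OF summ'] sums_unique[OF s] by simp
      have "(\<Sum>j. ennreal \<bar>dW (n + j) 0 t\<bar>) = ennreal (\<Sum>j. \<bar>dW (n + j) 0 t\<bar>)"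
        by (rule suminf_ennreal2[OF _ summ']) simp
      with le show ?thesis by (simp only: ennreal_leI)
    qed
    then show ?case using L Lim by simp
  qed
qed

lemma W_L1: "(\<integral>\<^sup>+t. ennreal \<bar>Winf t - W n 0 t\<bar> \<partial>TM) \<le> ennreal (L1_const * \<eta> ^ n / (1 - \<eta>))"
proof -
  have "(\<integral>\<^sup>+t. ennreal \<bar>Winf t - W n 0 t\<bar> \<partial>TM) \<le> (\<integral>\<^sup>+t. (\<Sum>j. ennreal \<bar>dW (n + j) 0 t\<bar>) \<partial>TM)"
    by (rule nn_integral_mono_AE) (use W_converges in eventually_elim, blast)
  then show ?thesis using increments_nn[of n] by simp
qed

lemma eta_tendsto: "(\<lambda>n. L1_const * \<eta> ^ n / (1 - \<eta>)) \<longlonglongrightarrow> 0"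
proof -
  have "(\<lambda>n. L1_const * \<eta> ^ n / (1 - \<eta>)) \<longlonglongrightarrow> L1_const * 0 / (1 - \<eta>)"
    using eta by (intro tendsto_intros LIMSEQ_realpow_zero) auto
  then show ?thesis by simp
qed

text \<open>The expectation of \<open>W\<^sub>n\<close> is 1 for all \<open>n\<close>, and the convergence holds in \<open>L\<^sup>1\<close>.\<close>

lemma vanishes_prob_less: "prob {t. vanishes 0 t} < 1"
proof (rule ccontr)
  assume "\<not> prob {t. vanishes 0 t} < 1"
  then have "prob {t. vanishes 0 t} = 1" using prob_le_1[of "{t. vanishes 0 t}"] by linarith
  then have "AE t in TM. t \<in> {t. vanishes 0 t}" by (rule AE_prob_1)
  with W_converges have "AE t in TM. Winf t = 0"
    by eventually_elim (auto simp: vanishes_def dest: LIMSEQ_unique)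
  then have ae: "AE t in TM. ennreal (W n 0 t) = ennreal \<bar>Winf t - W n 0 t\<bar>" for n
    by eventually_elim (simp add: W_nonneg)
  have "(\<integral>\<^sup>+t. ennreal (W n 0 t) \<partial>TM) = (\<integral>\<^sup>+t. ennreal \<bar>Winf t - W n 0 t\<bar> \<partial>TM)" for n
    by (rule nn_integral_cong_AE[OF ae])
  then have "1 \<le> L1_const * \<eta> ^ n / (1 - \<eta>)" for n
    using W_L1[of n] nn_integral_W[of n 0] by (simp add: ennreal_le_iff2)
  with eta_tendsto show False using LIMSEQ_le_const by fastforce
qed

text \<open>Both complements are dominated by the event of a visit to the origin, so their
  probabilities are determined by the values at the origin (\<open>harmonic_off_origin\<close>), and these
  are positive roots of one equation.\<close>

lemma extinct_eq_vanishes: "prob {t. extinct 0 t} = prob {t. vanishes 0 t}"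
proof -
  define dS dV where "dS = (\<lambda>x. 1 - prob {t. extinct x t})" and "dV = (\<lambda>x. 1 - prob {t. vanishes x t})"
  have sub: "prob {t. extinct x t} \<le> prob {t. vanishes x t}" for x
    by (rule finite_measure_mono[OF _ vanishes_measurable]) (auto simp: vanishes_def extinct_imp_W_tendsto_0)
  have le: "dV x \<le> dS x" "dS x \<le> hit_gf p 1 x" "dV x \<le> hit_gf p 1 x" "0 \<le> dS x" "0 \<le> dV x" for x
    using sub[of x] survive_le_hit[of x] by (auto simp: dS_def dV_def)
  have bdd: "bdd_fun (\<lambda>x. prob {t. E x t})" for E by (rule bdd_fun_unit) auto
  have harm: "d x = hit_gf p 1 x * d 0 \<and> 1 - pgf offs (1 - walk_mean p (hit_gf p 1) 0 * d 0) = d 0"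
    if d: "d = (\<lambda>x. 1 - prob {t. E x t})" "\<And>x. d x \<le> hit_gf p 1 x"
      and E: "\<And>x. prob {t. E x t} =
        (if x = 0 then pgf offs (walk_mean p (\<lambda>y. prob {t. E y t}) 0) else walk_mean p (\<lambda>y. prob {t. E y t}) x)"
    for d :: "int \<Rightarrow> real" and E x
  proof -
    have wm: "walk_mean p d x = 1 - walk_mean p (\<lambda>y. prob {t. E y t}) x" for x
      unfolding d(1) using bdd by (subst walk_mean_diff) auto
    have eq: "d x = hit_gf p 1 x * d 0" for x
    proof (rule harmonic_off_origin)
      show "d x = walk_mean p d x" if "x \<noteq> 0" for x
        unfolding wm using E[of x] that by (simp add: d(1))
    qed (use d in auto)
    have "walk_mean p d 0 = walk_mean p (hit_gf p 1) 0 * d 0"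
      by (subst eq[abs_def]) (simp add: walk_mean_multc)
    then have X: "walk_mean p (\<lambda>y. prob {t. E y t}) 0 = 1 - walk_mean p (hit_gf p 1) 0 * d 0"
      using wm[of 0] by linarith
    have "d 0 = 1 - prob {t. E 0 t}" by (simp only: d(1))
    moreover have "prob {t. E 0 t} = pgf offs (walk_mean p (\<lambda>y. prob {t. E y t}) 0)"
      by (subst E) simp
    ultimately have "d 0 = 1 - pgf offs (1 - walk_mean p (hit_gf p 1) 0 * d 0)" unfolding X by linarith
    then show ?thesis using eq[of x] by linarith
  qed
  have rS: "1 - pgf offs (1 - walk_mean p (hit_gf p 1) 0 * dS 0) = dS 0"
  proof (rule harm[of dS extinct, THEN conjunct2])
    show "dS = (\<lambda>x. 1 - prob {t. extinct x t})" by (simp only: dS_def)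
    show "dS x \<le> hit_gf p 1 x" for x by (rule le)
    show "prob {t. extinct x t} =
        (if x = 0 then pgf offs (walk_mean p (\<lambda>y. prob {t. extinct y t}) 0)
         else walk_mean p (\<lambda>y. prob {t. extinct y t}) x)" for x
      by (rule branch_event[OF extinct_measurable root_free_extinct extinct_rec])
  qed
  have rV: "1 - pgf offs (1 - walk_mean p (hit_gf p 1) 0 * dV 0) = dV 0"
  proof (rule harm[of dV vanishes, THEN conjunct2])
    show "dV = (\<lambda>x. 1 - prob {t. vanishes x t})" by (simp only: dV_def)
    show "dV x \<le> hit_gf p 1 x" for x by (rule le)
    show "prob {t. vanishes x t} =
        (if x = 0 then pgf offs (walk_mean p (\<lambda>y. prob {t. vanishes y t}) 0)
         else walk_mean p (\<lambda>y. prob {t. vanishes y t}) x)" for x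
      by (rule branch_event[OF vanishes_measurable root_free_vanishes vanishes_rec])
  qed
  have "dV 0 = dS 0"
    by (rule survival_root_unique[OF _ rV _ rS]) (use le vanishes_prob_less in \<open>auto simp: dV_def dS_def\<close>)
  then show ?thesis by (simp add: dS_def dV_def)
qed

lemma Winf_pos_iff_survival: "AE t in TM. Winf t > 0 \<longleftrightarrow> \<not> extinct 0 t"
proof -
  have "prob ({t. vanishes 0 t} - {t. extinct 0 t}) = 0"
  proof -
    have "{t. extinct 0 t} \<subseteq> {t. vanishes 0 t}" by (auto simp: vanishes_def extinct_imp_W_tendsto_0)
    then show ?thesis
      by (simp add: finite_measure_Diff[OF vanishes_measurable extinct_measurable] extinct_eq_vanishes)
  qed
  then have "{t. vanishes 0 t} - {t. extinct 0 t} \<in> null_sets TM"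
    using vanishes_measurable extinct_measurable by (auto simp: null_sets_def emeasure_eq_measure)
  from AE_not_in[OF this] W_converges show ?thesis
  proof eventually_elim
    case (elim t)
    have "Winf t = 0 \<longleftrightarrow> vanishes 0 t" using elim by (auto simp: vanishes_def dest: LIMSEQ_unique)
    moreover have "vanishes 0 t \<longleftrightarrow> extinct 0 t" using elim extinct_imp_W_tendsto_0 by (auto simp: vanishes_def)
    ultimately show ?case using Winf_nonneg[of t] by auto
  qed
qed

end

section \<open>The law of the maximum\<close>

lemma exp_minus_bounds:
  fixes x :: real
  assumes "0 \<le> x"
  shows "1 - x \<le> exp (- x)" "exp (- x) \<le> 1 - x + x\<^sup>2"
proof -
  show "1 - x \<le> exp (- x)" using exp_ge_add_one_self[of "- x"] by simp
  have "exp (- x) * (1 + x) \<le> exp (- x) * exp x" by (intro mult_left_mono exp_ge_add_one_self) auto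
  also have "\<dots> = 1" by (simp add: mult_exp_exp)
  also have "1 \<le> (1 - x + x\<^sup>2) * (1 + x)" using assms by (simp add: algebra_simps power2_eq_square)
  finally show "exp (- x) \<le> 1 - x + x\<^sup>2" using assms by (simp add: mult_le_cancel_right)
qed

lemma exp_minus_lipschitz:
  fixes x y :: real
  assumes "0 \<le> x" "0 \<le> y"
  shows "\<bar>exp (- x) - exp (- y)\<bar> \<le> \<bar>x - y\<bar>"
proof -
  have *: "exp (- a) - exp (- c) \<le> c - a" if "0 \<le> a" "a \<le> c" for a c :: real
  proof -
    have "exp (- a) - exp (- c) = exp (- a) * (1 - exp (- (c - a)))"
      by (simp add: right_diff_distrib mult_exp_exp)
    also have "\<dots> \<le> 1 * (c - a)"
      using that exp_minus_bounds(1)[of "c - a"] by (intro mult_mono) auto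
    finally show ?thesis by simp
  qed
  show ?thesis
  proof (cases "x \<le> y")
    case True
    then have "exp (- y) \<le> exp (- x)" by simp
    then show ?thesis using *[of x y] True assms by simp
  next
    case False
    then have "exp (- x) \<le> exp (- y)" by simp
    then show ?thesis using *[of y x] False assms by simp
  qed
qed

lemma prod_list_exp_approx:
  fixes v :: "'a \<Rightarrow> real"
  assumes v: "\<And>x. 0 \<le> v x" "\<And>x. v x \<le> 1"
  shows "\<bar>prod_list (map (\<lambda>x. 1 - v x) l) - exp (- sum_list (map v l))\<bar> \<le> sum_list (map (\<lambda>x. (v x)\<^sup>2) l)"
proof (induction l)
  case (Cons x l)
  let ?P = "prod_list (map (\<lambda>x. 1 - v x) l)" and ?Q = "exp (- sum_list (map v l))"
  have P: "0 \<le> ?P \<and> ?P \<le> 1" by (induction l) (use v in \<open>auto intro: mult_le_one\<close>)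
  have "prod_list (map (\<lambda>x. 1 - v x) (x # l)) - exp (- sum_list (map v (x # l)))
      = (1 - v x - exp (- v x)) * ?P + exp (- v x) * (?P - ?Q)"
    by (simp add: exp_diff exp_minus algebra_simps divide_inverse)
  also have "\<bar>\<dots>\<bar> \<le> \<bar>1 - v x - exp (- v x)\<bar> * ?P + exp (- v x) * \<bar>?P - ?Q\<bar>"
    using P by (intro order_trans[OF abs_triangle_ineq]) (simp add: abs_mult)
  also have "\<dots> \<le> (v x)\<^sup>2 * 1 + 1 * sum_list (map (\<lambda>x. (v x)\<^sup>2) l)"
    using P Cons v exp_minus_bounds[of "v x"] by (intro add_mono mult_mono) auto
  finally show ?case by simp
qed simp

context catalytic
begin

lemma max_le_prob: "prob {t. \<forall>c\<in>set (gen n 0 t). c \<le> k} = prodmean offs p (\<lambda>x. of_bool (x \<le> k)) n 0"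
proof -
  have "prod_list (map (\<lambda>x. of_bool (x \<le> k)) l) = (of_bool (\<forall>c\<in>set l. c \<le> k) :: real)" for l :: "int list"
    by (induction l) auto
  then have "(\<integral>\<^sup>+t. ennreal (of_bool (\<forall>c\<in>set (gen n 0 t). c \<le> k)) \<partial>TM) = ennreal (prodmean offs p (\<lambda>x. of_bool (x \<le> k)) n 0)"
    using prod_gen[of "\<lambda>x. of_bool (x \<le> k)" n 0] by simp
  moreover have "(\<integral>\<^sup>+t. ennreal (of_bool (\<forall>c\<in>set (gen n 0 t). c \<le> k)) \<partial>TM)
      = (\<integral>\<^sup>+t. indicator {t. \<forall>c\<in>set (gen n 0 t). c \<le> k} t \<partial>TM)"
    by (intro nn_integral_cong) (auto simp: indicator_def)
  moreover have "\<dots> = ennreal (prob {t. \<forall>c\<in>set (gen n 0 t). c \<le> k})"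
    using pred_gen[of "\<lambda>l. \<forall>c\<in>set l. c \<le> k"] by (simp add: emeasure_eq_measure)
  ultimately show ?thesis
    using prodmean_unit[of "\<lambda>x. of_bool (x \<le> k)" offs p n 0] by simp
qed

lemma max_le_prob_branching:
  "prob {t. \<forall>c\<in>set (gen (j + l) 0 t). c \<le> k} = (\<integral>t. prod_list (map (\<lambda>x. 1 - prob_above k l x) (gen j 0 t)) \<partial>TM)"
proof -
  have P: "0 \<le> prod_list (map (\<lambda>x. 1 - prob_above k l x) g)" for g
    by (induction g) (use prob_above_unit in auto)
  have "(\<integral>t. prod_list (map (\<lambda>x. 1 - prob_above k l x) (gen j 0 t)) \<partial>TM)
     = enn2real (\<integral>\<^sup>+t. ennreal (prod_list (map (\<lambda>x. 1 - prob_above k l x) (gen j 0 t))) \<partial>TM)"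
    by (rule integral_eq_nn_integral) (use P in auto)
  also have "\<dots> = prodmean offs p (\<lambda>x. 1 - prob_above k l x) j 0"
    using prob_above_unit prodmean_unit[of "\<lambda>x. 1 - prob_above k l x" offs p j 0] by (subst prod_gen) auto
  finally show ?thesis by (simp add: max_le_prob prodmean_add prodmean_prob_above)
qed

text \<open>The quantity \<open>e\<close> is the error in the asymptotics of the mean. In the bound the factor
  \<open>(a * disc ^ j)\<^sup>2\<close>, of the order of the square of \<open>prob_above\<close>, collects the quadratic
  errors; summed over the particles of generation \<open>j\<close> it is of order \<open>e\<^bsup>-rj\<^esup> W\<^sub>j\<close>.\<close>

lemma prob_above_approx:
  fixes k :: int and n j :: nat and x :: int
  assumes n: "n = j + l"
  defines "a \<equiv> exp (- t0 * (real_of_int k - speed * real n))"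
    and "q \<equiv> exp (t0 * real_of_int k) * (disc ^ l * mean_above k l x)"
  defines "e \<equiv> \<bar>q - \<beta> * \<phi> x\<bar>"
  shows "(prob_above k l x)\<^sup>2 + \<bar>prob_above k l x - a * \<beta> * (disc ^ j * \<phi> x)\<bar>
    \<le> (a * disc ^ j)\<^sup>2 * (2 * \<beta>\<^sup>2 + prob_above_const) * \<phi> x + (a * e + 2 * a\<^sup>2 * e\<^sup>2)"
proof -
  have a: "a > 0" by (simp add: a_def)
  have disc_pow: "disc ^ i = exp (- (r * real i))" for i by (simp add: exp_of_nat_mult[symmetric] mult.commute)
  have a_eq: "a = exp (r * real n - t0 * real_of_int k)"
  proof -
    have "- t0 * (real_of_int k - speed * real n) = (t0 * speed) * real n - t0 * real_of_int k" by algebra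
    then show ?thesis unfolding a_def t0_speed by simp
  qed
  have scale: "a * disc ^ j = exp (r * real l - t0 * real_of_int k)"
    unfolding a_eq disc_pow mult_exp_exp by (simp add: n algebra_simps)
  have A_eq: "mean_above k l x = a * disc ^ j * q"
  proof -
    have "exp (r * real l - t0 * real_of_int k) * (exp (t0 * real_of_int k) * disc ^ l) = 1"
      unfolding disc_pow mult_exp_exp by simp
    then have "mean_above k l x = exp (r * real l - t0 * real_of_int k) * (exp (t0 * real_of_int k) * disc ^ l) * mean_above k l x" by simp
    also have "\<dots> = a * disc ^ j * q" unfolding scale q_def by (simp only: mult.assoc)
    finally show ?thesis .
  qed
  have dj: "0 < disc ^ j" "disc ^ j \<le> 1" using disc by (auto intro: power_le_one)
  have q: "q \<ge> 0" by (simp add: q_def)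
  have up: "prob_above k l x \<le> a * disc ^ j * q" using prob_above_upper[of k l x] by (simp add: A_eq)
  have low: "a * disc ^ j * q - prob_above_const * (a * disc ^ j)\<^sup>2 * \<phi> x \<le> prob_above k l x"
  proof -
    have "exp (2 * (r * real l - t0 * real_of_int k)) = (a * disc ^ j)\<^sup>2"
      unfolding scale by (rule exp_double)
    then show ?thesis using prob_above_lower[of k l x] by (simp add: A_eq)
  qed
  have "\<bar>prob_above k l x - a * \<beta> * (disc ^ j * \<phi> x)\<bar> \<le> a * disc ^ j * e + prob_above_const * (a * disc ^ j)\<^sup>2 * \<phi> x"
  proof -
    have "\<bar>a * disc ^ j * q - a * \<beta> * (disc ^ j * \<phi> x)\<bar> = a * disc ^ j * e"
    proof -
      have "a * disc ^ j * q - a * \<beta> * (disc ^ j * \<phi> x) = a * disc ^ j * (q - \<beta> * \<phi> x)" by (simp add: algebra_simps)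
      then show ?thesis unfolding e_def using a dj by (simp add: abs_mult)
    qed
    moreover have "0 \<le> prob_above_const * (a * disc ^ j)\<^sup>2 * \<phi> x" using prob_above_const_nonneg by simp
    ultimately show ?thesis using up low by linarith
  qed
  also have "\<dots> \<le> a * e + prob_above_const * (a * disc ^ j)\<^sup>2 * \<phi> x"
  proof -
    have "a * disc ^ j * e \<le> a * 1 * e" using a dj by (intro mult_right_mono mult_left_mono) (auto simp: e_def)
    then show ?thesis by simp
  qed
  finally have lin: "\<bar>prob_above k l x - a * \<beta> * (disc ^ j * \<phi> x)\<bar> \<le> a * e + prob_above_const * (a * disc ^ j)\<^sup>2 * \<phi> x" .
  have "(prob_above k l x)\<^sup>2 \<le> (a * disc ^ j * q)\<^sup>2" using up prob_above_unit by (intro power_mono) auto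
  also have "\<dots> = (a * disc ^ j)\<^sup>2 * q\<^sup>2" by (rule power_mult_distrib)
  also have "\<dots> \<le> (a * disc ^ j)\<^sup>2 * (2 * \<beta>\<^sup>2 * \<phi> x + 2 * e\<^sup>2)"
  proof (intro mult_left_mono)
    have "q \<le> \<beta> * \<phi> x + e" by (simp add: e_def)
    then have "q\<^sup>2 \<le> (\<beta> * \<phi> x + e)\<^sup>2" using q by (intro power_mono)
    also have "\<dots> \<le> 2 * (\<beta> * \<phi> x)\<^sup>2 + 2 * e\<^sup>2"
      using sum_squares_bound[of "\<beta> * \<phi> x" e] by (simp add: power2_sum)
    also have "(\<beta> * \<phi> x)\<^sup>2 \<le> \<beta>\<^sup>2 * \<phi> x"
      unfolding power_mult_distrib by (intro mult_left_mono) (auto simp: power2_eq_square mult_left_le)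
    finally show "q\<^sup>2 \<le> 2 * \<beta>\<^sup>2 * \<phi> x + 2 * e\<^sup>2" by simp
  qed simp
  also have "\<dots> = (a * disc ^ j)\<^sup>2 * (2 * \<beta>\<^sup>2) * \<phi> x + (a * disc ^ j)\<^sup>2 * (2 * e\<^sup>2)" by (simp add: algebra_simps)
  also have "(a * disc ^ j)\<^sup>2 * (2 * e\<^sup>2) \<le> a\<^sup>2 * (2 * e\<^sup>2)"
    using a dj by (intro mult_right_mono power_mono) (auto simp: mult_left_le)
  finally have sq: "(prob_above k l x)\<^sup>2 \<le> (a * disc ^ j)\<^sup>2 * (2 * \<beta>\<^sup>2) * \<phi> x + a\<^sup>2 * (2 * e\<^sup>2)" by simp
  show ?thesis using add_mono[OF sq lin] by (simp add: algebra_simps)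
qed

definition approx_const :: real where "approx_const = 2 * \<beta>\<^sup>2 + prob_above_const"

lemma approx_const_nonneg: "approx_const \<ge> 0" using prob_above_const_nonneg by (simp add: approx_const_def)

lemma W_integral: "integrable TM (W j 0)" "(\<integral>t. W j 0 t \<partial>TM) = 1"
proof -
  show "integrable TM (W j 0)"
    by (rule integrableI_nonneg) (use nn_integral_W[of j 0] W_nonneg in auto)
  show "(\<integral>t. W j 0 t \<partial>TM) = 1"
    using nn_integral_W[of j 0] W_nonneg by (subst integral_eq_nn_integral) auto
qed

lemma unit_integrable:
  fixes f :: "tree \<Rightarrow> real"
  assumes "f \<in> borel_measurable TM" "\<And>t. 0 \<le> f t" "\<And>t. f t \<le> 1"
  shows "integrable TM f"
  by (rule integrable_const_bound[where B = 1]) (use assms in auto)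

text \<open>For a fixed generation \<open>j\<close> the list of positions is fixed by the tree, so the errors in the
  asymptotics of the means tend to 0 for each tree. What remains is bounded by a multiple of
  \<open>e\<^bsup>-rj\<^esup> W\<^sub>j\<close>, with expectation of order \<open>e\<^bsup>-rj\<^esup>\<close>.\<close>

lemma fixed_generation_error:
  fixes j :: nat
  assumes k: "\<And>n. \<bar>real_of_int (k n) - speed * real n\<bar> \<le> B"
  defines "a \<equiv> \<lambda>n. exp (- t0 * (real_of_int (k n) - speed * real n))"
  defines "D \<equiv> \<lambda>l t. \<bar>prod_list (map (\<lambda>x. 1 - prob_above (k (j + l)) l x) (gen j 0 t)) - exp (- (a (j + l) * \<beta> * W j 0 t))\<bar>"
  shows "\<exists>G. G \<longlonglongrightarrow> 0 \<and> (\<forall>l. (\<integral>t. D l t \<partial>TM) \<le> (exp (t0 * B))\<^sup>2 * disc ^ j * approx_const + G l)"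
proof -
  define Am where "Am = exp (t0 * B)"
  have a: "0 < a n" "a n \<le> Am" for n
  proof -
    have "t0 * (- (real_of_int (k n) - speed * real n)) \<le> t0 * B"
      using k[of n] t0_pos by (intro mult_left_mono) auto
    then show "a n \<le> Am" unfolding a_def Am_def by (simp add: algebra_simps)
  qed (simp add: a_def)
  define q where "q l x = exp (t0 * real_of_int (k (j + l))) * (disc ^ l * mean_above (k (j + l)) l x)" for l x
  define e where "e l x = \<bar>q l x - \<beta> * \<phi> x\<bar>" for l x
  have e_lim: "(\<lambda>l. e l x) \<longlonglongrightarrow> 0" for x
  proof -
    have "\<bar>real_of_int (k (j + l)) - speed * real l\<bar> \<le> B + speed * real j" for l
    proof -
      have "speed * real (j + l) = speed * real l + speed * real j" by (simp add: algebra_simps)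
      moreover have "speed * real j \<ge> 0" using speed_pos by simp
      ultimately show ?thesis using k[of "j + l"] by linarith
    qed
    from mean_above_limit[of "\<lambda>l. k (j + l)", OF this, of x]
    have "(\<lambda>l. q l x) \<longlonglongrightarrow> \<beta> * \<phi> x" by (simp add: q_def)
    from tendsto_rabs_zero[OF LIM_zero[OF this]] show ?thesis by (simp only: e_def)
  qed
  define Err where "Err l t = sum_list (map (\<lambda>x. Am * e l x + 2 * Am\<^sup>2 * (e l x)\<^sup>2) (gen j 0 t))" for l t
  have Err_lim: "(\<lambda>l. Err l t) \<longlonglongrightarrow> 0" for t
  proof -
    have "(\<lambda>l. sum_list (map (\<lambda>x. Am * e l x + 2 * Am\<^sup>2 * (e l x)\<^sup>2) g)) \<longlonglongrightarrow> 0" for g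
    proof (induction g)
      case (Cons x g)
      have "(\<lambda>l. (Am * e l x + 2 * Am\<^sup>2 * (e l x)\<^sup>2) + sum_list (map (\<lambda>x. Am * e l x + 2 * Am\<^sup>2 * (e l x)\<^sup>2) g))
        \<longlonglongrightarrow> (Am * 0 + 2 * Am\<^sup>2 * 0\<^sup>2) + 0"
        by (intro tendsto_intros e_lim Cons)
      then show ?case by simp
    qed simp
    then show ?thesis by (simp add: Err_def)
  qed
  define main where "main t = Am\<^sup>2 * disc ^ j * approx_const * W j 0 t" for t
  have main_nonneg: "0 \<le> main t" for t
    using approx_const_nonneg W_nonneg by (simp add: main_def)
  have D_le: "D l t \<le> main t + Err l t" for l t
  proof -
    let ?g = "gen j 0 t" and ?v = "prob_above (k (j + l)) l" and ?a = "a (j + l)"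
    have "D l t \<le> \<bar>prod_list (map (\<lambda>x. 1 - ?v x) ?g) - exp (- sum_list (map ?v ?g))\<bar>
        + \<bar>exp (- sum_list (map ?v ?g)) - exp (- (?a * \<beta> * W j 0 t))\<bar>"
      unfolding D_def by linarith
    also have "\<dots> \<le> sum_list (map (\<lambda>x. (?v x)\<^sup>2) ?g) + \<bar>sum_list (map ?v ?g) - ?a * \<beta> * W j 0 t\<bar>"
    proof (intro add_mono prod_list_exp_approx exp_minus_lipschitz)
      show "0 \<le> sum_list (map ?v ?g)" using prob_above_unit by (intro sum_list_nonneg) auto
      show "0 \<le> ?a * \<beta> * W j 0 t" using a[of "j + l"] beta_pos W_nonneg by simp
    qed (use prob_above_unit in auto)
    also have "\<bar>sum_list (map ?v ?g) - ?a * \<beta> * W j 0 t\<bar> \<le> sum_list (map (\<lambda>x. \<bar>?v x - ?a * \<beta> * (disc ^ j * \<phi> x)\<bar>) ?g)"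
    proof -
      have "?a * \<beta> * W j 0 t = sum_list (map (\<lambda>x. ?a * \<beta> * (disc ^ j * \<phi> x)) ?g)"
        by (simp add: W_def sum_list_const_mult)
      then have "sum_list (map ?v ?g) - ?a * \<beta> * W j 0 t = sum_list (map (\<lambda>x. ?v x - ?a * \<beta> * (disc ^ j * \<phi> x)) ?g)"
        by (simp add: sum_list_subtractf)
      then show ?thesis using sum_list_abs[of "map (\<lambda>x. ?v x - ?a * \<beta> * (disc ^ j * \<phi> x)) ?g"] by (simp add: o_def)
    qed
    also have "sum_list (map (\<lambda>x. (?v x)\<^sup>2) ?g) + sum_list (map (\<lambda>x. \<bar>?v x - ?a * \<beta> * (disc ^ j * \<phi> x)\<bar>) ?g)
      = sum_list (map (\<lambda>x. (?v x)\<^sup>2 + \<bar>?v x - ?a * \<beta> * (disc ^ j * \<phi> x)\<bar>) ?g)"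
      by (simp add: sum_list_addf)
    also have "\<dots> \<le> sum_list (map (\<lambda>x. Am\<^sup>2 * disc ^ j * approx_const * (disc ^ j * \<phi> x) + (Am * e l x + 2 * Am\<^sup>2 * (e l x)\<^sup>2)) ?g)"
    proof (rule sum_list_mono)
      fix x
      have "(?v x)\<^sup>2 + \<bar>?v x - ?a * \<beta> * (disc ^ j * \<phi> x)\<bar>
        \<le> (?a * disc ^ j)\<^sup>2 * approx_const * \<phi> x + (?a * e l x + 2 * ?a\<^sup>2 * (e l x)\<^sup>2)"
        unfolding approx_const_def e_def q_def a_def by (rule prob_above_approx[OF refl])
      also have "\<dots> \<le> (Am * disc ^ j)\<^sup>2 * approx_const * \<phi> x + (Am * e l x + 2 * Am\<^sup>2 * (e l x)\<^sup>2)"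
        using a[of "j + l"] approx_const_nonneg
        by (intro add_mono mult_right_mono mult_left_mono power_mono) (auto simp: e_def)
      also have "(Am * disc ^ j)\<^sup>2 * approx_const * \<phi> x = Am\<^sup>2 * disc ^ j * approx_const * (disc ^ j * \<phi> x)"
        by (simp add: power2_eq_square)
      finally show "(?v x)\<^sup>2 + \<bar>?v x - ?a * \<beta> * (disc ^ j * \<phi> x)\<bar>
        \<le> Am\<^sup>2 * disc ^ j * approx_const * (disc ^ j * \<phi> x) + (Am * e l x + 2 * Am\<^sup>2 * (e l x)\<^sup>2)" .
    qed
    also have "\<dots> = main t + Err l t"
      unfolding sum_list_addf main_def Err_def W_def by (simp only: sum_list_const_mult)
    finally show ?thesis by simp
  qed
  have P: "0 \<le> prod_list (map (\<lambda>x. 1 - prob_above i l x) g) \<and> prod_list (map (\<lambda>x. 1 - prob_above i l x) g) \<le> 1" for i l g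
    by (induction g) (use prob_above_unit in \<open>auto intro: mult_le_one\<close>)
  have D_unit: "0 \<le> D l t" "D l t \<le> 1" for l t
  proof -
    have "0 \<le> a (j + l) * \<beta> * W j 0 t" using a[of "j + l"] beta_pos W_nonneg by simp
    then have "exp (- (a (j + l) * \<beta> * W j 0 t)) \<le> 1" by simp
    moreover have "0 < exp (- (a (j + l) * \<beta> * W j 0 t))" by simp
    ultimately show "D l t \<le> 1" unfolding D_def using P[of "k (j + l)" l "gen j 0 t"] by linarith
  qed (simp add: D_def)
  have D_meas [measurable]: "D l \<in> borel_measurable TM" for l
    unfolding D_def by measurable
  have main_meas [measurable]: "main \<in> borel_measurable TM" unfolding main_def[abs_def] by measurable
  have main_int: "integrable TM main" "(\<integral>t. main t \<partial>TM) = Am\<^sup>2 * disc ^ j * approx_const"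
    unfolding main_def[abs_def] using W_integral[of j] by simp_all
  \<comment> \<open>the integrand is at most 1, as \<open>D\<close> is, and at most \<open>Err\<close>, which tends to 0 for each tree\<close>
  define G where "G l = (\<integral>t. max 0 (D l t - main t) \<partial>TM)" for l
  have "G \<longlonglongrightarrow> (\<integral>t. 0 \<partial>TM)"
    unfolding G_def
  proof (rule integral_dominated_convergence[where w = "\<lambda>_. 1"])
    show "AE t in TM. norm (max 0 (D l t - main t)) \<le> 1" for l
    proof (rule AE_I2)
      fix t show "norm (max 0 (D l t - main t)) \<le> 1" using D_unit[of l t] main_nonneg[of t] by simp
    qed
    show "AE t in TM. (\<lambda>l. max 0 (D l t - main t)) \<longlonglongrightarrow> 0"
    proof (rule AE_I2)
      fix t
      have Err_nonneg: "0 \<le> Err l t" for l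
        unfolding Err_def using a[of 0] by (intro sum_list_nonneg) (auto simp: e_def intro!: add_nonneg_nonneg mult_nonneg_nonneg)
      show "(\<lambda>l. max 0 (D l t - main t)) \<longlonglongrightarrow> 0"
      proof (rule tendsto_sandwich[OF _ _ tendsto_const Err_lim[of t]])
        show "\<forall>\<^sub>F l in sequentially. max 0 (D l t - main t) \<le> Err l t"
          using D_le[of _ t] Err_nonneg by (intro always_eventually) (auto simp: algebra_simps)
      qed simp
    qed
  qed auto
  then have "G \<longlonglongrightarrow> 0" by simp
  moreover have "(\<integral>t. D l t \<partial>TM) \<le> Am\<^sup>2 * disc ^ j * approx_const + G l" for l
  proof -
    have int1: "integrable TM (D l)" using D_unit by (intro unit_integrable) auto
    have int2: "integrable TM (\<lambda>t. max 0 (D l t - main t))"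
    proof (rule unit_integrable)
      show "max 0 (D l t - main t) \<le> 1" for t using D_unit[of l t] main_nonneg[of t] by simp
    qed auto
    have "(\<integral>t. D l t \<partial>TM) \<le> (\<integral>t. main t + max 0 (D l t - main t) \<partial>TM)"
      using int1 int2 main_int by (intro integral_mono) auto
    also have "\<dots> = Am\<^sup>2 * disc ^ j * approx_const + G l"
      unfolding G_def using int2 main_int by simp
    finally show ?thesis .
  qed
  ultimately show ?thesis unfolding Am_def by blast
qed

text \<open>First \<open>n\<close> tends to infinity for a fixed generation \<open>j\<close>, then \<open>j\<close> tends to infinity, where
  \<open>W\<^sub>j\<close> is replaced by its limit through convergence in \<open>L\<^sup>1\<close>.\<close>

lemma max_limit:
  assumes k: "\<And>n. \<bar>real_of_int (k n) - speed * real n\<bar> \<le> B"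
  shows "(\<lambda>n. prob {t. \<exists>c\<in>set (gen n 0 t). k n < c}
     - (\<integral>t. 1 - exp (- (exp (- t0 * (real_of_int (k n) - speed * real n)) * \<beta> * Winf t)) \<partial>TM)) \<longlonglongrightarrow> 0"
proof -
  define a where "a n = exp (- t0 * (real_of_int (k n) - speed * real n))" for n
  define L where "L n = (\<integral>t. exp (- (a n * \<beta> * Winf t)) \<partial>TM)" for n
  define Q where "Q n = prob {t. \<forall>c\<in>set (gen n 0 t). c \<le> k n}" for n
  define Am where "Am = exp (t0 * B)"
  have a: "0 < a n" "a n \<le> Am" for n
  proof -
    have "t0 * (- (real_of_int (k n) - speed * real n)) \<le> t0 * B"
      using k[of n] t0_pos by (intro mult_left_mono) auto
    then show "a n \<le> Am" unfolding a_def Am_def by (simp add: algebra_simps)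
  qed (simp add: a_def)
  have exp_int: "integrable TM (\<lambda>t. exp (- (a n * \<beta> * f t)))"
    if "f \<in> borel_measurable TM" "\<And>t. 0 \<le> f t" for n f
    using that a beta_pos by (intro unit_integrable) (auto intro!: mult_nonneg_nonneg simp: less_imp_le)
  have WL: "\<bar>(\<integral>t. exp (- (a n * \<beta> * W j 0 t)) \<partial>TM) - L n\<bar> \<le> Am * \<beta> * (L1_const * \<eta> ^ j / (1 - \<eta>))" for n j
  proof -
    have int: "integrable TM (\<lambda>t. \<bar>Winf t - W j 0 t\<bar>)"
    proof (rule integrableI_nonneg)
      show "(\<integral>\<^sup>+t. ennreal \<bar>Winf t - W j 0 t\<bar> \<partial>TM) < \<infinity>"
        by (rule le_less_trans[OF W_L1]) simp
    qed auto
    have "(\<integral>t. \<bar>Winf t - W j 0 t\<bar> \<partial>TM) \<le> L1_const * \<eta> ^ j / (1 - \<eta>)"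
    proof -
      have "ennreal (\<integral>t. \<bar>Winf t - W j 0 t\<bar> \<partial>TM) \<le> ennreal (L1_const * \<eta> ^ j / (1 - \<eta>))"
        using W_L1[of j] nn_integral_eq_integral[OF int] by simp
      then show ?thesis using L1_const eta by (subst (asm) ennreal_le_iff) auto
    qed
    moreover have "\<bar>(\<integral>t. exp (- (a n * \<beta> * W j 0 t)) \<partial>TM) - L n\<bar> \<le> (\<integral>t. a n * \<beta> * \<bar>Winf t - W j 0 t\<bar> \<partial>TM)"
    proof -
      have eq: "(\<integral>t. exp (- (a n * \<beta> * W j 0 t)) \<partial>TM) - L n = (\<integral>t. exp (- (a n * \<beta> * W j 0 t)) - exp (- (a n * \<beta> * Winf t)) \<partial>TM)"
        unfolding L_def by (rule Bochner_Integration.integral_diff[symmetric]) (auto intro!: exp_int simp: W_nonneg Winf_nonneg)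
      have "\<bar>(\<integral>t. exp (- (a n * \<beta> * W j 0 t)) \<partial>TM) - L n\<bar>
          \<le> (\<integral>t. \<bar>exp (- (a n * \<beta> * W j 0 t)) - exp (- (a n * \<beta> * Winf t))\<bar> \<partial>TM)"
        unfolding eq by (rule integral_abs_bound)
      also have "\<dots> \<le> (\<integral>t. a n * \<beta> * \<bar>Winf t - W j 0 t\<bar> \<partial>TM)"
      proof (rule integral_mono)
        show "integrable TM (\<lambda>t. \<bar>exp (- (a n * \<beta> * W j 0 t)) - exp (- (a n * \<beta> * Winf t))\<bar>)"
          by (intro integrable_abs Bochner_Integration.integrable_diff exp_int) (auto simp: W_nonneg Winf_nonneg)
        show "integrable TM (\<lambda>t. a n * \<beta> * \<bar>Winf t - W j 0 t\<bar>)" using int by simp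
        fix t
        have "\<bar>exp (- (a n * \<beta> * W j 0 t)) - exp (- (a n * \<beta> * Winf t))\<bar> \<le> \<bar>a n * \<beta> * W j 0 t - a n * \<beta> * Winf t\<bar>"
          using a[of n] beta_pos W_nonneg Winf_nonneg by (intro exp_minus_lipschitz) auto
        also have "\<dots> = a n * \<beta> * \<bar>Winf t - W j 0 t\<bar>"
        proof -
          have "a n * \<beta> * W j 0 t - a n * \<beta> * Winf t = - (a n * \<beta> * (Winf t - W j 0 t))" by (simp add: algebra_simps)
          then show ?thesis using a[of n] beta_pos by (simp add: abs_mult)
        qed
        finally show "\<bar>exp (- (a n * \<beta> * W j 0 t)) - exp (- (a n * \<beta> * Winf t))\<bar> \<le> a n * \<beta> * \<bar>Winf t - W j 0 t\<bar>" .
      qed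
      finally show ?thesis .
    qed
    moreover have "(\<integral>t. a n * \<beta> * \<bar>Winf t - W j 0 t\<bar> \<partial>TM) = a n * \<beta> * (\<integral>t. \<bar>Winf t - W j 0 t\<bar> \<partial>TM)" by simp
    moreover have "a n * \<beta> * (\<integral>t. \<bar>Winf t - W j 0 t\<bar> \<partial>TM) \<le> Am * \<beta> * (L1_const * \<eta> ^ j / (1 - \<eta>))"
      using a[of n] beta_pos \<open>(\<integral>t. \<bar>Winf t - W j 0 t\<bar> \<partial>TM) \<le> L1_const * \<eta> ^ j / (1 - \<eta>)\<close>
      by (intro mult_mono) auto
    ultimately show ?thesis by linarith
  qed
  have QL: "(\<lambda>n. Q n - L n) \<longlonglongrightarrow> 0"
  proof (rule LIMSEQ_I)
    fix \<epsilon> :: real assume "\<epsilon> > 0"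
    have "(\<lambda>j. Am\<^sup>2 * disc ^ j * approx_const + Am * \<beta> * (L1_const * \<eta> ^ j / (1 - \<eta>))) \<longlonglongrightarrow> Am\<^sup>2 * 0 * approx_const + Am * \<beta> * 0"
      using disc by (intro tendsto_intros LIMSEQ_realpow_zero eta_tendsto) auto
    then have "(\<lambda>j. Am\<^sup>2 * disc ^ j * approx_const + Am * \<beta> * (L1_const * \<eta> ^ j / (1 - \<eta>))) \<longlonglongrightarrow> 0" by simp
    from order_tendstoD(2)[OF this, of "\<epsilon> / 2"] \<open>\<epsilon> > 0\<close>
    obtain j where j: "Am\<^sup>2 * disc ^ j * approx_const + Am * \<beta> * (L1_const * \<eta> ^ j / (1 - \<eta>)) < \<epsilon> / 2"
      by (auto simp: eventually_sequentially)
    define D where "D l t = \<bar>prod_list (map (\<lambda>x. 1 - prob_above (k (j + l)) l x) (gen j 0 t)) - exp (- (a (j + l) * \<beta> * W j 0 t))\<bar>" for l t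
    obtain G where G: "G \<longlonglongrightarrow> 0" "\<And>l. (\<integral>t. D l t \<partial>TM) \<le> Am\<^sup>2 * disc ^ j * approx_const + G l"
      using fixed_generation_error[of k B j, OF k] unfolding D_def Am_def a_def by blast
    obtain l0 where l0: "\<And>l. l \<ge> l0 \<Longrightarrow> G l < \<epsilon> / 2"
      using order_tendstoD(2)[OF G(1), of "\<epsilon> / 2"] \<open>\<epsilon> > 0\<close> by (auto simp: eventually_sequentially)
    have "norm (Q n - L n - 0) < \<epsilon>" if n: "n \<ge> j + l0" for n
    proof -
      define l where "l = n - j"
      have nl: "n = j + l" "l \<ge> l0" using n by (auto simp: l_def)
      have P: "0 \<le> prod_list (map (\<lambda>x. 1 - prob_above i l x) g) \<and> prod_list (map (\<lambda>x. 1 - prob_above i l x) g) \<le> 1" for i g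
        by (induction g) (use prob_above_unit in \<open>auto intro: mult_le_one\<close>)
      have intP: "integrable TM (\<lambda>t. prod_list (map (\<lambda>x. 1 - prob_above (k n) l x) (gen j 0 t)))"
        using P by (intro unit_integrable) auto
      have intW: "integrable TM (\<lambda>t. exp (- (a n * \<beta> * W j 0 t)))" by (rule exp_int) (auto simp: W_nonneg)
      have eq: "Q n - (\<integral>t. exp (- (a n * \<beta> * W j 0 t)) \<partial>TM)
        = (\<integral>t. prod_list (map (\<lambda>x. 1 - prob_above (k n) l x) (gen j 0 t)) - exp (- (a n * \<beta> * W j 0 t)) \<partial>TM)"
        unfolding Q_def nl(1) max_le_prob_branching
        using intP intW unfolding nl(1) by (rule Bochner_Integration.integral_diff[symmetric])
      have "\<bar>Q n - (\<integral>t. exp (- (a n * \<beta> * W j 0 t)) \<partial>TM)\<bar> \<le> (\<integral>t. D l t \<partial>TM)"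
        unfolding eq unfolding D_def nl(1) by (rule integral_abs_bound)
      then have "\<bar>Q n - (\<integral>t. exp (- (a n * \<beta> * W j 0 t)) \<partial>TM)\<bar> \<le> Am\<^sup>2 * disc ^ j * approx_const + G l"
        using G(2)[of l] by linarith
      then show ?thesis using WL[of n j] l0[OF nl(2)] j unfolding real_norm_def by linarith
    qed
    then show "\<exists>n0. \<forall>n\<ge>n0. norm (Q n - L n - 0) < \<epsilon>" by blast
  qed
  have "prob {t. \<exists>c\<in>set (gen n 0 t). k n < c} - (\<integral>t. 1 - exp (- (a n * \<beta> * Winf t)) \<partial>TM) = - (Q n - L n)" for n
  proof -
    have "{t. \<exists>c\<in>set (gen n 0 t). k n < c} = space TM - {t. \<forall>c\<in>set (gen n 0 t). c \<le> k n}" by (auto simp: not_le)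
    then have "prob {t. \<exists>c\<in>set (gen n 0 t). k n < c} = 1 - Q n"
      unfolding Q_def using prob_compl[OF pred_gen[of "\<lambda>l. \<forall>c\<in>set l. c \<le> k n"]] by simp
    moreover have "(\<integral>t. 1 - exp (- (a n * \<beta> * Winf t)) \<partial>TM) = 1 - L n"
      unfolding L_def using exp_int[OF measurable_Winf Winf_nonneg, of n] by simp
    ultimately show ?thesis by simp
  qed
  then show ?thesis using tendsto_minus[OF QL] by (simp add: a_def)
qed

end

section \<open>Functionals of the underlying walk\<close>

definition walk_path :: "int \<Rightarrow> (nat \<Rightarrow> int) \<Rightarrow> nat \<Rightarrow> int" where
  "walk_path x \<xi> n = x + (\<Sum>i<n. \<xi> i)"

definition steps_measure :: "int pmf \<Rightarrow> (nat \<Rightarrow> int) measure" where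
  "steps_measure p = (\<Pi>\<^sub>M i\<in>(UNIV :: nat set). measure_pmf p)"

lemma path_case_nat: "walk_path x (case_nat z \<omega>) (Suc n) = walk_path (x + z) \<omega> n"
  by (simp add: walk_path_def sum.lessThan_Suc_shift del: sum.lessThan_Suc)

lemma path_0 [simp]: "walk_path x \<omega> 0 = x" by (simp add: walk_path_def)

locale walk_space = fixes p :: "int pmf"
begin

abbreviation "SM \<equiv> steps_measure p"

sublocale prob_space SM
  unfolding steps_measure_def by (rule prob_space_PiM) (rule measure_pmf.prob_space_axioms)

lemma space_SM [simp]: "space SM = UNIV" by (simp add: steps_measure_def space_PiM)

lemma emeasure_SM [simp]: "emeasure SM UNIV = 1" using emeasure_space_1 by simp

lemma measurable_step: "(\<lambda>\<xi>. \<xi> i) \<in> measurable SM (count_space UNIV)"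
proof -
  have "(\<lambda>\<xi>. \<xi> i) \<in> measurable SM (measure_pmf p)"
    unfolding steps_measure_def by (rule measurable_component_singleton) simp
  then show ?thesis by simp
qed

lemma measurable_path_at: "(\<lambda>\<xi>. walk_path x \<xi> n) \<in> measurable SM (count_space UNIV)"
proof (induction n)
  case 0
  then show ?case by simp
next
  case (Suc n)
  have "(\<lambda>\<xi>. walk_path x \<xi> n + \<xi> n) \<in> measurable SM (count_space UNIV)"
  proof (rule measurable_compose_countable[where f = "\<lambda>y \<xi>. y + \<xi> n", OF _ Suc])
    show "(\<lambda>\<xi>. y + \<xi> n) \<in> measurable SM (count_space UNIV)" for y
      by (rule measurable_compose[OF measurable_step]) simp
  qed
  then show ?case by (simp add: walk_path_def add.assoc)
qed

lemma measurable_path: "walk_path x \<in> measurable SM (\<Pi>\<^sub>M i\<in>(UNIV :: nat set). count_space UNIV)"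
proof -
  have "(\<lambda>\<xi> n. walk_path x \<xi> n) \<in> measurable SM (\<Pi>\<^sub>M i\<in>(UNIV :: nat set). count_space UNIV)"
    by (rule measurable_PiM_single') (auto simp: measurable_path_at)
  then show ?thesis by simp
qed

lemma walk_law_eq: "walk_law p x = distr SM (\<Pi>\<^sub>M i\<in>(UNIV :: nat set). count_space UNIV) (walk_path x)"
  unfolding walk_law_def steps_measure_def walk_path_def[abs_def] ..

lemma pred_path: "{\<xi>. Q (walk_path x \<xi> n)} \<in> sets SM"
  using measurable_sets[OF measurable_path_at, of "{y. Q y}" x n] by (simp add: vimage_def)

lemma nn_integral_first_step:
  assumes "F \<in> borel_measurable SM"
  shows "(\<integral>\<^sup>+\<xi>. F \<xi> \<partial>SM) = (\<integral>\<^sup>+z. \<integral>\<^sup>+\<omega>. F (case_nat z \<omega>) \<partial>SM \<partial>measure_pmf p)"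
proof -
  interpret S: sequence_space "measure_pmf p" by standard
  have iter: "distr (measure_pmf p \<Otimes>\<^sub>M SM) SM (\<lambda>(s, \<omega>). case_nat s \<omega>) = SM"
    unfolding steps_measure_def by (rule S.PiM_iter)
  have m: "(\<lambda>(s, \<omega>). case_nat s \<omega>) \<in> measurable (measure_pmf p \<Otimes>\<^sub>M SM) SM"
    unfolding steps_measure_def by measurable
  have "(\<integral>\<^sup>+\<xi>. F \<xi> \<partial>SM) = (\<integral>\<^sup>+\<xi>. F \<xi> \<partial>distr (measure_pmf p \<Otimes>\<^sub>M SM) SM (\<lambda>(s, \<omega>). case_nat s \<omega>))"
    by (simp only: iter)
  also have "\<dots> = (\<integral>\<^sup>+y. F (case y of (s, \<omega>) \<Rightarrow> case_nat s \<omega>) \<partial>(measure_pmf p \<Otimes>\<^sub>M SM))"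
    by (rule nn_integral_distr[OF m]) (use assms in simp)
  also have "\<dots> = (\<integral>\<^sup>+z. \<integral>\<^sup>+\<omega>. F (case (z, \<omega>) of (s, \<omega>) \<Rightarrow> case_nat s \<omega>) \<partial>SM \<partial>measure_pmf p)"
    by (rule nn_integral_fst[symmetric]) (rule measurable_compose[OF m assms])
  finally show ?thesis by simp
qed

definition hits :: "int \<Rightarrow> nat \<Rightarrow> (nat \<Rightarrow> int) set" where
  "hits x n = {\<xi>. walk_path x \<xi> n = 0 \<and> (\<forall>j<n. walk_path x \<xi> j \<noteq> 0)}"

definition returns :: "nat \<Rightarrow> (nat \<Rightarrow> int) set" where
  "returns n = {\<xi>. walk_path 0 \<xi> (Suc n) = 0 \<and> (\<forall>j<n. walk_path 0 \<xi> (Suc j) \<noteq> 0)}"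

lemma hits_measurable: "hits x n \<in> sets SM"
proof -
  have "hits x n = {\<xi>. walk_path x \<xi> n = 0} \<inter> (\<Inter>j. {\<xi>. j < n \<longrightarrow> walk_path x \<xi> j \<noteq> 0})"
    by (auto simp: hits_def)
  also have "\<dots> \<in> sets SM"
    using pred_path[of "\<lambda>y. j < n \<longrightarrow> y \<noteq> 0" x j for j] pred_path[of "\<lambda>y. y = 0" x n]
    by (intro sets.Int sets.countable_INT') auto
  finally show ?thesis .
qed

lemma returns_measurable: "returns n \<in> sets SM"
proof -
  have "returns n = {\<xi>. walk_path 0 \<xi> (Suc n) = 0} \<inter> (\<Inter>j. {\<xi>. j < n \<longrightarrow> walk_path 0 \<xi> (Suc j) \<noteq> 0})"
    by (auto simp: returns_def)
  also have "\<dots> \<in> sets SM"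
    using pred_path[of "\<lambda>y. j < n \<longrightarrow> y \<noteq> 0" 0 "Suc j" for j] pred_path[of "\<lambda>y. y = 0" 0 "Suc n"]
    by (intro sets.Int sets.countable_INT') auto
  finally show ?thesis .
qed

lemma hits_case_nat: "x \<noteq> 0 \<Longrightarrow> case_nat z \<omega> \<in> hits x (Suc n) \<longleftrightarrow> \<omega> \<in> hits (x + z) n"
proof -
  assume "x \<noteq> 0"
  have "(\<forall>j<Suc n. Q j) \<longleftrightarrow> Q 0 \<and> (\<forall>j<n. Q (Suc j))" for Q
    by (metis Suc_less_eq less_Suc_eq_0_disj zero_less_Suc)
  then show ?thesis using \<open>x \<noteq> 0\<close> by (simp add: hits_def path_case_nat)
qed

lemma emeasure_hits: "emeasure SM (hits x n) = ennreal (hit p n x)"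
proof (induction n arbitrary: x)
  case 0
  then show ?case by (simp add: hits_def)
next
  case (Suc n)
  show ?case
  proof (cases "x = 0")
    case True
    then have "walk_path x \<xi> 0 = 0" for \<xi> by simp
    then have "hits x (Suc n) = {}" unfolding hits_def by blast
    then show ?thesis using True by simp
  next
    case False
    have "emeasure SM (hits x (Suc n)) = (\<integral>\<^sup>+\<xi>. indicator (hits x (Suc n)) \<xi> \<partial>SM)"
      by (simp add: hits_measurable)
    also have "\<dots> = (\<integral>\<^sup>+z. \<integral>\<^sup>+\<omega>. indicator (hits x (Suc n)) (case_nat z \<omega>) \<partial>SM \<partial>measure_pmf p)"
      by (rule nn_integral_first_step[OF borel_measurable_indicator[OF hits_measurable]])
    also have "\<dots> = (\<integral>\<^sup>+z. \<integral>\<^sup>+\<omega>. indicator (hits (x + z) n) \<omega> \<partial>SM \<partial>measure_pmf p)"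
      by (intro nn_integral_cong) (simp add: indicator_def hits_case_nat[OF False])
    also have "\<dots> = (\<integral>\<^sup>+z. ennreal (hit p n (x + z)) \<partial>measure_pmf p)"
      by (simp add: hits_measurable Suc)
    also have "\<dots> = ennreal (walk_mean p (hit p n) x)" by (rule nn_integral_walk_mean) auto
    finally show ?thesis using False by simp
  qed
qed

lemma emeasure_returns: "emeasure SM (returns n) = ennreal (walk_mean p (hit p n) 0)"
proof -
  have "emeasure SM (returns n) = (\<integral>\<^sup>+\<xi>. indicator (returns n) \<xi> \<partial>SM)"
    by (simp add: returns_measurable)
  also have "\<dots> = (\<integral>\<^sup>+z. \<integral>\<^sup>+\<omega>. indicator (returns n) (case_nat z \<omega>) \<partial>SM \<partial>measure_pmf p)"
    by (rule nn_integral_first_step[OF borel_measurable_indicator[OF returns_measurable]])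
  also have "\<dots> = (\<integral>\<^sup>+z. \<integral>\<^sup>+\<omega>. indicator (hits (0 + z) n) \<omega> \<partial>SM \<partial>measure_pmf p)"
    by (intro nn_integral_cong) (simp add: indicator_def returns_def hits_def path_case_nat)
  also have "\<dots> = (\<integral>\<^sup>+z. ennreal (hit p n (0 + z)) \<partial>measure_pmf p)"
    by (simp add: hits_measurable emeasure_hits)
  also have "\<dots> = ennreal (walk_mean p (hit p n) 0)" by (rule nn_integral_walk_mean) auto
  finally show ?thesis .
qed

lemma return_time_enat: "return_time (walk_path 0 \<xi>) = enat (Suc n) \<longleftrightarrow> \<xi> \<in> returns n"
proof -
  let ?S = "walk_path 0 \<xi>"
  show ?thesis
  proof
    assume eq: "return_time ?S = enat (Suc n)"
    have "{n. n \<ge> 1 \<and> ?S n = 0} \<noteq> {}"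
    proof
      assume empty: "{n. n \<ge> 1 \<and> ?S n = 0} = {}"
      have "return_time ?S = top" unfolding return_time_def empty by simp
      then show False using eq by (simp add: top_enat_def)
    qed
    then have "return_time ?S \<in> enat ` {n. n \<ge> 1 \<and> ?S n = 0}"
      unfolding return_time_def Inf_enat_def by (simp only: image_is_empty if_False) (rule LeastI_ex, blast)
    then have "?S (Suc n) = 0" using eq by auto
    moreover have "?S (Suc j) \<noteq> 0" if "j < n" for j
    proof
      assume "?S (Suc j) = 0"
      then have "return_time ?S \<le> enat (Suc j)" unfolding return_time_def by (intro INF_lower) auto
      then show False using eq that by simp
    qed
    ultimately show "\<xi> \<in> returns n" by (simp add: returns_def)
  next
    assume r: "\<xi> \<in> returns n"
    show "return_time ?S = enat (Suc n)"
      unfolding return_time_def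
    proof (rule antisym)
      show "(INF n\<in>{n. n \<ge> 1 \<and> ?S n = 0}. enat n) \<le> enat (Suc n)"
        using r by (intro INF_lower) (auto simp: returns_def)
      show "enat (Suc n) \<le> (INF n\<in>{n. n \<ge> 1 \<and> ?S n = 0}. enat n)"
      proof (rule INF_greatest)
        fix i assume i: "i \<in> {n. n \<ge> 1 \<and> ?S n = 0}"
        then obtain j where j: "i = Suc j" by (cases i) auto
        then have "\<not> j < n" using r i by (auto simp: returns_def)
        then show "enat (Suc n) \<le> enat i" using j by simp
      qed
    qed
  qed
qed

lemma return_time_cases:
  obtains n where "return_time S = enat (Suc n)" | "return_time S = \<infinity>"
proof (cases "return_time S")
  case (enat i)
  have "return_time S \<ge> enat 1" unfolding return_time_def by (intro INF_greatest) auto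
  then obtain n where "i = Suc n" using enat by (cases i) auto
  then show ?thesis using that(1) enat by simp
qed (use that in simp)

text \<open>At most one term is different from 0; for \<open>s = 0\<close> the identity describes the event of a
  return.\<close>

lemma discount_sums: "ennreal (discount s (return_time (walk_path 0 \<xi>))) = (\<Sum>n. ennreal (exp (- s) ^ Suc n) * indicator (returns n) \<xi>)"
proof (cases rule: return_time_cases[of "walk_path 0 \<xi>"])
  case (1 n)
  have "indicator (returns i) \<xi> = (if i = n then 1 else 0 :: ennreal)" for i
    using 1 return_time_enat[of \<xi> i] by (auto simp: indicator_def)
  then have "(\<Sum>i. ennreal (exp (- s) ^ Suc i) * indicator (returns i) \<xi>) = (\<Sum>i\<in>{n}. ennreal (exp (- s) ^ Suc i) * indicator (returns i) \<xi>)"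
    by (intro suminf_finite) auto
  also have "\<dots> = ennreal (exp (- s) ^ Suc n)" using 1 return_time_enat[of \<xi> n] by simp
  also have "exp (- s) ^ Suc n = exp (- s * real (Suc n))" by (subst exp_of_nat2_mult) simp
  finally show ?thesis using 1 by simp
next
  case 2
  then have "indicator (returns i) \<xi> = (0 :: ennreal)" for i
    using return_time_enat[of \<xi> i] by (auto simp: indicator_def)
  then show ?thesis using 2 by simp
qed

lemma nn_integral_discount:
  assumes "s \<ge> 0"
  shows "(\<integral>\<^sup>+\<xi>. ennreal (discount s (return_time (walk_path 0 \<xi>))) \<partial>SM) = ennreal (exp (- s) * walk_mean p (hit_gf p (exp (- s))) 0)"
proof -
  have d: "0 \<le> exp (- s)" "exp (- s) \<le> 1" using assms by auto
  have "(\<integral>\<^sup>+\<xi>. ennreal (discount s (return_time (walk_path 0 \<xi>))) \<partial>SM) = (\<Sum>n. \<integral>\<^sup>+\<xi>. ennreal (exp (- s) ^ Suc n) * indicator (returns n) \<xi> \<partial>SM)"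
    unfolding discount_sums
    by (rule nn_integral_suminf) (use returns_measurable in measurable)
  also have "\<dots> = (\<Sum>n. ennreal (exp (- s) * (exp (- s) ^ n * walk_mean p (hit p n) 0)))"
  proof (intro suminf_cong)
    fix n
    have "(\<integral>\<^sup>+\<xi>. ennreal (exp (- s) ^ Suc n) * indicator (returns n) \<xi> \<partial>SM) = ennreal (exp (- s) ^ Suc n) * ennreal (walk_mean p (hit p n) 0)"
      unfolding emeasure_returns[symmetric] by (rule nn_integral_cmult_indicator[OF returns_measurable])
    also have "\<dots> = ennreal (exp (- s) ^ Suc n * walk_mean p (hit p n) 0)"
      by (rule ennreal_mult[symmetric]) (auto intro: walk_mean_nonneg)
    finally show "(\<integral>\<^sup>+\<xi>. ennreal (exp (- s) ^ Suc n) * indicator (returns n) \<xi> \<partial>SM) = ennreal (exp (- s) * (exp (- s) ^ n * walk_mean p (hit p n) 0))"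
      by (simp only: power_Suc mult.assoc)
  qed
  also have "\<dots> = ennreal (exp (- s) * walk_mean p (hit_gf p (exp (- s))) 0)"
    by (rule suminf_ennreal_eq) (auto intro!: sums_mult walk_mean_hit_gf_sums d mult_nonneg_nonneg walk_mean_nonneg)
  finally show ?thesis .
qed

lemma discount_measurable: "(\<lambda>\<xi>. discount s (return_time (walk_path 0 \<xi>))) \<in> borel_measurable SM"
proof -
  have nonneg: "0 \<le> discount s e" for e by (cases e) auto
  have "(\<lambda>\<xi>. enn2real (\<Sum>n. ennreal (exp (- s) ^ Suc n) * indicator (returns n) \<xi>)) \<in> borel_measurable SM"
    using returns_measurable by measurable
  then show ?thesis unfolding discount_sums[symmetric] by (simp add: nonneg)
qed

lemma integral_discount:
  assumes "s \<ge> 0"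
  shows "(\<integral>\<xi>. discount s (return_time (walk_path 0 \<xi>)) \<partial>SM) = exp (- s) * walk_mean p (hit_gf p (exp (- s))) 0"
proof -
  have nonneg: "0 \<le> discount s e" for e by (cases e) auto
  have "0 \<le> walk_mean p (hit_gf p (exp (- s))) 0" using assms by (intro walk_mean_nonneg hit_gf_nonneg) auto
  then show ?thesis
    using discount_measurable nonneg by (subst integral_eq_nn_integral) (auto simp: nn_integral_discount assms)
qed

end

context
  fixes p :: "int pmf"
begin

interpretation walk_space p .

text \<open>The return time ignores \<open>S 0\<close>, so \<open>S 0\<close> may be changed to 0; then \<open>S\<close> is the path with
  steps \<open>S (i + 1) - S i\<close>, and the expansion of the discount factor applies.\<close>

lemma discount_path_measurable:
  "(\<lambda>S. discount s (return_time S)) \<in> borel_measurable (\<Pi>\<^sub>M i\<in>(UNIV :: nat set). count_space (UNIV :: int set))"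
proof -
  let ?N = "\<Pi>\<^sub>M i\<in>(UNIV :: nat set). count_space (UNIV :: int set)"
  have comp: "{S \<in> space ?N. Q (S n)} \<in> sets ?N" for Q n
  proof -
    have "(\<lambda>S. S n) \<in> measurable ?N (count_space UNIV)" by (rule measurable_component_singleton) simp
    from measurable_sets[OF this, of "{y. Q y}"] show ?thesis by (simp add: vimage_def Int_def conj_commute)
  qed
  have sp: "space ?N = UNIV" by (simp add: space_PiM)
  define R where "R n = {S :: nat \<Rightarrow> int. S (Suc n) = 0 \<and> (\<forall>j<n. S (Suc j) \<noteq> 0)}" for n
  have R: "R n \<in> sets ?N" for n
  proof -
    have "R n = {S. S (Suc n) = 0} \<inter> (\<Inter>j. {S. j < n \<longrightarrow> S (Suc j) \<noteq> 0})" by (auto simp: R_def)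
    also have "\<dots> \<in> sets ?N"
      using comp[of "\<lambda>y. j < n \<longrightarrow> y \<noteq> 0" "Suc j" for j] comp[of "\<lambda>y. y = 0" "Suc n"] unfolding sp
      by (intro sets.Int sets.countable_INT') auto
    finally show ?thesis .
  qed
  have time: "return_time S = enat (Suc n) \<longleftrightarrow> S \<in> R n" if "S 0 = 0" for S n
  proof -
    have "S = walk_path 0 (\<lambda>i. S (Suc i) - S i)"
      by (rule ext) (simp add: walk_path_def sum_lessThan_telescope that)
    then show ?thesis using return_time_enat[of "\<lambda>i. S (Suc i) - S i" n] by (simp add: R_def returns_def)
  qed
  have eq: "discount s (return_time S) = enn2real (\<Sum>n. ennreal (exp (- s) ^ Suc n) * indicator (R n) S)" for S
  proof -
    \<comment> \<open>a path that starts at the origin and has the same return time\<close>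
    define S' where "S' = S(0 := 0)"
    have "{n. n \<ge> 1 \<and> S n = 0} = {n. n \<ge> 1 \<and> S' n = 0}" by (auto simp: S'_def)
    then have rt: "return_time S = return_time S'" unfolding return_time_def by simp
    have ind: "indicator (R n) S = indicator (R n) S'" for n by (auto simp: indicator_def R_def S'_def)
    have "S' = walk_path 0 (\<lambda>i. S' (Suc i) - S' i)"
      by (rule ext) (simp add: walk_path_def sum_lessThan_telescope, simp add: S'_def)
    then have "ennreal (discount s (return_time S')) = (\<Sum>n. ennreal (exp (- s) ^ Suc n) * indicator (R n) S')"
      using discount_sums[of s "\<lambda>i. S' (Suc i) - S' i"] by (simp add: R_def returns_def indicator_def)
    moreover have "0 \<le> discount s e" for e by (cases e) auto
    ultimately show ?thesis unfolding rt ind by (metis enn2real_ennreal)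
  qed
  show ?thesis unfolding eq using R by measurable
qed

lemma return_laplace_eq: "r \<ge> 0 \<Longrightarrow> return_laplace p r = exp (- r) * walk_mean p (hit_gf p (exp (- r))) 0"
  unfolding return_laplace_def walk_law_eq
  by (subst integral_distr[OF measurable_path discount_path_measurable]) (rule integral_discount)

lemma measure_walk_law:
  assumes "{\<xi>. walk_path x \<xi> \<in> A} = B" "A \<in> sets (\<Pi>\<^sub>M i\<in>(UNIV :: nat set). count_space (UNIV :: int set))"
  shows "measure (walk_law p x) A = measure SM B"
  unfolding walk_law_eq using assms by (subst measure_distr[OF measurable_path]) (auto simp: vimage_def)

lemma return_time_set:
  "{S. return_time S = e} \<in> sets (\<Pi>\<^sub>M i\<in>(UNIV :: nat set). count_space (UNIV :: int set))"
proof -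
  let ?N = "\<Pi>\<^sub>M i\<in>(UNIV :: nat set). count_space (UNIV :: int set)"
  have inj: "discount 1 a = discount 1 c \<longleftrightarrow> a = c" for a c by (cases a; cases c) auto
  have "(\<lambda>S. discount 1 (return_time S)) -` {discount 1 e} \<inter> space ?N \<in> sets ?N"
    by (rule measurable_sets[OF discount_path_measurable]) simp
  then show ?thesis by (simp add: vimage_def inj space_PiM)
qed

lemma return_prob: "measure (walk_law p 0) {S. return_time S = enat (Suc n)} = walk_mean p (hit p n) 0"
proof -
  have "measure (walk_law p 0) {S. return_time S = enat (Suc n)} = measure SM (returns n)"
    by (rule measure_walk_law[OF _ return_time_set]) (simp add: return_time_enat)
  then show ?thesis using emeasure_returns[of n] by (simp add: measure_def walk_mean_nonneg)
qed

lemma q_esc_eq: "1 - q_esc p = walk_mean p (hit_gf p 1) 0"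
proof -
  let ?E = "{\<xi>. return_time (walk_path 0 \<xi>) = \<infinity>}"
  have q: "q_esc p = measure SM ?E"
    unfolding q_esc_def by (rule measure_walk_law[OF _ return_time_set]) simp
  have "?E \<in> sets SM"
    using measurable_sets[OF measurable_path return_time_set[of "\<infinity>"], of 0] by (simp add: vimage_def)
  have d0: "discount 0 e = 1 - of_bool (e = \<infinity>)" for e by (cases e) auto
  have "walk_mean p (hit_gf p 1) 0 = (\<integral>\<xi>. 1 - indicator ?E \<xi> \<partial>SM)"
    using integral_discount[of 0] unfolding d0 by (simp add: indicator_def of_bool_def if_distrib cong: if_cong)
  also have "\<dots> = 1 - measure SM ?E"
    using \<open>?E \<in> sets SM\<close> prob_space by (subst Bochner_Integration.integral_diff) (auto simp: emeasure_eq_measure)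
  finally show ?thesis by (simp add: q)
qed

lemma aperiodic_eq: "aperiodic_walk p \<Longrightarrow> Gcd {Suc n | n. walk_mean p (hit p n) 0 > 0} = 1"
proof -
  have "{n :: nat. n \<ge> 1 \<and> measure (walk_law p 0) {S. return_time S = enat n} > 0} = {Suc n | n. walk_mean p (hit p n) 0 > 0}"
  proof (rule set_eqI)
    fix i :: nat
    show "i \<in> {n :: nat. n \<ge> 1 \<and> measure (walk_law p 0) {S. return_time S = enat n} > 0} \<longleftrightarrow> i \<in> {Suc n | n. walk_mean p (hit p n) 0 > 0}"
      by (cases i) (auto simp: return_prob)
  qed
  then show "aperiodic_walk p \<Longrightarrow> Gcd {Suc n | n. walk_mean p (hit p n) 0 > 0} = 1"
    by (simp add: aperiodic_walk_def)
qed

text \<open>An event of positive probability contains an outcome all of whose steps are in the support.\<close>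

lemma irreducible_span: "irreducible_walk p \<Longrightarrow> additive_span (set_pmf p) = UNIV"
proof -
  assume irr: "irreducible_walk p"
  have "y \<in> additive_span (set_pmf p)" for y
  proof -
    obtain n where n: "measure (walk_law p 0) {S. S n = y} > 0"
      using irr by (auto simp: irreducible_walk_def)
    have sets: "{S. S n = y} \<in> sets (\<Pi>\<^sub>M i\<in>(UNIV :: nat set). count_space (UNIV :: int set))"
    proof -
      have "(\<lambda>S. S n) \<in> measurable (\<Pi>\<^sub>M i\<in>(UNIV :: nat set). count_space (UNIV :: int set)) (count_space UNIV)"
        by (rule measurable_component_singleton) simp
      from measurable_sets[OF this, of "{y}"] show ?thesis by (simp add: vimage_def space_PiM)
    qed
    have pos: "measure SM {\<xi>. walk_path 0 \<xi> n = y} > 0"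
      using n measure_walk_law[OF _ sets, of 0 "{\<xi>. walk_path 0 \<xi> n = y}"] by simp
    have "AE \<xi> in SM. \<forall>i. \<xi> i \<in> set_pmf p"
    proof (subst AE_all_countable, intro allI)
      fix i show "AE \<xi> in SM. \<xi> i \<in> set_pmf p"
        unfolding steps_measure_def
        by (rule AE_PiM_component) (auto simp: measure_pmf.prob_space_axioms AE_measure_pmf)
    qed
    have "\<exists>\<xi>. walk_path 0 \<xi> n = y \<and> (\<forall>i. \<xi> i \<in> set_pmf p)"
    proof (rule ccontr)
      assume none: "\<not> ?thesis"
      from \<open>AE \<xi> in SM. \<forall>i. \<xi> i \<in> set_pmf p\<close> have "AE \<xi> in SM. \<xi> \<notin> {\<xi>. walk_path 0 \<xi> n = y}"
        by eventually_elim (use none in auto)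
      then have "measure SM {\<xi>. walk_path 0 \<xi> n = y} = 0"
        using pred_path[of "\<lambda>z. z = y" 0 n] by (subst prob_eq_0) auto
      then show False using pos by simp
    qed
    then obtain \<xi> where \<xi>: "walk_path 0 \<xi> n = y" "\<And>i. \<xi> i \<in> set_pmf p" by blast
    have "walk_path 0 \<xi> i \<in> additive_span (set_pmf p)" for i
    proof (induction i)
      case (Suc i)
      then show ?case using additive_span.add[OF Suc \<xi>(2)[of i]] by (simp add: walk_path_def)
    qed (simp add: additive_span.zero)
    then show ?thesis using \<xi>(1) by blast
  qed
  then show "additive_span (set_pmf p) = UNIV" by blast
qed

lemma psi_finite:
  assumes "psi p t < \<infinity>"
  shows "integrable (measure_pmf p) (\<lambda>z. exp (t * real_of_int z))"
    and "psi p t = ereal (ln (\<integral>z. exp (t * real_of_int z) \<partial>measure_pmf p))"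
proof -
  have L: "(\<integral>\<^sup>+ S. ennreal (exp (t * real_of_int (S 1))) \<partial>walk_law p 0) = (\<integral>\<^sup>+z. ennreal (exp (t * real_of_int z)) \<partial>measure_pmf p)"
  proof -
    have "(\<integral>\<^sup>+ S. ennreal (exp (t * real_of_int (S 1))) \<partial>walk_law p 0) = (\<integral>\<^sup>+\<xi>. ennreal (exp (t * real_of_int (walk_path 0 \<xi> 1))) \<partial>SM)"
      unfolding walk_law_eq
    proof (rule nn_integral_distr[OF measurable_path])
      have "(\<lambda>S. S 1) \<in> measurable (\<Pi>\<^sub>M i\<in>(UNIV :: nat set). count_space (UNIV :: int set)) (count_space UNIV)"
        by (rule measurable_component_singleton) simp
      from measurable_compose[OF this, of "\<lambda>z. ennreal (exp (t * real_of_int z))" borel]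
      show "(\<lambda>S. ennreal (exp (t * real_of_int (S 1)))) \<in> borel_measurable (distr SM (\<Pi>\<^sub>M i\<in>(UNIV :: nat set). count_space UNIV) (walk_path 0))"
        by simp
    qed
    also have "\<dots> = (\<integral>\<^sup>+z. \<integral>\<^sup>+\<omega>. ennreal (exp (t * real_of_int (walk_path 0 (case_nat z \<omega>) 1))) \<partial>SM \<partial>measure_pmf p)"
    proof (rule nn_integral_first_step)
      show "(\<lambda>\<xi>. ennreal (exp (t * real_of_int (walk_path 0 \<xi> 1)))) \<in> borel_measurable SM"
        by (rule measurable_compose[OF measurable_path_at]) simp
    qed
    also have "\<dots> = (\<integral>\<^sup>+z. ennreal (exp (t * real_of_int z)) \<partial>measure_pmf p)" by (simp add: walk_path_def)
    finally show ?thesis .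
  qed
  have fin: "(\<integral>\<^sup>+z. ennreal (exp (t * real_of_int z)) \<partial>measure_pmf p) \<noteq> \<infinity>"
    using assms unfolding psi_def L Let_def by (auto split: if_splits)
  show int: "integrable (measure_pmf p) (\<lambda>z. exp (t * real_of_int z))"
    by (rule integrableI_nonneg) (use fin in \<open>auto simp: less_top\<close>)
  show "psi p t = ereal (ln (\<integral>z. exp (t * real_of_int z) \<partial>measure_pmf p))"
    unfolding psi_def L Let_def using fin by (subst integral_eq_nn_integral) auto
qed

end

section \<open>From the labelled particles to the limit theorem\<close>

lemma position_snoc: "position \<xi> (u @ [i]) = \<xi> [i] + position (\<lambda>v. \<xi> (v @ [i])) u"
  by (induction u) auto

primrec alive_from :: "int \<Rightarrow> (nat list \<Rightarrow> nat) \<Rightarrow> (nat list \<Rightarrow> int) \<Rightarrow> nat list \<Rightarrow> bool" where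
  "alive_from x N \<xi> [] = True"
| "alive_from x N \<xi> (i # u) \<longleftrightarrow> alive_from x N \<xi> u \<and> (if x + position \<xi> u = 0 then i < N u else i = 0)"

lemma alive_eq_alive_from: "alive N \<xi> u \<longleftrightarrow> alive_from 0 N \<xi> u"
  by (induction u) auto

lemma alive_from_snoc:
  "alive_from x N \<xi> (u @ [i]) \<longleftrightarrow>
     (if x = 0 then i < N [] else i = 0) \<and> alive_from (x + \<xi> [i]) (\<lambda>v. N (v @ [i])) (\<lambda>v. \<xi> (v @ [i])) u"
  by (induction u) (auto simp: position_snoc add.assoc)

lemma set_gen:
  "set (gen n x t) = {x + position (\<lambda>u. snd (t u)) u | u.
     length u = n \<and> alive_from x (\<lambda>u. fst (t u)) (\<lambda>u. snd (t u)) u}"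
proof (induction n arbitrary: x t)
  case 0
  then show ?case by auto
next
  case (Suc n)
  let ?N = "\<lambda>u. fst (t u)" and ?X = "\<lambda>u. snd (t u)"
  have "c \<in> set (gen (Suc n) x t) \<longleftrightarrow>
      (\<exists>u. length u = Suc n \<and> c = x + position ?X u \<and> alive_from x ?N ?X u)" for c
  proof -
    have "c \<in> set (gen (Suc n) x t) \<longleftrightarrow>
        (\<exists>i v. length v = n \<and> c = x + position ?X (v @ [i]) \<and> alive_from x ?N ?X (v @ [i]))"
      unfolding tree_space.set_gen_Suc child_def Suc position_snoc alive_from_snoc
      by (auto simp: kids_def sub_def add.assoc)
    then show ?thesis by (auto simp: length_Suc_conv_rev)
  qed
  then show ?case by blast
qed

text \<open>The deficit \<open>F \<theta> = 1 - E[e\<^bsup>-\<theta>X\<^esup>]\<close> of a Laplace transform is continuous, and on bounded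
  intervals it increases at a rate bounded below: \<open>F(\<theta> + h) - F \<theta>\<close> is at least
  \<open>E[e\<^bsup>-TX\<^esup> (1 - e\<^bsup>-hX\<^esup>)]\<close> for \<open>\<theta> \<le> T\<close>.\<close>

lemma (in prob_space) laplace_deficit:
  fixes X :: "'a \<Rightarrow> real"
  assumes X [measurable]: "X \<in> borel_measurable M" and nonneg: "\<And>\<omega>. 0 \<le> X \<omega>"
  defines "F \<equiv> \<lambda>\<theta>. \<integral>\<omega>. 1 - exp (- (\<theta> * X \<omega>)) \<partial>M"
  shows "\<And>\<theta>. 0 \<le> \<theta> \<Longrightarrow> integrable M (\<lambda>\<omega>. exp (- (\<theta> * X \<omega>)))"
    and "continuous_on {0..} F"
    and "\<And>\<theta> \<theta>'. 0 \<le> \<theta> \<Longrightarrow> \<theta> \<le> \<theta>' \<Longrightarrow> F \<theta> \<le> F \<theta>'"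
    and "\<not> (AE \<omega> in M. X \<omega> = 0) \<Longrightarrow> 0 < h \<Longrightarrow> \<exists>\<kappa>>0. \<forall>\<theta>. 0 \<le> \<theta> \<longrightarrow> \<theta> \<le> T \<longrightarrow> F \<theta> + \<kappa> \<le> F (\<theta> + h)"
proof -
  have unit: "0 \<le> exp (- (\<theta> * X \<omega>)) \<and> exp (- (\<theta> * X \<omega>)) \<le> 1" if "0 \<le> \<theta>" for \<theta> \<omega>
    using that nonneg by simp
  show int: "integrable M (\<lambda>\<omega>. exp (- (\<theta> * X \<omega>)))" if "0 \<le> \<theta>" for \<theta>
    by (rule integrable_const_bound[where B = 1]) (use unit[OF that] in auto)
  show "continuous_on {0..} F"
    unfolding continuous_on_sequentially
  proof (intro allI ballI impI, elim conjE)
    fix x :: "nat \<Rightarrow> real" and a assume a: "a \<in> {0..}" and x: "\<forall>n. x n \<in> {0..}" "x \<longlonglongrightarrow> a"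
    have "(\<lambda>n. \<integral>\<omega>. 1 - exp (- (x n * X \<omega>)) \<partial>M) \<longlonglongrightarrow> (\<integral>\<omega>. 1 - exp (- (a * X \<omega>)) \<partial>M)"
    proof (rule integral_dominated_convergence[where w = "\<lambda>_. 1"])
      show "AE \<omega> in M. (\<lambda>n. 1 - exp (- (x n * X \<omega>))) \<longlonglongrightarrow> 1 - exp (- (a * X \<omega>))"
        by (intro AE_I2 tendsto_intros x)
      show "AE \<omega> in M. norm (1 - exp (- (x n * X \<omega>))) \<le> 1" for n
        using unit[of "x n"] x(1) by (intro AE_I2) (simp add: abs_le_iff)
    qed auto
    then show "(F \<circ> x) \<longlonglongrightarrow> F a" by (simp add: F_def o_def)
  qed
  show "F \<theta> \<le> F \<theta>'" if "0 \<le> \<theta>" "\<theta> \<le> \<theta>'" for \<theta> \<theta>'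
    unfolding F_def using int[of \<theta>] int[of \<theta>'] that nonneg
    by (intro integral_mono) (auto intro: mult_right_mono)
  assume nontrivial: "\<not> (AE \<omega> in M. X \<omega> = 0)" and h: "0 < h"
  define T' where "T' = max 0 T"
  define g where "g \<omega> = exp (- (T' * X \<omega>)) * (1 - exp (- (h * X \<omega>)))" for \<omega>
  have g_nonneg: "0 \<le> g \<omega>" for \<omega> using h nonneg by (simp add: g_def)
  have g_int: "integrable M g"
  proof (rule integrable_const_bound[where B = 1])
    have "g \<omega> \<le> 1 * 1" for \<omega>
      unfolding g_def using unit[of T' \<omega>] unit[of h \<omega>] h by (intro mult_mono) (auto simp: T'_def)
    then show "AE \<omega> in M. norm (g \<omega>) \<le> 1" using g_nonneg by simp
  qed (unfold g_def[abs_def], measurable)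
  have "(\<integral>\<omega>. g \<omega> \<partial>M) \<noteq> 0"
  proof
    assume "(\<integral>\<omega>. g \<omega> \<partial>M) = 0"
    then have "AE \<omega> in M. g \<omega> = 0"
      by (subst integral_nonneg_eq_0_iff_AE[symmetric]) (use g_int g_nonneg in auto)
    then have "AE \<omega> in M. X \<omega> = 0" by eventually_elim (use h in \<open>auto simp: g_def\<close>)
    then show False using nontrivial by simp
  qed
  then have "(\<integral>\<omega>. g \<omega> \<partial>M) > 0" using g_nonneg by (simp add: less_le)
  moreover have "F \<theta> + (\<integral>\<omega>. g \<omega> \<partial>M) \<le> F (\<theta> + h)" if \<theta>: "0 \<le> \<theta>" "\<theta> \<le> T" for \<theta>
  proof -
    have "(\<integral>\<omega>. g \<omega> \<partial>M) \<le> (\<integral>\<omega>. exp (- (\<theta> * X \<omega>)) - exp (- ((\<theta> + h) * X \<omega>)) \<partial>M)"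
    proof (rule integral_mono[OF g_int])
      show "integrable M (\<lambda>\<omega>. exp (- (\<theta> * X \<omega>)) - exp (- ((\<theta> + h) * X \<omega>)))"
        using int[of \<theta>] int[of "\<theta> + h"] \<theta> h by auto
      fix \<omega>
      have "exp (- (T' * X \<omega>)) \<le> exp (- (\<theta> * X \<omega>))"
        using \<theta> nonneg by (simp add: T'_def mult_right_mono)
      then have "g \<omega> \<le> exp (- (\<theta> * X \<omega>)) * (1 - exp (- (h * X \<omega>)))"
        unfolding g_def using unit[of h \<omega>] h by (intro mult_right_mono) auto
      also have "\<dots> = exp (- (\<theta> * X \<omega>)) - exp (- ((\<theta> + h) * X \<omega>))"
        by (simp add: right_diff_distrib mult_exp_exp distrib_right)
      finally show "g \<omega> \<le> exp (- (\<theta> * X \<omega>)) - exp (- ((\<theta> + h) * X \<omega>))" .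
    qed
    also have "\<dots> = F (\<theta> + h) - F \<theta>"
      unfolding F_def using int[of \<theta>] int[of "\<theta> + h"] \<theta> h by simp
    finally show ?thesis by simp
  qed
  ultimately show "\<exists>\<kappa>>0. \<forall>\<theta>. 0 \<le> \<theta> \<longrightarrow> \<theta> \<le> T \<longrightarrow> F \<theta> + \<kappa> \<le> F (\<theta> + h)" by blast
qed

text \<open>An error that tends to 0 in the value of \<open>F\<close> can be moved into its argument: the
  intermediate value theorem provides the argument, and the uniform increase shows that it is
  close to the original one. This turns the asymptotic statement into the exact identity with
  a deterministic correction.\<close>

lemma (in prob_space) laplace_correction:
  fixes X :: "'a \<Rightarrow> real" and p \<theta> :: "nat \<Rightarrow> real"
  assumes X: "X \<in> borel_measurable M" and nonneg: "\<And>\<omega>. 0 \<le> X \<omega>"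
    and nontrivial: "\<not> (AE \<omega> in M. X \<omega> = 0)"
  defines "F \<equiv> \<lambda>\<theta>. \<integral>\<omega>. 1 - exp (- (\<theta> * X \<omega>)) \<partial>M"
  assumes p: "\<And>n. 0 \<le> p n" and \<theta>: "\<And>n. 0 \<le> \<theta> n" "\<And>n. \<theta> n \<le> T"
    and lim: "(\<lambda>n. p n - F (\<theta> n)) \<longlonglongrightarrow> 0"
  shows "\<exists>\<delta>. \<delta> \<longlonglongrightarrow> 0 \<and> (\<forall>\<^sub>F n in sequentially. p n = F (\<theta> n + \<delta> n))"
proof -
  have F: "(\<integral>\<omega>. 1 - exp (- (\<theta> * X \<omega>)) \<partial>M) = F \<theta>" for \<theta> by (simp only: F_def)
  note L = laplace_deficit[OF X nonneg, unfolded F]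
  have T: "T \<ge> 0" using \<theta>[of 0] by simp
  define x where "x n = (SOME a. 0 \<le> a \<and> a \<le> T + 1 \<and> F a = p n)" for n
  obtain \<kappa> where \<kappa>: "\<kappa> > 0" "\<And>\<theta>. 0 \<le> \<theta> \<Longrightarrow> \<theta> \<le> T \<Longrightarrow> F \<theta> + \<kappa> \<le> F (\<theta> + 1)"
    using L(4)[OF nontrivial, of 1 T] by auto
  have "\<forall>\<^sub>F n in sequentially. p n - F (\<theta> n) < \<kappa>"
    using order_tendstoD(2)[OF lim \<kappa>(1)] .
  then have x: "\<forall>\<^sub>F n in sequentially. 0 \<le> x n \<and> x n \<le> T + 1 \<and> F (x n) = p n"
  proof eventually_elim
    case (elim n)
    have "p n \<le> F (\<theta> n) + \<kappa>" using elim by simp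
    also have "\<dots> \<le> F (\<theta> n + 1)" by (rule \<kappa>(2)) (use \<theta> in auto)
    also have "\<dots> \<le> F (T + 1)" by (rule L(3)) (use \<theta>[of n] in auto)
    finally have up: "p n \<le> F (T + 1)" .
    have "F 0 \<le> p n" using p[of n] by (simp add: F_def)
    moreover have "continuous_on {0..T + 1} F" by (rule continuous_on_subset[OF L(2)]) auto
    ultimately have "\<exists>a. 0 \<le> a \<and> a \<le> T + 1 \<and> F a = p n" using IVT'[of F 0 "p n" "T + 1"] up T by auto
    then show ?case unfolding x_def by (rule someI_ex)
  qed
  have "(\<lambda>n. x n - \<theta> n) \<longlonglongrightarrow> 0"
  proof (rule tendstoI)
    fix h :: real assume h: "h > 0"
    obtain \<kappa> where \<kappa>: "\<kappa> > 0" "\<And>\<theta>. 0 \<le> \<theta> \<Longrightarrow> \<theta> \<le> T + 1 \<Longrightarrow> F \<theta> + \<kappa> \<le> F (\<theta> + h)"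
      using L(4)[OF nontrivial h, of "T + 1"] by auto
    have "\<forall>\<^sub>F n in sequentially. \<bar>p n - F (\<theta> n)\<bar> < \<kappa>"
      using tendstoD[OF lim \<kappa>(1)] by (simp add: dist_real_def)
    with x show "\<forall>\<^sub>F n in sequentially. dist (x n - \<theta> n) 0 < h"
    proof eventually_elim
      case (elim n)
      have "\<not> x n \<ge> \<theta> n + h"
      proof
        assume "x n \<ge> \<theta> n + h"
        then have "F (\<theta> n + h) \<le> F (x n)" by (intro L(3)) (use \<theta>[of n] h in auto)
        moreover have "F (\<theta> n) + \<kappa> \<le> F (\<theta> n + h)" by (rule \<kappa>(2)) (use \<theta>[of n] in auto)
        ultimately show False using elim by auto
      qed
      moreover have "\<not> \<theta> n \<ge> x n + h"
      proof
        assume "\<theta> n \<ge> x n + h"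
        then have "F (x n + h) \<le> F (\<theta> n)" by (intro L(3)) (use elim h in auto)
        moreover have "F (x n) + \<kappa> \<le> F (x n + h)" by (rule \<kappa>(2)) (use elim in auto)
        ultimately show False using elim by auto
      qed
      ultimately show ?case by (auto simp: dist_real_def)
    qed
  qed
  moreover have "\<forall>\<^sub>F n in sequentially. p n = F (\<theta> n + (x n - \<theta> n))"
    using x by eventually_elim simp
  ultimately show ?thesis by blast
qed

lemma (in catalytic) Winf_nontrivial: "\<not> (AE t in TM. Winf t = 0)"
proof
  assume "AE t in TM. Winf t = 0"
  with W_converges have "AE t in TM. t \<in> {t. vanishes 0 t}"
    by eventually_elim (auto simp: vanishes_def)
  then have "prob {t. vanishes 0 t} = 1"
    using prob_Collect_eq_1[of "vanishes 0"] vanishes_measurable by simp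
  then show False using vanishes_prob_less by simp
qed

context cbrw
begin

definition input_tree :: "'a \<Rightarrow> tree" where
  "input_tree \<omega> = (\<lambda>u. (N u \<omega>, \<xi> u \<omega>))"

lemma measurable_input: "(\<lambda>\<omega>. (N u \<omega>, \<xi> u \<omega>)) \<in> measurable P (count_space UNIV)"
  using indep_input by (auto simp: indep_vars_def)

lemma measurable_input_tree: "input_tree \<in> measurable P (tree_measure offs step)"
  unfolding input_tree_def[abs_def]
  by (rule tree_space.measurable_to_TM) (rule measurable_input)

lemma distr_input_tree: "distr P (tree_measure offs step) input_tree = tree_measure offs step"
proof -
  have "distr P (\<Pi>\<^sub>M u\<in>UNIV. count_space UNIV) (\<lambda>\<omega>. \<lambda>u\<in>UNIV. (N u \<omega>, \<xi> u \<omega>))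
      = (\<Pi>\<^sub>M u\<in>UNIV. distr P (count_space UNIV) (\<lambda>\<omega>. (N u \<omega>, \<xi> u \<omega>)))"
    using indep_input measurable_input by (subst (asm) indep_vars_iff_distr_eq_PiM') auto
  then have "distr P (\<Pi>\<^sub>M u\<in>UNIV. count_space UNIV) input_tree = tree_measure offs step"
    by (simp add: law_input tree_measure_def restrict_UNIV input_tree_def[abs_def])
  moreover have "distr P (\<Pi>\<^sub>M u\<in>UNIV. count_space UNIV) input_tree = distr P (tree_measure offs step) input_tree"
    unfolding tree_measure_def by (intro distr_cong refl sets_PiM_cong) auto
  ultimately show ?thesis by simp
qed

lemma measure_input_tree:
  assumes "{t. Q t} \<in> sets (tree_measure offs step)"
  shows "measure P {\<omega> \<in> space P. Q (input_tree \<omega>)} = measure (tree_measure offs step) {t. Q t}"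
proof -
  have "measure (tree_measure offs step) {t. Q t} = measure (distr P (tree_measure offs step) input_tree) {t. Q t}"
    by (simp only: distr_input_tree)
  also have "\<dots> = measure P (input_tree -` {t. Q t} \<inter> space P)"
    by (rule measure_distr[OF measurable_input_tree assms])
  also have "input_tree -` {t. Q t} \<inter> space P = {\<omega> \<in> space P. Q (input_tree \<omega>)}" by auto
  finally show ?thesis by simp
qed

lemma AE_input_tree: "AE t in tree_measure offs step. Q t \<Longrightarrow> AE \<omega> in P. Q (input_tree \<omega>)"
  by (rule AE_distrD[OF measurable_input_tree, of Q, unfolded distr_input_tree])

lemma integral_input_tree:
  fixes f :: "tree \<Rightarrow> real"
  assumes "f \<in> borel_measurable (tree_measure offs step)"
  shows "(\<integral>t. f t \<partial>tree_measure offs step) = (\<integral>\<omega>. f (input_tree \<omega>) \<partial>P)"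
  using integral_distr[OF measurable_input_tree assms] by (simp add: distr_input_tree)

lemma set_gen_input: "set (gen n 0 (input_tree \<omega>)) = position (\<lambda>u. \<xi> u \<omega>) ` particles (\<lambda>u. N u \<omega>) (\<lambda>u. \<xi> u \<omega>) n"
  unfolding set_gen by (auto simp: input_tree_def particles_def alive_eq_alive_from)

lemma M_eq: "M n \<omega> = (SUP c\<in>set (gen n 0 (input_tree \<omega>)). ereal (real_of_int c))"
  unfolding M_def rightmost_def set_gen_input by (simp add: image_image)

lemma M_gt_iff: "M n \<omega> - ereal b > ereal y \<longleftrightarrow> (\<exists>c\<in>set (gen n 0 (input_tree \<omega>)). \<lfloor>b + y\<rfloor> < c)"
proof -
  have "M n \<omega> - ereal b > ereal y \<longleftrightarrow> ereal (b + y) < M n \<omega>"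
    by (cases "M n \<omega>") auto
  also have "\<dots> \<longleftrightarrow> (\<exists>c\<in>set (gen n 0 (input_tree \<omega>)). b + y < real_of_int c)"
    unfolding M_eq by (simp add: less_SUP_iff)
  finally show ?thesis by (simp add: floor_less_iff)
qed

lemma M_eq_iff: "M n \<omega> - ereal (real_of_int b) = ereal (real_of_int y) \<longleftrightarrow>
  (\<exists>c\<in>set (gen n 0 (input_tree \<omega>)). b + y - 1 < c) \<and> \<not> (\<exists>c\<in>set (gen n 0 (input_tree \<omega>)). b + y < c)"
proof -
  let ?S = "set (gen n 0 (input_tree \<omega>))"
  have "M n \<omega> - ereal (real_of_int b) = ereal (real_of_int y) \<longleftrightarrow> M n \<omega> = ereal (real_of_int (b + y))"
    by (cases "M n \<omega>") auto
  also have "\<dots> \<longleftrightarrow> (\<exists>c\<in>?S. b + y - 1 < c) \<and> \<not> (\<exists>c\<in>?S. b + y < c)"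
  proof
    assume M: "M n \<omega> = ereal (real_of_int (b + y))"
    then have "ereal (real_of_int (b + y - 1)) < M n \<omega>" "\<not> ereal (real_of_int (b + y)) < M n \<omega>" by auto
    then show "(\<exists>c\<in>?S. b + y - 1 < c) \<and> \<not> (\<exists>c\<in>?S. b + y < c)"
      unfolding M_eq less_SUP_iff by (simp only: less_ereal.simps of_int_less_iff simp_thms)
  next
    assume *: "(\<exists>c\<in>?S. b + y - 1 < c) \<and> \<not> (\<exists>c\<in>?S. b + y < c)"
    then obtain c where "c \<in> ?S" "b + y - 1 < c" "\<not> b + y < c" by blast
    then have mem: "b + y \<in> ?S" by (metis linorder_cases zle_diff1_eq not_le)
    show "M n \<omega> = ereal (real_of_int (b + y))"
      unfolding M_eq
    proof (rule antisym)
      show "(SUP c\<in>?S. ereal (real_of_int c)) \<le> ereal (real_of_int (b + y))"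
        using * by (intro SUP_least) (auto simp: not_less)
    qed (rule SUP_upper[OF mem])
  qed
  finally show ?thesis .
qed

lemma survival_iff: "\<omega> \<in> space P \<Longrightarrow> \<omega> \<in> survival \<longleftrightarrow> \<not> tree_space.extinct 0 (input_tree \<omega>)"
proof -
  assume "\<omega> \<in> space P"
  then have "\<omega> \<in> survival \<longleftrightarrow> (\<exists>\<^sub>\<infinity>n. \<exists>u\<in>particles (\<lambda>u. N u \<omega>) (\<lambda>u. \<xi> u \<omega>) n. position (\<lambda>u. \<xi> u \<omega>) u = 0)"
    by (simp add: survival_def origin_visited_io_def)
  also have "\<dots> \<longleftrightarrow> (\<exists>\<^sub>F n in sequentially. 0 \<in> set (gen n 0 (input_tree \<omega>)))"
    unfolding set_gen_input cofinite_eq_sequentially image_iff by (simp only: eq_commute)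
  finally show ?thesis by (simp add: tree_space.extinct_def frequently_def)
qed

end

theorem theorem1p2:
  fixes P :: "'a measure" and offs :: "nat pmf" and step :: "int pmf"
    and N :: "nat list \<Rightarrow> 'a \<Rightarrow> nat" and \<xi> :: "nat list \<Rightarrow> 'a \<Rightarrow> int"
    and m r t0 \<alpha> :: real
  assumes cbrw: "cbrw P offs step N \<xi>"
    and irreducible: "irreducible_walk step"
    and finite_mean: "integrable (measure_pmf offs) real"
    and m: "m = measure_pmf.expectation offs real"
    and supercritical: "m * (1 - q_esc step) > 1"
    and r: "r > 0" "m * return_laplace step r = 1"
    and zeta_pos: "zeta step > 0"
    and t0: "t0 > 0" "ereal t0 < zeta step" "psi step t0 = ereal r"
    and \<alpha>: "\<alpha> = real_of_ereal (psi step t0) / t0"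
    and second_moment: "integrable (measure_pmf offs) (\<lambda>k. (real k)\<^sup>2)"
    and aperiodic: "aperiodic_walk step"
  shows "\<exists>(c::real) (\<Lambda> :: 'a \<Rightarrow> real).
      c > 0 \<and> \<Lambda> \<in> borel_measurable P \<and> (\<forall>\<omega>\<in>space P. \<Lambda> \<omega> \<ge> 0) \<and>
      (AE \<omega> in P. \<Lambda> \<omega> > 0 \<longleftrightarrow> \<omega> \<in> cbrw.survival P N \<xi>) \<and>
      (\<forall>y::real. \<exists>\<epsilon> :: nat \<Rightarrow> real. \<epsilon> \<longlonglongrightarrow> 0 \<and>
        (\<forall>\<^sub>F n in sequentially.
          measure P {\<omega> \<in> space P. cbrw.M N \<xi> n \<omega> - ereal (\<alpha> * real n) > ereal y} =
          (\<integral>\<omega>. 1 - exp (- c * exp (- t0 * y) * (exp (t0 * frac (\<alpha> * real n + y)) + \<epsilon> n) * \<Lambda> \<omega>) \<partial>P))) \<and>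
      (\<forall>(n :: nat \<Rightarrow> nat) (s::real).
        filterlim n at_top sequentially \<longrightarrow> 0 \<le> s \<longrightarrow> s < 1 \<longrightarrow>
        (\<lambda>j. frac (\<alpha> * real (n j))) \<longlonglongrightarrow> s \<longrightarrow>
        (\<forall>y::int.
          (\<lambda>j. measure P {\<omega> \<in> space P.
                 cbrw.M N \<xi> (n j) \<omega> - ereal (real_of_int \<lfloor>\<alpha> * real (n j)\<rfloor>) = ereal (real_of_int y)})
          \<longlonglongrightarrow> (\<integral>\<omega>. exp (- c * exp (- t0 * (real_of_int y - s)) * \<Lambda> \<omega>)
                     - exp (- c * exp (- t0 * (real_of_int y - 1 - s)) * \<Lambda> \<omega>) \<partial>P)))"
proof -
  interpret C: cbrw P offs step N \<xi> by (rule cbrw)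
  have psi_t0: "psi step t0 < \<infinity>" using t0(3) by simp
  have exp_t0: "(\<integral>z. exp (t0 * real_of_int z) \<partial>measure_pmf step) = exp r"
  proof -
    let ?L = "\<integral>z. exp (t0 * real_of_int z) \<partial>measure_pmf step"
    have "ln ?L = r" using psi_finite(2)[OF psi_t0] t0(3) by simp
    moreover have "0 \<le> ?L" by (rule Bochner_Integration.integral_nonneg) simp
    ultimately have "0 < ?L" using r(1) ln_0 by (metis less_le less_irrefl)
    then show ?thesis using \<open>ln ?L = r\<close> by (metis exp_ln)
  qed
  obtain t1 where t1: "t0 < t1" "psi step t1 < \<infinity>"
    using t0(2) unfolding zeta_def less_Sup_iff by auto
  have laplace: "return_laplace step r = exp (- r) * walk_mean step (hit_gf step (exp (- r))) 0"
    using r(1) by (intro return_laplace_eq) simp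
  interpret K: catalytic step offs m r t0 t1
    by unfold_locales
       (use r t0 t1 psi_finite(1)[OF psi_t0] psi_finite(1)[OF t1(2)] exp_t0 irreducible_span[OF irreducible]
         laplace aperiodic_eq[OF aperiodic] finite_mean m second_moment supercritical q_esc_eq[of step] in simp_all)
  have speed: "K.speed = \<alpha>" unfolding K.speed_def \<alpha> t0(3) by simp
  define \<Lambda> where "\<Lambda> \<omega> = K.Winf (C.input_tree \<omega>)" for \<omega>
  define X where "X \<omega> = K.\<beta> * \<Lambda> \<omega>" for \<omega>
  define F where "F \<theta> = (\<integral>\<omega>. 1 - exp (- (\<theta> * X \<omega>)) \<partial>P)" for \<theta>
  have \<Lambda>_meas: "\<Lambda> \<in> borel_measurable P"
    unfolding \<Lambda>_def by (rule measurable_compose[OF C.measurable_input_tree K.measurable_Winf])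
  have \<Lambda>_nonneg: "0 \<le> \<Lambda> \<omega>" for \<omega> by (simp add: \<Lambda>_def K.Winf_nonneg)
  have X: "X \<in> borel_measurable P" "\<And>\<omega>. 0 \<le> X \<omega>"
    using \<Lambda>_meas \<Lambda>_nonneg K.beta_pos by (auto simp: X_def[abs_def])
  have survival: "AE \<omega> in P. \<Lambda> \<omega> > 0 \<longleftrightarrow> \<omega> \<in> C.survival"
    using C.AE_input_tree[OF K.Winf_pos_iff_survival] AE_space
    by eventually_elim (simp add: \<Lambda>_def C.survival_iff)
  have nontrivial: "\<not> (AE \<omega> in P. X \<omega> = 0)"
  proof
    assume "AE \<omega> in P. X \<omega> = 0"
    then have "AE \<omega> in P. K.Winf (C.input_tree \<omega>) = 0"
      using K.beta_pos by (simp add: X_def \<Lambda>_def)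
    then have "AE t in distr P K.TM C.input_tree. K.Winf t = 0"
      using measurable_sets[OF K.measurable_Winf, of "{0}"]
      by (subst AE_distr_iff[OF C.measurable_input_tree]) (auto simp: vimage_def)
    then show False using K.Winf_nontrivial unfolding C.distr_input_tree by blast
  qed
  have unit: "1 - exp (- (\<theta> * X \<omega>)) \<le> 1" for \<theta> \<omega> by simp
  have limit: "(\<lambda>n. measure P {\<omega> \<in> space P. \<exists>c\<in>set (gen n 0 (C.input_tree \<omega>)). k n < c}
      - F (exp (- t0 * (real_of_int (k n) - \<alpha> * real n)))) \<longlonglongrightarrow> 0"
    if "\<And>n. \<bar>real_of_int (k n) - \<alpha> * real n\<bar> \<le> B" for k B
  proof -
    have "measure P {\<omega> \<in> space P. \<exists>c\<in>set (gen n 0 (C.input_tree \<omega>)). k n < c}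
        = measure K.TM {t. \<exists>c\<in>set (gen n 0 t). k n < c}" for n
      by (rule C.measure_input_tree) (rule K.pred_gen)
    moreover have "F \<theta> = (\<integral>t. 1 - exp (- (\<theta> * K.\<beta> * K.Winf t)) \<partial>K.TM)" for \<theta>
      unfolding F_def X_def \<Lambda>_def
      by (subst C.integral_input_tree) (auto simp: mult.assoc)
    ultimately show ?thesis using K.max_limit[of k B] that unfolding speed by simp
  qed
  have partA: "\<exists>\<epsilon> :: nat \<Rightarrow> real. \<epsilon> \<longlonglongrightarrow> 0 \<and>
        (\<forall>\<^sub>F n in sequentially.
          measure P {\<omega> \<in> space P. C.M n \<omega> - ereal (\<alpha> * real n) > ereal y} =
          (\<integral>\<omega>. 1 - exp (- K.\<beta> * exp (- t0 * y) * (exp (t0 * frac (\<alpha> * real n + y)) + \<epsilon> n) * \<Lambda> \<omega>) \<partial>P))"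
    for y :: real
  proof -
    define k where "k n = \<lfloor>\<alpha> * real n + y\<rfloor>" for n
    define \<theta> where "\<theta> n = exp (- t0 * y) * exp (t0 * frac (\<alpha> * real n + y))" for n
    define p where "p n = measure P {\<omega> \<in> space P. C.M n \<omega> - ereal (\<alpha> * real n) > ereal y}" for n
    have frac: "frac (\<alpha> * real n + y) = \<alpha> * real n + y - real_of_int (k n)" for n
      by (simp add: k_def frac_def)
    have kb: "\<bar>real_of_int (k n) - \<alpha> * real n\<bar> \<le> \<bar>y\<bar> + 1" for n
      using frac[of n] frac_ge_0[of "\<alpha> * real n + y"] frac_lt_1[of "\<alpha> * real n + y"] by linarith
    have \<theta>_eq: "exp (- t0 * (real_of_int (k n) - \<alpha> * real n)) = \<theta> n" for n
      unfolding \<theta>_def mult_exp_exp frac by (simp add: algebra_simps)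
    have lim: "(\<lambda>n. p n - F (\<theta> n)) \<longlonglongrightarrow> 0"
      using limit[of k, OF kb] unfolding \<theta>_eq unfolding p_def C.M_gt_iff k_def .
    have bound: "\<theta> n \<le> exp (- t0 * y) * exp t0" for n
      unfolding \<theta>_def using t0(1) frac_lt_1[of "\<alpha> * real n + y"] by (simp add: mult_left_le)
    have "\<exists>\<delta>. \<delta> \<longlonglongrightarrow> 0 \<and> (\<forall>\<^sub>F n in sequentially. p n = (\<integral>\<omega>. 1 - exp (- ((\<theta> n + \<delta> n) * X \<omega>)) \<partial>P))"
    proof (rule C.laplace_correction[OF X nontrivial])
      show "0 \<le> p n" for n by (simp add: p_def)
      show "0 \<le> \<theta> n" for n by (simp add: \<theta>_def)
      show "(\<lambda>n. p n - (\<integral>\<omega>. 1 - exp (- (\<theta> n * X \<omega>)) \<partial>P)) \<longlonglongrightarrow> 0" using lim by (simp only: F_def)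
    qed (rule bound)
    then obtain \<delta> where \<delta>: "\<delta> \<longlonglongrightarrow> 0" "\<forall>\<^sub>F n in sequentially. p n = (\<integral>\<omega>. 1 - exp (- ((\<theta> n + \<delta> n) * X \<omega>)) \<partial>P)"
      by blast
    show ?thesis
    proof (intro exI conjI)
      have "(\<lambda>n. \<delta> n / exp (- t0 * y)) \<longlonglongrightarrow> 0 / exp (- t0 * y)" by (intro tendsto_divide \<delta> tendsto_const) simp
      then show "(\<lambda>n. \<delta> n / exp (- t0 * y)) \<longlonglongrightarrow> 0" by simp
      have "(\<theta> n + \<delta> n) * X \<omega> = - (- K.\<beta> * exp (- t0 * y) * (exp (t0 * frac (\<alpha> * real n + y)) + \<delta> n / exp (- t0 * y)) * \<Lambda> \<omega>)" for n \<omega>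
        unfolding \<theta>_def X_def by (simp add: field_simps)
      with \<delta>(2) show "\<forall>\<^sub>F n in sequentially.
          measure P {\<omega> \<in> space P. C.M n \<omega> - ereal (\<alpha> * real n) > ereal y} =
          (\<integral>\<omega>. 1 - exp (- K.\<beta> * exp (- t0 * y) * (exp (t0 * frac (\<alpha> * real n + y)) + \<delta> n / exp (- t0 * y)) * \<Lambda> \<omega>) \<partial>P)"
        unfolding p_def by (simp only: minus_minus)
    qed
  qed
  have partB: "(\<lambda>j. measure P {\<omega> \<in> space P. C.M (n j) \<omega> - ereal (real_of_int \<lfloor>\<alpha> * real (n j)\<rfloor>) = ereal (real_of_int y)})
          \<longlonglongrightarrow> (\<integral>\<omega>. exp (- K.\<beta> * exp (- t0 * (real_of_int y - s)) * \<Lambda> \<omega>)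
                     - exp (- K.\<beta> * exp (- t0 * (real_of_int y - 1 - s)) * \<Lambda> \<omega>) \<partial>P)"
    if n: "filterlim n at_top sequentially" and s: "(\<lambda>j. frac (\<alpha> * real (n j))) \<longlonglongrightarrow> s"
    for n :: "nat \<Rightarrow> nat" and s :: real and y :: int
  proof -
    define p where "p z i = measure P {\<omega> \<in> space P. \<exists>c\<in>set (gen i 0 (C.input_tree \<omega>)). \<lfloor>\<alpha> * real i\<rfloor> + z < c}" for z i
    define \<theta> where "\<theta> z = exp (- t0 * (real_of_int z - s))" for z
    have p_lim: "(\<lambda>j. p z (n j)) \<longlonglongrightarrow> F (\<theta> z)" for z
    proof -
      have dist: "\<bar>real_of_int (\<lfloor>\<alpha> * real i\<rfloor> + z) - \<alpha> * real i\<bar> \<le> \<bar>real_of_int z\<bar> + 1" for i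
        using frac_ge_0[of "\<alpha> * real i"] frac_lt_1[of "\<alpha> * real i"] unfolding frac_def by simp linarith
      have "(\<lambda>i. p z i - F (exp (- t0 * (real_of_int (\<lfloor>\<alpha> * real i\<rfloor> + z) - \<alpha> * real i)))) \<longlonglongrightarrow> 0"
        unfolding p_def by (rule limit[OF dist])
      from filterlim_compose[OF this n]
      have 1: "(\<lambda>j. p z (n j) - F (exp (- t0 * (real_of_int z - frac (\<alpha> * real (n j)))))) \<longlonglongrightarrow> 0"
        by (simp add: frac_def algebra_simps)
      have cont: "continuous_on {0..} F"
        unfolding F_def[abs_def] by (rule C.laplace_deficit(2)[OF X])
      have "(\<lambda>j. exp (- t0 * (real_of_int z - frac (\<alpha> * real (n j))))) \<longlonglongrightarrow> \<theta> z"
        unfolding \<theta>_def by (intro tendsto_intros s)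
      then have 2: "(\<lambda>j. F (exp (- t0 * (real_of_int z - frac (\<alpha> * real (n j)))))) \<longlonglongrightarrow> F (\<theta> z)"
        by (rule continuous_on_tendsto_compose[OF cont]) (auto simp: \<theta>_def)
      from tendsto_add[OF 1 2] show ?thesis by simp
    qed
    have meas: "{\<omega> \<in> space P. \<exists>c\<in>set (gen i 0 (C.input_tree \<omega>)). k < c} \<in> sets P" for i k
    proof -
      have "{\<omega> \<in> space P. \<exists>c\<in>set (gen i 0 (C.input_tree \<omega>)). k < c}
          = C.input_tree -` {t. \<exists>c\<in>set (gen i 0 t). k < c} \<inter> space P" by auto
      then show ?thesis
        by (simp only:) (rule measurable_sets[OF C.measurable_input_tree K.pred_gen])
    qed
    have "measure P {\<omega> \<in> space P. C.M i \<omega> - ereal (real_of_int \<lfloor>\<alpha> * real i\<rfloor>) = ereal (real_of_int y)} = p (y - 1) i - p y i" for i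
    proof -
      let ?A = "\<lambda>k. {\<omega> \<in> space P. \<exists>c\<in>set (gen i 0 (C.input_tree \<omega>)). k < c}"
      have "{\<omega> \<in> space P. C.M i \<omega> - ereal (real_of_int \<lfloor>\<alpha> * real i\<rfloor>) = ereal (real_of_int y)}
          = ?A (\<lfloor>\<alpha> * real i\<rfloor> + y - 1) - ?A (\<lfloor>\<alpha> * real i\<rfloor> + y)"
        unfolding C.M_eq_iff by blast
      moreover have "?A (\<lfloor>\<alpha> * real i\<rfloor> + y) \<subseteq> ?A (\<lfloor>\<alpha> * real i\<rfloor> + y - 1)"
      proof -
        have "k - 1 < c" if "k < c" for k c :: int using that by simp
        then show ?thesis by blast
      qed
      ultimately show ?thesis
        using C.finite_measure_Diff[OF meas meas] by (simp only: p_def add_diff_eq)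
    qed
    then have "(\<lambda>j. measure P {\<omega> \<in> space P. C.M (n j) \<omega> - ereal (real_of_int \<lfloor>\<alpha> * real (n j)\<rfloor>) = ereal (real_of_int y)})
       \<longlonglongrightarrow> F (\<theta> (y - 1)) - F (\<theta> y)"
      using tendsto_diff[OF p_lim[of "y - 1"] p_lim[of y]] by simp
    also have "F (\<theta> (y - 1)) - F (\<theta> y) = (\<integral>\<omega>. exp (- (\<theta> y * X \<omega>)) - exp (- (\<theta> (y - 1) * X \<omega>)) \<partial>P)"
    proof -
      have "integrable P (\<lambda>\<omega>. exp (- (\<theta> z * X \<omega>)))" for z
        by (rule C.laplace_deficit(1)[OF X]) (simp add: \<theta>_def)
      then show ?thesis unfolding F_def using C.prob_space by simp
    qed
    also have "\<dots> = (\<integral>\<omega>. exp (- K.\<beta> * exp (- t0 * (real_of_int y - s)) * \<Lambda> \<omega>)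
                     - exp (- K.\<beta> * exp (- t0 * (real_of_int y - 1 - s)) * \<Lambda> \<omega>) \<partial>P)"
      by (intro Bochner_Integration.integral_cong refl) (simp add: \<theta>_def X_def mult_ac)
    finally show ?thesis .
  qed
  show ?thesis
  proof (intro exI[of _ K.\<beta>] exI[of _ \<Lambda>] conjI ballI allI impI)
  qed (rule K.beta_pos \<Lambda>_meas \<Lambda>_nonneg survival partA partB; assumption)+
qed

end
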